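(* There exist constants $C>0$ and $N\ge0$ such that $$\|\mathrm{Op}^t_\hbar(a)u\|_{L^2(\mathbb{R}^n;\Omega^{1/2})}\le C|a|_{\widetilde S^0_f,N}\|u\|_{L^2(\mathbb{R}^n;\Omega^{1/2})}$$ for all $a\in\widetilde S^0_f$, all $u\in C_c^\infty(\mathbb{R}^n;\Omega^{1/2})$, all $t\in[0,1]$ and all $\hbar\in(0,1]$.
   Context: Points of $\mathbb{R}^n=\mathbb{R}\times\mathbb{R}^{n-1}$ are written $q=(r,\theta)$, dual variables $p=(\rho,\eta)$. Multiindices: $\alpha=(\alpha_0,\alpha')\in\mathbb{Z}_{\ge0}\times\mathbb{Z}_{\ge0}^{n-1}$, $|\alpha|=\alpha_0+|\alpha'|$. $\langle\rho\oplus\eta\rangle=(1+\rho^2+|\eta|^2)^{1/2}$. $f:\mathbb{R}\to[1,\infty)$ is a fixed smooth function with $\partial_r^j\log f\in L^\infty(\mathbb{R})$ for all $j\ge1$. For $m\in\mathbb{R}$, $\widetilde S^m_f$ is the set of $a\in C^\infty(\mathbb{R}^{2n})$ such that for every integer $N\ge0$ $$|a|_{\widetilde S^m_f,N}:=\sum_{|\alpha|+|\beta|\le N}\left\|\frac{(f(r)^{-1}\partial_\theta)^{\alpha'}(f(r)\partial_\eta)^{\beta'}\partial_r^{\alpha_0}\partial_\rho^{\beta_0}a}{\langle\rho\oplus f(r)^{-1}\eta\rangle^{m-|\beta|}}\right\|_{L^\infty(\mathbb{R}^{2n})}<\infty.$$ $C_c^\infty(\mathbb{R}^n;\Omega^{1/2})$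 denotes compactly supported smooth half-densities $v|dq|^{1/2}$; $L^2(\mathbb{R}^n;\Omega^{1/2})$ is its completion for $\langle u,v\rangle=\int u\overline v$. For $t\in[0,1]$, $$\mathrm{Op}^t_\hbar(a)(v|dq|^{1/2})=\frac1{(2\pi\hbar)^n}\int_{\mathbb{R}^{2n}}a(tq+(1-t)q',p)e^{ip\cdot(q-q')/\hbar}v(q')\,dq'\,dp\,|dq|^{1/2},$$ where one integrates first in $q'$ and then in $p$. *)

theory Defs
  imports "HOL-Analysis.Analysis" "HOL-Probability.Essential_Supremum"
begin

text \<open>
  The space \<open>\<real>^n = \<real> \<times> \<real>^(n-1)\<close> is rendered as \<^typ>\<open>real ^ 'n\<close> for a finite, linearly ordered index
  type, \<open>n = CARD('n)\<close>. The coordinate with the least index is \<open>r\<close> (resp. \<open>\<rho>\<close>), the remaining ones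
  are \<open>\<theta>\<close> (resp. \<open>\<eta>\<close>). All \<open>n \<ge> 1\<close> are covered; for \<open>n = 1\<close> there are no \<open>\<theta>\<close> coordinates.
  Phase space \<open>\<real>^(2n)\<close> consists of pairs \<open>(q, p)\<close>.
\<close>

type_synonym 'n phase = "(real ^ 'n) \<times> (real ^ 'n)"

definition r_idx :: "'n::{finite,linorder}"
  where "r_idx = Min UNIV"

definition theta_idxs :: "'n::{finite,linorder} list"
  where "theta_idxs = sorted_list_of_set (UNIV - {r_idx})"

subsection \<open>Smoothness\<close>

definition partial :: "'a::real_normed_vector \<Rightarrow> ('a \<Rightarrow> 'b::real_normed_vector) \<Rightarrow> 'a \<Rightarrow> 'b"
  where "partial b g x = vector_derivative (\<lambda>s. g (x + s *\<^sub>R b)) (at 0)"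

text \<open>\<open>C\<^sup>\<infinity>\<close>: every iterated partial derivative, in any order of the coordinate directions, is
  (Frechet) differentiable everywhere, hence also continuous.\<close>

definition smooth :: "('a::euclidean_space \<Rightarrow> 'b::real_normed_vector) \<Rightarrow> bool"
  where "smooth g \<longleftrightarrow>
    (\<forall>bs. set bs \<subseteq> Basis \<longrightarrow> (\<forall>x. foldr partial bs g differentiable (at x)))"

definition Linf_norm :: "('a::euclidean_space \<Rightarrow> 'b::real_normed_vector) \<Rightarrow> ennreal"
  where "Linf_norm g = esssup lborel (\<lambda>x. ennreal (norm (g x)))"

subsection \<open>The symbol classes\<close>

definition deriv_q :: "'n::finite \<Rightarrow> ('n phase \<Rightarrow> complex) \<Rightarrow> 'n phase \<Rightarrow> complex"
  where "deriv_q i = partial (axis i 1, 0)"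

definition deriv_p :: "'n::finite \<Rightarrow> ('n phase \<Rightarrow> complex) \<Rightarrow> 'n phase \<Rightarrow> complex"
  where "deriv_p i = partial (0, axis i 1)"

text \<open>The operators \<open>f(r)\<^sup>-\<^sup>1 \<partial>\<^sub>\<theta>\<close> and \<open>f(r) \<partial>\<^sub>\<eta>\<close> for a single coordinate.\<close>

definition scaled_deriv_theta ::
    "(real \<Rightarrow> real) \<Rightarrow> 'n::{finite,linorder} \<Rightarrow> ('n phase \<Rightarrow> complex) \<Rightarrow> 'n phase \<Rightarrow> complex"
  where "scaled_deriv_theta f i g = (\<lambda>(q, p). inverse (f (q $ r_idx)) *\<^sub>R deriv_q i g (q, p))"

definition scaled_deriv_eta ::
    "(real \<Rightarrow> real) \<Rightarrow> 'n::{finite,linorder} \<Rightarrow> ('n phase \<Rightarrow> complex) \<Rightarrow> 'n phase \<Rightarrow> complex"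
  where "scaled_deriv_eta f i g = (\<lambda>(q, p). f (q $ r_idx) *\<^sub>R deriv_p i g (q, p))"

text \<open>Powers of a family of operators with a multiindex in the \<open>\<theta>\<close> coordinates. The factors are
  composed in the order of the indices; on smooth functions the order is immaterial.\<close>

definition theta_power ::
    "('n::{finite,linorder} \<Rightarrow> 'x \<Rightarrow> 'x) \<Rightarrow> ('n \<Rightarrow> nat) \<Rightarrow> 'x \<Rightarrow> 'x"
  where "theta_power D \<alpha> = foldr (\<lambda>i. D i ^^ \<alpha> i) theta_idxs"

definition weighted_deriv ::
    "(real \<Rightarrow> real) \<Rightarrow> ('n::{finite,linorder} \<Rightarrow> nat) \<Rightarrow> ('n \<Rightarrow> nat) \<Rightarrow>
      ('n phase \<Rightarrow> complex) \<Rightarrow> 'n phase \<Rightarrow> complex"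
  where "weighted_deriv f \<alpha> \<beta> a =
    theta_power (scaled_deriv_theta f) \<alpha>
      (theta_power (scaled_deriv_eta f) \<beta>
        ((deriv_q r_idx ^^ \<alpha> r_idx) ((deriv_p r_idx ^^ \<beta> r_idx) a)))"

text \<open>\<open>\<langle>\<rho> \<oplus> f(r)\<^sup>-\<^sup>1 \<eta>\<rangle>\<close>\<close>

definition scaled_bracket :: "(real \<Rightarrow> real) \<Rightarrow> 'n::{finite,linorder} phase \<Rightarrow> real"
  where "scaled_bracket f = (\<lambda>(q, p).
    sqrt (1 + (p $ r_idx)\<^sup>2 + (\<Sum>i\<in>UNIV - {r_idx}. (inverse (f (q $ r_idx)) * p $ i)\<^sup>2)))"

abbreviation order_of :: "('n::finite \<Rightarrow> nat) \<Rightarrow> nat"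
  where "order_of \<alpha> \<equiv> sum \<alpha> UNIV"

definition symbol_seminorm ::
    "(real \<Rightarrow> real) \<Rightarrow> real \<Rightarrow> nat \<Rightarrow> ('n::{finite,linorder} phase \<Rightarrow> complex) \<Rightarrow> ennreal"
  where "symbol_seminorm f m N a =
    (\<Sum>(\<alpha>, \<beta>)\<in>{(\<alpha>, \<beta>). order_of \<alpha> + order_of \<beta> \<le> N}.
      Linf_norm (\<lambda>z. weighted_deriv f \<alpha> \<beta> a z /\<^sub>R scaled_bracket f z powr (m - real (order_of \<beta>))))"

text \<open>The sum above is not a junk value.\<close>

lemma finite_multiindices:
  "finite {(\<alpha>, \<beta>). order_of (\<alpha> :: 'n::finite \<Rightarrow> nat) + order_of (\<beta> :: 'n \<Rightarrow> nat) \<le> N}"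
proof (rule finite_subset)
  let ?F = "PiE (UNIV :: 'n set) (\<lambda>_. {..N})"
  have "\<alpha> i \<le> N" if "order_of \<alpha> \<le> N" for \<alpha> :: "'n \<Rightarrow> nat" and i
    using that member_le_sum[of i UNIV \<alpha>] by simp
  then show "{(\<alpha>, \<beta>). order_of (\<alpha> :: 'n \<Rightarrow> nat) + order_of (\<beta> :: 'n \<Rightarrow> nat) \<le> N} \<subseteq> ?F \<times> ?F"
    by (auto simp: PiE_UNIV_domain)
  show "finite (?F \<times> ?F)"
    by (intro finite_cartesian_product finite_PiE) auto
qed

definition symbol_class ::
    "(real \<Rightarrow> real) \<Rightarrow> real \<Rightarrow> ('n::{finite,linorder} phase \<Rightarrow> complex) set"
  where "symbol_class f m = {a. smooth a \<and> (\<forall>N. symbol_seminorm f m N a < \<infinity>)}"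

subsection \<open>Half-densities and quantization\<close>

text \<open>A half-density \<open>v |dq|\<^bsup>1/2\<^esup>\<close> on \<open>\<real>^n\<close> is represented by its coefficient \<open>v\<close>; the pairing
  \<open>\<integral> u \<bar>v\<close> of half-densities is the Lebesgue integral of the product of coefficients.\<close>

definition Cc_smooth :: "(real ^ 'n \<Rightarrow> complex) set"
  where "Cc_smooth = {v. smooth v \<and> compact (closure {q. v q \<noteq> 0})}"

definition L2 :: "(real ^ 'n \<Rightarrow> complex) set"
  where "L2 = {v. v \<in> borel_measurable lborel \<and> integrable lborel (\<lambda>q. (cmod (v q))\<^sup>2)}"

definition L2_norm :: "(real ^ 'n \<Rightarrow> complex) \<Rightarrow> real"
  where "L2_norm v = sqrt (\<integral>q. (cmod (v q))\<^sup>2 \<partial>lborel)"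

text \<open>An iterated integral, first over \<open>q'\<close> and then over \<open>p\<close>; the double integral need not
  converge absolutely.\<close>

definition Op :: "real \<Rightarrow> real \<Rightarrow> ('n::finite phase \<Rightarrow> complex) \<Rightarrow>
    (real ^ 'n \<Rightarrow> complex) \<Rightarrow> real ^ 'n \<Rightarrow> complex"
  where "Op t h a v q =
    complex_of_real (1 / (2 * pi * h) ^ CARD('n)) *
    (\<integral>p. (\<integral>q'. a (t *\<^sub>R q + (1 - t) *\<^sub>R q', p) *
        exp (\<i> * complex_of_real (p \<bullet> (q - q') / h)) * v q' \<partial>lborel) \<partial>lborel)"

end

theory Submission
  imports Defs "HOL-Computational_Algebra.Polynomial" "HOL-Probability.Characteristic_Functions"
begin

text \<open>
  Substituting \<open>h p\<close> for \<open>p\<close> reduces the bound to \<open>h = 1\<close> (\<open>Op_rescale\<close>), and since \<open>h \<le> 1\<close> it does not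
  increase the derivatives of the symbol. A finite seminorm of order \<open>0\<close> implies that each derivative in \<open>\<theta>\<close>
  costs at most a factor \<open>f r\<close> and that each derivative in \<open>\<eta>\<close> gains one, while those in \<open>r\<close> and \<open>\<rho>\<close> are
  bounded (\<open>symbol_seminorm_jet\<close>). This is the hypothesis of the Calderon-Vaillancourt theorem in
  coordinates that are rescaled by \<open>l = (1, f r, \<dots>, f r)\<close> at each point. The argument below proves that theorem in a
  way that allows the scales to vary from point to point.

  In one variable a function is the convolution of \<open>g - g'' / l\<^sup>2\<close> with the kernel \<open>l exp (- l \<bar>s\<bar>) / 2\<close>. Used
  in all position variables, with the scales taken at the integration variable \<open>z\<close>, this writes \<open>a (m, p)\<close> as a
  superposition over \<open>z\<close> of the products of \<open>exp (- l \<bar>m - z\<bar>)\<close>, with coefficients that depend on \<open>z\<close> and \<open>p\<close>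
  only (\<open>symbol_representation\<close>). The scales depend on \<open>z\<close> through its coordinate \<open>r\<close>, whose own scale is
  \<open>1\<close>; hence that coordinate can be integrated last and no error terms arise.

  For the operator, \<open>m = t x + (1 - t) y\<close>, and \<open>x\<close> has to be separated from \<open>y\<close>. With \<open>X = l (m - z)\<close> and
  \<open>S = l (x - y)\<close>, the product \<open>(1 + \<i> l (x - z)) (1 + \<i> l (y - z))\<close> is a quadratic polynomial in \<open>1 + \<i> X\<close> and \<open>S\<close> whose
  coefficients are bounded for \<open>t\<close> between \<open>0\<close> and \<open>1\<close> (\<open>green_split\<close>). Multiplying and dividing by it
  produces a window in \<open>x\<close> and a window in \<open>y\<close>, both centred at \<open>z\<close>. The powers of \<open>S\<close> become
  derivatives of the symbol in \<open>p\<close>, whose gain cancels the scale in \<open>S\<close>. The factors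
  \<open>(1 + \<i> X)^j exp (- \<bar>X\<bar>)\<close> are superpositions of plane waves in \<open>X\<close> with an integrable density
  (\<open>exp_kernel_waves\<close>), and each plane wave is a product of a function of \<open>x\<close>, one of \<open>y\<close> and one of \<open>z\<close>.

  The pairing of the image of \<open>u\<close> with \<open>v\<close> is then an integral over \<open>z\<close>, over the frequency of the
  plane wave and over \<open>p\<close> of a bounded function times a windowed Fourier transform of \<open>u\<close> times one of \<open>v\<close>.
  Bessel's inequality in \<open>p\<close> and the fact that the squares of the windows, times the
  Jacobian of the scales, have a constant integral over their centres
  (\<open>window_transform_L2\<close>) give the bilinear estimate \<open>pairing_bound\<close>, with a constant that depends on the
  dimension only. It uses at most \<open>4 n\<close> derivatives, two in each of the \<open>2 n\<close> variables.

  All of this presupposes a compactly supported symbol. A general symbol is multiplied by cutoffs whose scales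
  are chosen so that the derivative bounds are preserved uniformly (\<open>jet_bound_cutoff\<close>,
  \<open>cutoff_scale_admissible\<close>). The iterated integrals converge pointwise, because integration by parts in \<open>y\<close>
  yields integrable decay in \<open>p\<close> (\<open>quantize_tendsto\<close>), and Fatou's lemma carries the bound to the limit.
\<close>

section \<open>Calculus of iterated partial derivatives\<close>

abbreviation partials :: "'a::real_normed_vector list \<Rightarrow> ('a \<Rightarrow> 'b::real_normed_vector) \<Rightarrow> 'a \<Rightarrow> 'b"
  where "partials bs g \<equiv> foldr partial bs g"

lemma has_vector_derivative_along:
  assumes "(g has_derivative g') (at (x + s *\<^sub>R b))"
  shows "((\<lambda>s. g (x + s *\<^sub>R b)) has_vector_derivative g' b) (at s)"
proof -
  interpret bounded_linear g' using assms by (rule has_derivative_bounded_linear)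
  have "((\<lambda>s. x + s *\<^sub>R b) has_derivative (\<lambda>h. h *\<^sub>R b)) (at s)"
    by (auto intro!: derivative_eq_intros)
  from has_derivative_compose[OF this assms] show ?thesis
    by (simp add: has_vector_derivative_def scaleR)
qed

lemma partial_eqI: "(g has_derivative g') (at x) \<Longrightarrow> partial b g x = g' b"
  unfolding partial_def
  by (rule vector_derivative_at) (use has_vector_derivative_along[of g g' x 0 b] in simp)

lemma partial_along:
  assumes "\<And>x. g differentiable (at x)"
  shows "((\<lambda>s. g (x + s *\<^sub>R b)) has_vector_derivative partial b g (x + s *\<^sub>R b)) (at s)"
proof -
  obtain g' where g': "(g has_derivative g') (at (x + s *\<^sub>R b))"
    using assms unfolding differentiable_def by blast
  show ?thesis
    using has_vector_derivative_along[OF g'] partial_eqI[OF g'] by simp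
qed

lemma smoothD: "smooth g \<Longrightarrow> g differentiable (at x)"
  unfolding smooth_def by (metis empty_set empty_subsetI foldr.simps(1) id_apply)

lemma smooth_partial: "smooth g \<Longrightarrow> b \<in> Basis \<Longrightarrow> smooth (partial b g)"
  unfolding smooth_def
proof (intro allI impI)
  fix bs :: "'a list" and x assume *: "\<forall>bs. set bs \<subseteq> Basis \<longrightarrow> (\<forall>x. partials bs g differentiable at x)" "b \<in> Basis" "set bs \<subseteq> Basis"
  then have "partials (bs @ [b]) g differentiable at x" by (metis Un_subset_iff empty_set insert_subset empty_subsetI list.simps(15) set_append)
  then show "partials bs (partial b g) differentiable at x" by simp
qed

lemma smooth_partials: "smooth g \<Longrightarrow> set bs \<subseteq> Basis \<Longrightarrow> smooth (partials bs g)"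
  by (induction bs) (auto simp: smooth_partial)

lemma smooth_continuous: "smooth g \<Longrightarrow> continuous_on A g"
  by (meson continuous_at_imp_continuous_on differentiable_imp_continuous_within smoothD)

text \<open>Smoothness is coinductive: any class of differentiable functions that is stable under
  partial derivatives consists of smooth functions.\<close>

lemma smooth_coinduct:
  assumes "g \<in> S" "\<And>g x. g \<in> S \<Longrightarrow> g differentiable (at x)"
    and "\<And>g b. g \<in> S \<Longrightarrow> b \<in> Basis \<Longrightarrow> partial b g \<in> S"
  shows "smooth g"
proof -
  have "set bs \<subseteq> Basis \<Longrightarrow> partials bs g \<in> S" for bs
    by (induction bs) (auto simp: assms)
  then show ?thesis unfolding smooth_def using assms(2) by blast
qed

lemma partial_add:
  "g differentiable (at x) \<Longrightarrow> h differentiable (at x) \<Longrightarrow>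
    partial b (\<lambda>x. g x + h x) x = partial b g x + partial b h x"
  unfolding frechet_derivative_works
  by (subst (1 2 3) partial_eqI) (auto intro: has_derivative_add)

lemma partial_scaleR:
  "g differentiable (at x) \<Longrightarrow> partial b (\<lambda>x. (c::real) *\<^sub>R g x) x = c *\<^sub>R partial b g x"
  unfolding frechet_derivative_works
  by (subst (1 2) partial_eqI) (auto intro: has_derivative_scaleR_right)

lemma partial_mult:
  fixes g h :: "'a::euclidean_space \<Rightarrow> 'b::real_normed_algebra"
  assumes "g differentiable (at x)" "h differentiable (at x)"
  shows "partial b (\<lambda>x. g x * h x) x = g x * partial b h x + partial b g x * h x"
  using assms unfolding frechet_derivative_works
  by (subst (1 2 3) partial_eqI) (auto intro: has_derivative_mult)

lemma smooth_add: assumes "smooth g" "smooth h" shows "smooth (\<lambda>x. g x + h x)"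
proof (rule smooth_coinduct[where S = "{\<lambda>x. g x + h x | g h. smooth g \<and> smooth h}"])
  fix k b assume "k \<in> {\<lambda>x. g x + h x | g h. smooth g \<and> smooth (h::'a\<Rightarrow>'b)}" and b: "b \<in> (Basis::'a set)"
  then obtain g h where k: "k = (\<lambda>x. g x + h x)" and s: "smooth g" "smooth h" by auto
  have "partial b k = (\<lambda>x. partial b g x + partial b h x)"
    by (auto simp: k fun_eq_iff s smoothD partial_add)
  then show "partial b k \<in> {\<lambda>x. g x + h x | g h. smooth g \<and> smooth h}"
    using s b smooth_partial by blast
qed (use assms in \<open>auto intro!: derivative_intros simp: smoothD\<close>)

lemma smooth_scaleR: assumes "smooth g" shows "smooth (\<lambda>x. (c::real) *\<^sub>R g x)"
proof (rule smooth_coinduct[where S = "{\<lambda>x. c *\<^sub>R g x | g. smooth g}"])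
  fix k b assume "k \<in> {\<lambda>x. c *\<^sub>R g x | g. smooth (g::'a\<Rightarrow>'b)}" and b: "b \<in> (Basis::'a set)"
  then obtain g where k: "k = (\<lambda>x. c *\<^sub>R g x)" and s: "smooth g" by auto
  have "partial b k = (\<lambda>x. c *\<^sub>R partial b g x)"
    by (auto simp: k fun_eq_iff s smoothD partial_scaleR)
  then show "partial b k \<in> {\<lambda>x. c *\<^sub>R g x | g. smooth g}"
    using s b smooth_partial by blast
qed (use assms in \<open>auto intro!: derivative_intros simp: smoothD\<close>)

inductive_set product_span :: "('a::euclidean_space \<Rightarrow> 'b::real_normed_algebra) set" where
  product: "smooth g \<Longrightarrow> smooth h \<Longrightarrow> (\<lambda>x. g x * h x) \<in> product_span"
| sum: "k \<in> product_span \<Longrightarrow> l \<in> product_span \<Longrightarrow> (\<lambda>x. k x + l x) \<in> product_span"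

lemma smooth_mult:
  fixes g h :: "'a::euclidean_space \<Rightarrow> 'b::real_normed_algebra"
  assumes "smooth g" "smooth h" shows "smooth (\<lambda>x. g x * h x)"
proof (rule smooth_coinduct)
  show "(\<lambda>x. g x * h x) \<in> product_span" by (rule product_span.product) fact+
  show d: "k differentiable at x" if "k \<in> product_span" for k :: "'a \<Rightarrow> 'b" and x
    using that by induction (auto intro!: derivative_intros simp: smoothD)
  show "partial b k \<in> product_span" if "k \<in> product_span" and b: "b \<in> Basis" for k :: "'a \<Rightarrow> 'b" and b
    using that(1)
  proof induction
    case (product g h)
    have "partial b (\<lambda>x. g x * h x) = (\<lambda>x. g x * partial b h x + partial b g x * h x)"
      by (simp add: fun_eq_iff partial_mult smoothD product)
    then show ?case using product b by (auto intro!: product_span.intros smooth_partial)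
  next
    case (sum k l)
    have "partial b (\<lambda>x. k x + l x) = (\<lambda>x. partial b k x + partial b l x)"
      by (simp add: fun_eq_iff partial_add d sum)
    then show ?case using sum by (auto intro: product_span.intros)
  qed
qed

lemma partials_add:
  "smooth g \<Longrightarrow> smooth h \<Longrightarrow> set bs \<subseteq> Basis \<Longrightarrow>
    partials bs (\<lambda>x. g x + h x) = (\<lambda>x. partials bs g x + partials bs h x)"
proof (induction bs)
  case (Cons b bs)
  then have IH: "partials bs (\<lambda>x. g x + h x) = (\<lambda>x. partials bs g x + partials bs h x)" by simp
  show ?case
    using partial_add[OF smoothD smoothD, of "partials bs g" "partials bs h" b] Cons.prems
    unfolding foldr.simps o_apply IH by (simp add: smooth_partials fun_eq_iff)
qed simp

lemma partials_scaleR: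
  "smooth g \<Longrightarrow> set bs \<subseteq> Basis \<Longrightarrow>
    partials bs (\<lambda>x. (c::real) *\<^sub>R g x) = (\<lambda>x. c *\<^sub>R partials bs g x)"
proof (induction bs)
  case (Cons b bs)
  then have IH: "partials bs (\<lambda>x. c *\<^sub>R g x) = (\<lambda>x. c *\<^sub>R partials bs g x)" by simp
  show ?case
    using partial_scaleR[OF smoothD, of "partials bs g" b c] Cons.prems
    unfolding foldr.simps o_apply IH by (simp add: smooth_partials fun_eq_iff)
qed simp

subsection \<open>Symmetry of second derivatives\<close>

lemma onorm_scaleR_left_le: "norm w \<le> e \<Longrightarrow> onorm (\<lambda>v::real. v *\<^sub>R w) \<le> e"
  by (rule onorm_le) (metis abs_ge_zero mult.commute mult_right_mono norm_scaleR real_norm_def)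

text \<open>The mean value inequality, applied first in direction \<open>c\<close> to \<open>partial b g\<close> and then in direction
  \<open>b\<close> to the increment of \<open>g\<close>. The second difference on the left is symmetric in \<open>b\<close> and \<open>c\<close>, which
  is what makes the two mixed derivatives agree.\<close>

lemma second_difference_estimate:
  fixes g :: "'a::euclidean_space \<Rightarrow> 'b::real_normed_vector"
  assumes g: "smooth g" and b: "b \<in> Basis" "c \<in> Basis" and e: "e > 0"
  shows "\<exists>d>0. \<forall>t. 0 < t \<and> t < d \<longrightarrow>
    norm (g (x + t *\<^sub>R b + t *\<^sub>R c) - g (x + t *\<^sub>R b) - g (x + t *\<^sub>R c) + g x
      - (t * t) *\<^sub>R partial c (partial b g) x) \<le> e * (t * t)"
proof -
  let ?h = "partial c (partial b g)"
  have "isCont ?h x"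
    by (metis g b differentiable_imp_continuous_within smoothD smooth_partial)
  then obtain d where d: "d > 0" "\<And>y. dist y x < d \<Longrightarrow> dist (?h y) (?h x) < e"
    unfolding continuous_at_eps_delta using e by blast
  show ?thesis
  proof (intro exI[of _ "d / 2"] conjI allI impI)
    fix t assume t: "0 < t \<and> t < d / 2"
    have near: "norm (?h (x + s *\<^sub>R b + r *\<^sub>R c) - ?h x) \<le> e" if "s \<in> {0..t}" "r \<in> {0..t}" for s r
    proof -
      have "norm (s *\<^sub>R b + r *\<^sub>R c) \<le> \<bar>s\<bar> * 1 + \<bar>r\<bar> * 1"
        by (rule norm_triangle_le) (use b in auto)
      then have "dist (x + s *\<^sub>R b + r *\<^sub>R c) x < d"
        using that t by (auto simp: dist_norm add.assoc)
      then show ?thesis using d(2) by (simp add: dist_norm less_imp_le)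
    qed
    have inner: "norm (partial b g (x + s *\<^sub>R b + t *\<^sub>R c) - partial b g (x + s *\<^sub>R b) - t *\<^sub>R ?h x) \<le> t * e"
      if s: "s \<in> {0..t}" for s
    proof -
      let ?k = "\<lambda>r. partial b g (x + s *\<^sub>R b + r *\<^sub>R c) - r *\<^sub>R ?h x"
      have D: "(?k has_derivative (\<lambda>v. v *\<^sub>R (?h (x + s *\<^sub>R b + r *\<^sub>R c) - ?h x))) (at r within {0..t})" for r
      proof -
        have "((\<lambda>r. partial b g (x + s *\<^sub>R b + r *\<^sub>R c)) has_derivative (\<lambda>v. v *\<^sub>R ?h (x + s *\<^sub>R b + r *\<^sub>R c))) (at r within {0..t})"
          by (rule has_derivative_at_withinI)
            (rule partial_along[OF smoothD[OF smooth_partial[OF g b(1)]], unfolded has_vector_derivative_def])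
        moreover have "((\<lambda>r. r *\<^sub>R ?h x) has_derivative (\<lambda>v. v *\<^sub>R ?h x)) (at r within {0..t})"
          by (rule has_derivative_scaleR_left[OF has_derivative_ident])
        ultimately show ?thesis
          unfolding scaleR_diff_right by (rule has_derivative_diff)
      qed
      have "norm (?k t - ?k 0) \<le> e * norm (t - 0)"
      proof (rule differentiable_bound[of "{0..t}" ?k, OF _ D])
        show "onorm (\<lambda>v. v *\<^sub>R (?h (x + s *\<^sub>R b + r *\<^sub>R c) - ?h x)) \<le> e" if "r \<in> {0..t}" for r
          by (rule onorm_scaleR_left_le[OF near[OF s that]])
      qed (use t in auto)
      then show ?thesis using t by (simp add: algebra_simps)
    qed
    let ?K = "\<lambda>s. g (x + s *\<^sub>R b + t *\<^sub>R c) - g (x + s *\<^sub>R b) - (s * t) *\<^sub>R ?h x"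
    have D: "(?K has_derivative (\<lambda>v. v *\<^sub>R (partial b g (x + s *\<^sub>R b + t *\<^sub>R c) - partial b g (x + s *\<^sub>R b) - t *\<^sub>R ?h x))) (at s within {0..t})" for s
    proof -
      have "((\<lambda>s. g (x + t *\<^sub>R c + s *\<^sub>R b)) has_derivative (\<lambda>v. v *\<^sub>R partial b g (x + t *\<^sub>R c + s *\<^sub>R b))) (at s within {0..t})"
        by (rule has_derivative_at_withinI)
          (rule partial_along[OF smoothD[OF g], unfolded has_vector_derivative_def])
      moreover have "x + t *\<^sub>R c + s *\<^sub>R b = x + s *\<^sub>R b + t *\<^sub>R c" for s
        by (simp add: ac_simps)
      ultimately have 1: "((\<lambda>s. g (x + s *\<^sub>R b + t *\<^sub>R c)) has_derivative (\<lambda>v. v *\<^sub>R partial b g (x + s *\<^sub>R b + t *\<^sub>R c))) (at s within {0..t})"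
        by simp
      have 2: "((\<lambda>s. g (x + s *\<^sub>R b)) has_derivative (\<lambda>v. v *\<^sub>R partial b g (x + s *\<^sub>R b))) (at s within {0..t})"
        by (rule has_derivative_at_withinI)
          (rule partial_along[OF smoothD[OF g], unfolded has_vector_derivative_def])
      have 3: "((\<lambda>s. (s * t) *\<^sub>R ?h x) has_derivative (\<lambda>v. (v * t) *\<^sub>R ?h x)) (at s within {0..t})"
        by (intro has_derivative_scaleR_left has_derivative_mult_left has_derivative_ident)
      show ?thesis
        using has_derivative_diff[OF has_derivative_diff[OF 1 2] 3] by (simp add: scaleR_diff_right)
    qed
    have "norm (?K t - ?K 0) \<le> (t * e) * norm (t - 0)"
    proof (rule differentiable_bound[of "{0..t}" ?K, OF _ D])
      show "onorm (\<lambda>v. v *\<^sub>R (partial b g (x + s *\<^sub>R b + t *\<^sub>R c) - partial b g (x + s *\<^sub>R b) - t *\<^sub>R ?h x)) \<le> t * e"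
        if "s \<in> {0..t}" for s
        by (rule onorm_scaleR_left_le[OF inner[OF that]])
    qed (use t in auto)
    moreover have "?K t - ?K 0 = g (x + t *\<^sub>R b + t *\<^sub>R c) - g (x + t *\<^sub>R b) - g (x + t *\<^sub>R c) + g x - (t * t) *\<^sub>R ?h x"
      by simp
    moreover have "(t * e) * norm (t - 0) = e * (t * t)"
      using t by simp
    ultimately show "norm (g (x + t *\<^sub>R b + t *\<^sub>R c) - g (x + t *\<^sub>R b) - g (x + t *\<^sub>R c) + g x - (t * t) *\<^sub>R ?h x) \<le> e * (t * t)"
      by metis
  qed (use d in auto)
qed

lemma partial_commute:
  fixes g :: "'a::euclidean_space \<Rightarrow> 'b::real_normed_vector"
  assumes g: "smooth g" and b: "b \<in> Basis" "c \<in> Basis"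
  shows "partial b (partial c g) = partial c (partial b g)"
proof
  fix x
  have "norm (partial b (partial c g) x - partial c (partial b g) x) \<le> e" if e: "e > 0" for e
  proof -
    obtain d where d: "d > 0" "\<And>t. 0 < t \<Longrightarrow> t < d \<Longrightarrow>
      norm (g (x + t *\<^sub>R b + t *\<^sub>R c) - g (x + t *\<^sub>R b) - g (x + t *\<^sub>R c) + g x
      - (t * t) *\<^sub>R partial c (partial b g) x) \<le> (e/2) * (t * t)"
      using second_difference_estimate[OF g b, of "e/2" x] e by auto
    obtain d' where d': "d' > 0" "\<And>t. 0 < t \<Longrightarrow> t < d' \<Longrightarrow>
      norm (g (x + t *\<^sub>R c + t *\<^sub>R b) - g (x + t *\<^sub>R c) - g (x + t *\<^sub>R b) + g x
      - (t * t) *\<^sub>R partial b (partial c g) x) \<le> (e/2) * (t * t)"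
      using second_difference_estimate[OF g b(2,1), of "e/2" x] e by auto
    obtain t where t: "0 < t" "t < d" "t < d'" using d(1) d'(1) by (metis dense min_less_iff_conj)
    define D where "D = g (x + t *\<^sub>R b + t *\<^sub>R c) - g (x + t *\<^sub>R b) - g (x + t *\<^sub>R c) + g x"
    have "norm (D - (t * t) *\<^sub>R partial c (partial b g) x) \<le> (e/2) * (t * t)"
      using d(2)[OF t(1,2)] by (simp only: D_def)
    moreover have "D = g (x + t *\<^sub>R c + t *\<^sub>R b) - g (x + t *\<^sub>R c) - g (x + t *\<^sub>R b) + g x"
      by (simp add: D_def add.assoc add.commute[of "t *\<^sub>R b"])
    then have "norm (D - (t * t) *\<^sub>R partial b (partial c g) x) \<le> (e/2) * (t * t)"
      using d'(2)[OF t(1,3)] by simp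
    ultimately have "norm ((D - (t * t) *\<^sub>R partial c (partial b g) x) - (D - (t * t) *\<^sub>R partial b (partial c g) x))
        \<le> (e/2) * (t*t) + (e/2) * (t*t)"
      by (rule order_trans[OF norm_triangle_ineq4 add_mono])
    moreover have "(D - (t * t) *\<^sub>R partial c (partial b g) x) - (D - (t * t) *\<^sub>R partial b (partial c g) x)
        = (t * t) *\<^sub>R (partial b (partial c g) x - partial c (partial b g) x)"
      by (simp add: scaleR_diff_right)
    moreover have "norm ((t * t) *\<^sub>R w) = (t * t) * norm w" for w :: 'b
      using t(1) by simp
    ultimately have "(t*t) * norm (partial b (partial c g) x - partial c (partial b g) x) \<le> (t*t) * e"
      using t(1) by (metis distrib_left field_sum_of_halves mult.commute)
    then show ?thesis using t(1) by (simp only: mult_le_cancel_left_pos mult_pos_pos)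
  qed
  then have "norm (partial b (partial c g) x - partial c (partial b g) x) \<le> 0"
    by (rule field_le_epsilon) auto
  then show "partial b (partial c g) x = partial c (partial b g) x" by simp
qed

lemma partials_partial_commute:
  "smooth g \<Longrightarrow> set bs \<subseteq> Basis \<Longrightarrow> b \<in> Basis \<Longrightarrow> partials bs (partial b g) = partial b (partials bs g)"
proof (induction bs)
  case (Cons c bs)
  then have "partials bs (partial b g) = partial b (partials bs g)" by simp
  moreover have "partial c (partial b (partials bs g)) = partial b (partial c (partials bs g))"
    by (rule partial_commute) (use Cons.prems in \<open>auto intro: smooth_partials\<close>)
  ultimately show ?case by simp
qed simp

text \<open>The bookkeeping of derivatives below uses words of directions; by the symmetry of second
  derivatives only the multiset of letters matters.\<close>

lemma partials_mset_cong:
  fixes g :: "'a::euclidean_space \<Rightarrow> 'b::real_normed_vector"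
  assumes "mset bs = mset cs" "smooth g" "set bs \<subseteq> Basis"
  shows "partials bs g = partials cs g"
  using assms(1,3)
proof (induction bs arbitrary: cs)
  case Nil
  then show ?case by simp
next
  case (Cons b bs)
  have sets: "set cs = insert b (set bs)"
    using mset_eq_setD[OF Cons.prems(1)] by simp
  then obtain cs1 cs2 where cs: "cs = cs1 @ b # cs2"
    using split_list[of b cs] by auto
  have B: "b \<in> Basis" "set bs \<subseteq> Basis" using Cons.prems(2) by auto
  have sub: "set cs1 \<subseteq> Basis" "set cs2 \<subseteq> Basis"
    using sets B unfolding cs by auto
  have "mset bs = mset (cs1 @ cs2)" using Cons.prems(1) by (simp add: cs)
  then have "partials bs g = partials (cs1 @ cs2) g"
    using B by (intro Cons.IH)
  moreover have "partials cs1 (partial b (partials cs2 g)) = partial b (partials cs1 (partials cs2 g))"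
    by (intro partials_partial_commute smooth_partials assms(2) sub B)
  ultimately show ?case
    by (simp add: cs)
qed

section \<open>Pointwise bounds of all derivatives\<close>

text \<open>A word of at most \<open>L\<close> basis directions costs the constant \<open>A\<close> and one weight \<open>W b\<close> for each letter.
  The weights may depend on the point \<open>z\<close>, as the powers of \<open>f\<close> in the seminorm do.\<close>

definition jet_bound :: "nat \<Rightarrow> ('a::euclidean_space \<Rightarrow> real) \<Rightarrow> 'a \<Rightarrow> real \<Rightarrow> ('a \<Rightarrow> 'b::real_normed_vector) \<Rightarrow> bool"
  where "jet_bound L W z A g \<longleftrightarrow>
    (\<forall>bs. set bs \<subseteq> Basis \<longrightarrow> length bs \<le> L \<longrightarrow> norm (partials bs g z) \<le> A * prod_list (map W bs))"

lemma jet_boundD: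
  "jet_bound L W z A g \<Longrightarrow> set bs \<subseteq> Basis \<Longrightarrow> length bs \<le> L \<Longrightarrow>
    norm (partials bs g z) \<le> A * prod_list (map W bs)"
  by (simp add: jet_bound_def)

lemma jet_bound_norm: "jet_bound L W z A g \<Longrightarrow> norm (g z) \<le> A"
  using jet_boundD[of L W z A g "[]"] by simp

lemma jet_bound_mono:
  assumes "jet_bound L W z A g" "A \<le> B" "\<And>b. b \<in> Basis \<Longrightarrow> 0 \<le> W b" "L' \<le> L"
  shows "jet_bound L' W z B g"
  unfolding jet_bound_def
proof (intro allI impI)
  fix bs :: "'a list" assume bs: "set bs \<subseteq> Basis" "length bs \<le> L'"
  have "0 \<le> prod_list (map W bs)"
    using bs(1) assms(3) by (intro prod_list_nonneg) auto
  then have "A * prod_list (map W bs) \<le> B * prod_list (map W bs)"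
    using assms(2) by (rule mult_right_mono[rotated])
  with jet_boundD[OF assms(1) bs(1)] bs(2) assms(4)
  show "norm (partials bs g z) \<le> B * prod_list (map W bs)" by force
qed

lemma jet_bound_partial:
  assumes "jet_bound (Suc L) W z A g" "b \<in> Basis"
  shows "jet_bound L W z (A * W b) (partial b g)"
  unfolding jet_bound_def
proof (intro allI impI)
  fix bs :: "'a list" assume bs: "set bs \<subseteq> Basis" "length bs \<le> L"
  show "norm (partials bs (partial b g) z) \<le> A * W b * prod_list (map W bs)"
    using jet_boundD[OF assms(1), of "bs @ [b]"] bs assms(2) by (simp add: mult_ac)
qed

lemma jet_bound_add:
  assumes "jet_bound L W z A g" "jet_bound L W z B h" "smooth g" "smooth h"
  shows "jet_bound L W z (A + B) (\<lambda>x. g x + h x)"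
  unfolding jet_bound_def
proof (intro allI impI)
  fix bs :: "'a list" assume bs: "set bs \<subseteq> Basis" "length bs \<le> L"
  have "norm (partials bs (\<lambda>x. g x + h x) z) \<le> norm (partials bs g z) + norm (partials bs h z)"
    by (simp add: partials_add assms bs norm_triangle_ineq)
  also have "\<dots> \<le> A * prod_list (map W bs) + B * prod_list (map W bs)"
    using bs by (intro add_mono jet_boundD[OF assms(1)] jet_boundD[OF assms(2)])
  finally show "norm (partials bs (\<lambda>x. g x + h x) z) \<le> (A + B) * prod_list (map W bs)"
    by (simp add: distrib_right)
qed

lemma jet_bound_scaleR:
  assumes "jet_bound L W z A g" "smooth g"
  shows "jet_bound L W z (\<bar>c\<bar> * A) (\<lambda>x. c *\<^sub>R g x)"
  unfolding jet_bound_def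
proof (intro allI impI)
  fix bs :: "'a list" assume bs: "set bs \<subseteq> Basis" "length bs \<le> L"
  then show "norm (partials bs (\<lambda>x. c *\<^sub>R g x) z) \<le> \<bar>c\<bar> * A * prod_list (map W bs)"
    using mult_left_mono[OF jet_boundD[OF assms(1) bs], of "\<bar>c\<bar>"]
    by (simp add: partials_scaleR assms bs mult_ac)
qed

text \<open>The Leibniz rule by induction on the number of derivatives: each derivative doubles the number of
  terms, whence the factor \<open>2 ^ L\<close>, and weights multiply along the word.\<close>

lemma jet_bound_mult:
  fixes g h :: "'a::euclidean_space \<Rightarrow> 'b::real_normed_algebra"
  assumes "jet_bound L W z A g" "jet_bound L W z B h" "smooth g" "smooth h"
  shows "jet_bound L W z (2 ^ L * (A * B)) (\<lambda>x. g x * h x)"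
  using assms
proof (induction L arbitrary: g h A B)
  case 0
  have "norm (g z * h z) \<le> A * B"
    using jet_bound_norm[OF 0(1)] jet_bound_norm[OF 0(2)]
    by (intro order_trans[OF norm_mult_ineq] mult_mono) (auto intro: order_trans[OF norm_ge_zero])
  then show ?case by (simp add: jet_bound_def)
next
  case (Suc L)
  have A: "norm (g z) \<le> A" "norm (h z) \<le> B" "0 \<le> A" "0 \<le> B"
    using jet_bound_norm[OF Suc.prems(1)] jet_bound_norm[OF Suc.prems(2)]
    by (auto intro: order_trans[OF norm_ge_zero])
  show ?case unfolding jet_bound_def
  proof (intro allI impI)
    fix bs :: "'a list" assume bs: "set bs \<subseteq> Basis" "length bs \<le> Suc L"
    show "norm (partials bs (\<lambda>x. g x * h x) z) \<le> 2 ^ Suc L * (A * B) * prod_list (map W bs)"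
    proof (cases bs rule: rev_cases)
      case Nil
      have "norm (g z * h z) \<le> A * B"
        using A by (intro order_trans[OF norm_mult_ineq] mult_mono) auto
      also have "A * B \<le> 2 ^ Suc L * (A * B)"
        using A mult_right_mono[OF one_le_power[of "2::real" "Suc L"], of "A * B"] by simp
      finally show ?thesis using Nil by simp
    next
      case (snoc cs b)
      have b: "b \<in> Basis" "set cs \<subseteq> Basis" "length cs \<le> L" using bs snoc by auto
      have lower: "jet_bound L W z A' k" if "jet_bound (Suc L) W z A' k" for A' and k :: "'a \<Rightarrow> 'b"
        using that by (simp add: jet_bound_def)
      have sm: "smooth (partial b g)" "smooth (partial b h)"
        using smooth_partial Suc.prems b by auto
      have j: "jet_bound L W z (2 ^ L * (A * (B * W b))) (\<lambda>x. g x * partial b h x)"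
        "jet_bound L W z (2 ^ L * ((A * W b) * B)) (\<lambda>x. partial b g x * h x)"
        by (intro Suc.IH lower Suc.prems jet_bound_partial b sm)+
      have "partial b (\<lambda>x. g x * h x) = (\<lambda>x. g x * partial b h x + partial b g x * h x)"
        by (rule ext) (intro partial_mult smoothD Suc.prems)
      then have "partials bs (\<lambda>x. g x * h x) = partials cs (\<lambda>x. g x * partial b h x + partial b g x * h x)"
        by (simp add: snoc)
      moreover have "norm (partials cs (\<lambda>x. g x * partial b h x + partial b g x * h x) z)
         \<le> (2 ^ L * (A * (B * W b)) + 2 ^ L * ((A * W b) * B)) * prod_list (map W cs)"
        using b by (intro jet_boundD[OF jet_bound_add[OF j]] smooth_mult sm Suc.prems)
      ultimately show ?thesis by (simp add: snoc algebra_simps)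
    qed
  qed
qed

lemma smooth_const: "smooth (\<lambda>x::'a::euclidean_space. c :: 'b::real_normed_vector)"
proof (rule smooth_coinduct[where S = "{\<lambda>x. c | c. True}"])
  show "partial b g \<in> {\<lambda>x. c | c. True}" if "g \<in> {\<lambda>x::'a. c::'b | c. True}" for g b
    using that by (auto simp: partial_def fun_eq_iff)
qed auto

lemma jet_bound_const:
  assumes "\<And>b. b \<in> Basis \<Longrightarrow> 0 \<le> W b"
  shows "jet_bound L W z (norm c) (\<lambda>x. c)"
  unfolding jet_bound_def
proof (intro allI impI)
  fix bs :: "'a list" assume bs: "set bs \<subseteq> Basis" "length bs \<le> L"
  have "0 \<le> prod_list (map W bs)"
    using bs(1) assms by (intro prod_list_nonneg) auto
  moreover have "partials bs (\<lambda>x. c) = (\<lambda>x. if bs = [] then c else 0)"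
    by (induction bs) (auto simp: partial_def fun_eq_iff)
  ultimately show "norm (partials bs (\<lambda>x. c) z) \<le> norm c * prod_list (map W bs)"
    by simp
qed

lemma jet_bound_prod:
  fixes g :: "'i \<Rightarrow> 'a::euclidean_space \<Rightarrow> complex"
  assumes "finite I" "\<And>i. i \<in> I \<Longrightarrow> smooth (g i)" "\<And>i. i \<in> I \<Longrightarrow> jet_bound L W z (A i) (g i)"
    and "\<And>b. b \<in> Basis \<Longrightarrow> 0 \<le> W b"
  shows "smooth (\<lambda>x. \<Prod>i\<in>I. g i x) \<and> jet_bound L W z (\<Prod>i\<in>I. 2 ^ L * A i) (\<lambda>x. \<Prod>i\<in>I. g i x)"
  using assms(1-3)
proof (induction I rule: finite_induct)
  case empty
  show ?case using jet_bound_const[of W L z "1::complex"] assms(4) by (simp add: smooth_const)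
next
  case (insert i I)
  have 1: "smooth (g i)" "jet_bound L W z (A i) (g i)" using insert by auto
  have 2: "smooth (\<lambda>x. \<Prod>i\<in>I. g i x)" "jet_bound L W z (\<Prod>i\<in>I. 2 ^ L * A i) (\<lambda>x. \<Prod>i\<in>I. g i x)"
    using insert by auto
  from smooth_mult[OF 1(1) 2(1)] jet_bound_mult[OF 1(2) 2(2) 1(1) 2(1)] insert(1,2)
  show ?case by (simp add: mult_ac)
qed

subsection \<open>Affine substitutions\<close>

text \<open>A linear map that sends every basis vector to a multiple of a basis vector turns words of
  basis directions into words of basis directions. This covers slices, dilations, translations and
  coordinate functionals.\<close>

lemma
  fixes g :: "'b::euclidean_space \<Rightarrow> 'c::real_normed_vector" and T :: "'a::euclidean_space \<Rightarrow> 'b"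
  assumes T: "bounded_linear T" and c: "\<And>b. b \<in> Basis \<Longrightarrow> T b = c b *\<^sub>R \<sigma> b"
    and \<sigma>: "\<And>b. b \<in> Basis \<Longrightarrow> \<sigma> b \<in> Basis" and g: "smooth g"
  shows smooth_affine: "smooth (\<lambda>x. g (y + T x))"
    and partials_affine: "set bs \<subseteq> Basis \<Longrightarrow>
      partials bs (\<lambda>x. g (y + T x)) x = prod_list (map c bs) *\<^sub>R partials (map \<sigma> bs) g (y + T x)"
proof -
  have deriv: "((\<lambda>x. h (y + T x)) has_derivative (\<lambda>v. frechet_derivative h (at (y + T x)) (T v))) (at x)"
    if "smooth h" for h :: "'b \<Rightarrow> 'c" and x
  proof -
    have "((\<lambda>x. y + T x) has_derivative T) (at x)"
      using bounded_linear_imp_has_derivative[OF T] by (auto intro!: derivative_eq_intros)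
    from has_derivative_compose[OF this smoothD[OF that, THEN frechet_derivative_works[THEN iffD1]]]
    show ?thesis .
  qed
  have step: "partial b (\<lambda>x. r *\<^sub>R h (y + T x)) = (\<lambda>x. (r * c b) *\<^sub>R partial (\<sigma> b) h (y + T x))"
    if h: "smooth h" and b: "b \<in> Basis" for r and h :: "'b \<Rightarrow> 'c" and b
  proof
    fix x
    have "(h has_derivative frechet_derivative h (at (y + T x))) (at (y + T x))"
      by (rule smoothD[OF h, THEN frechet_derivative_works[THEN iffD1]])
    then have "partial (\<sigma> b) h (y + T x) = frechet_derivative h (at (y + T x)) (\<sigma> b)"
      and l: "linear (frechet_derivative h (at (y + T x)))"
      by (auto simp: partial_eqI has_derivative_linear)
    moreover have "partial b (\<lambda>x. r *\<^sub>R h (y + T x)) x = r *\<^sub>R frechet_derivative h (at (y + T x)) (T b)"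
      by (rule partial_eqI) (rule has_derivative_scaleR_right[OF deriv[OF h]])
    ultimately show "partial b (\<lambda>x. r *\<^sub>R h (y + T x)) x = (r * c b) *\<^sub>R partial (\<sigma> b) h (y + T x)"
      by (simp add: c[OF b] linear_scale)
  qed
  show "smooth (\<lambda>x. g (y + T x))"
  proof (rule smooth_coinduct[where S = "{\<lambda>x. r *\<^sub>R h (y + T x) | r h. smooth h}"])
    have "(\<lambda>x. g (y + T x)) = (\<lambda>x. 1 *\<^sub>R g (y + T x))" by simp
    then show "(\<lambda>x. g (y + T x)) \<in> {\<lambda>x. r *\<^sub>R h (y + T x) | r h. smooth h}"
      using g by blast
  next
    fix k x assume "k \<in> {\<lambda>x. r *\<^sub>R h (y + T x) | r h. smooth (h :: 'b \<Rightarrow> 'c)}"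
    then show "k differentiable at x"
      using has_derivative_scaleR_right[OF deriv] by (auto simp: differentiable_def)
  next
    fix k b assume "k \<in> {\<lambda>x. r *\<^sub>R h (y + T x) | r h. smooth (h :: 'b \<Rightarrow> 'c)}" and b: "b \<in> (Basis :: 'a set)"
    then obtain r h where "k = (\<lambda>x. r *\<^sub>R h (y + T x))" "smooth (h :: 'b \<Rightarrow> 'c)" by auto
    then show "partial b k \<in> {\<lambda>x. r *\<^sub>R h (y + T x) | r h. smooth h}"
      using step[of h b r] b smooth_partial[OF _ \<sigma>[OF b]] by auto
  qed
  have "set bs \<subseteq> Basis \<Longrightarrow>
    partials bs (\<lambda>x. g (y + T x)) = (\<lambda>x. prod_list (map c bs) *\<^sub>R partials (map \<sigma> bs) g (y + T x))"
  proof (induction bs)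
    case (Cons b bs)
    have s: "smooth (partials (map \<sigma> bs) g)" using Cons.prems \<sigma> by (intro smooth_partials g) auto
    have "partials bs (\<lambda>x. g (y + T x)) = (\<lambda>x. prod_list (map c bs) *\<^sub>R partials (map \<sigma> bs) g (y + T x))"
      using Cons by simp
    then show ?case using step[OF s, of b "prod_list (map c bs)"] Cons.prems by (simp add: mult.commute)
  qed simp
  then show "set bs \<subseteq> Basis \<Longrightarrow>
      partials bs (\<lambda>x. g (y + T x)) x = prod_list (map c bs) *\<^sub>R partials (map \<sigma> bs) g (y + T x)"
    by simp
qed

subsection \<open>Cutoff functions\<close>

text \<open>For \<open>p = 1\<close> this is the standard flat function \<open>exp (- 1 / x)\<close>; the polynomial factor makes the
  family closed under differentiation.\<close>

definition flat_poly :: "real poly \<Rightarrow> real \<Rightarrow> complex"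
  where "flat_poly p x = of_real (if x > 0 then poly p (1 / x) * exp (- (1 / x)) else 0)"

lemma poly_exp_tendsto_0: "((\<lambda>y::real. poly p y * exp (- y)) \<longlongrightarrow> 0) at_top"
proof -
  have "((\<lambda>y. \<Sum>i\<le>degree p. coeff p i * (y ^ i / exp y)) \<longlongrightarrow> (\<Sum>i\<le>degree p. coeff p i * 0)) at_top"
    by (intro tendsto_intros tendsto_power_div_exp_0)
  moreover have "(\<lambda>y. \<Sum>i\<le>degree p. coeff p i * (y ^ i / exp y)) = (\<lambda>y. poly p y * exp (- y))"
    by (simp add: poly_altdef sum_distrib_right exp_minus divide_inverse mult.assoc)
  ultimately show ?thesis by simp
qed

text \<open>The polynomial comes from the chain rule: with \<open>y = 1 / x\<close> the derivative of \<open>p y * exp (- y)\<close>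
  is \<open>(p' y - p y) * exp (- y)\<close> times \<open>- y\<^sup>2\<close>. At the origin the exponential beats every power of \<open>y\<close>.\<close>

lemma flat_poly_deriv:
  "(flat_poly p has_vector_derivative flat_poly ([:0, 0, 1:] * (p - pderiv p)) x) (at x)"
proof -
  define F where "F = (\<lambda>x::real. if x > 0 then poly p (1 / x) * exp (- (1 / x)) else 0)"
  define G where "G = (\<lambda>x::real. if x > 0 then poly ([:0, 0, 1:] * (p - pderiv p)) (1 / x) * exp (- (1 / x)) else 0)"
  have "(F has_real_derivative G x) (at x)"
  proof -
    consider "x > 0" | "x < 0" | "x = 0" by linarith
    then show ?thesis
    proof cases
      case 1
      have "((\<lambda>x. poly p (1 / x) * exp (- (1 / x))) has_real_derivative G x) (at x)"
        using 1 by (auto intro!: derivative_eq_intros DERIV_chain2[OF poly_DERIV] simp: G_def field_simps power2_eq_square)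
      then show ?thesis
        by (rule has_field_derivative_transform_within_open[of _ _ _ "{0<..}"]) (use 1 in \<open>auto simp: F_def\<close>)
    next
      case 2
      have "((\<lambda>x. 0) has_real_derivative G x) (at x)" using 2 by (simp add: G_def)
      then show ?thesis
        by (rule has_field_derivative_transform_within_open[of _ _ _ "{..<0}"]) (use 2 in \<open>auto simp: F_def\<close>)
    next
      case 3
      have "((\<lambda>h. F h / h) \<longlongrightarrow> 0) (at_right 0)"
      proof -
        have "((\<lambda>h. poly ([:0, 1:] * p) (inverse h) * exp (- inverse h)) \<longlongrightarrow> 0) (at_right (0::real))"
          by (rule filterlim_compose[OF poly_exp_tendsto_0 filterlim_inverse_at_top_right])
        moreover have "eventually (\<lambda>h. poly ([:0, 1:] * p) (inverse h) * exp (- inverse h) = F h / h) (at_right (0::real))"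
          by (rule eventually_at_right_less[THEN eventually_mono]) (auto simp: F_def field_simps)
        ultimately show ?thesis by (rule Lim_transform_eventually)
      qed
      moreover have "((\<lambda>h. F h / h) \<longlongrightarrow> 0) (at_left 0)"
        by (rule Lim_transform_eventually[of "\<lambda>_. 0"])
          (auto simp: F_def eventually_at_left_field intro!: exI[of _ "-1"])
      ultimately have "((\<lambda>h. F h / h) \<longlongrightarrow> 0) (at 0)"
        by (simp add: filterlim_split_at)
      moreover have "(\<lambda>h. (F (x + h) - F x) / h) = (\<lambda>h. F h / h)" "G x = 0"
        using 3 by (auto simp: F_def G_def)
      ultimately show ?thesis by (simp only: DERIV_def)
    qed
  qed
  from has_vector_derivative_of_real[OF this] show ?thesis
    unfolding flat_poly_def[abs_def] F_def G_def .
qed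

lemma smooth_flat_poly: "smooth (flat_poly p)"
proof (rule smooth_coinduct[where S = "range flat_poly"])
  show "g differentiable at x" if "g \<in> range flat_poly" for g x
    using that flat_poly_deriv by (auto simp: differentiable_def has_vector_derivative_def)
  show "partial b g \<in> range flat_poly" if g: "g \<in> range flat_poly" and b: "b \<in> Basis" for g and b :: real
  proof -
    obtain p where p: "g = flat_poly p" using g by blast
    have "partial 1 (flat_poly p) = flat_poly ([:0, 0, 1:] * (p - pderiv p))"
      using flat_poly_deriv[of p, unfolded has_vector_derivative_def, THEN partial_eqI]
      by (auto simp: fun_eq_iff)
    then show ?thesis using b p by simp
  qed
qed simp

definition bump :: "real \<Rightarrow> complex"
  where "bump x = exp 2 * (flat_poly 1 (1 + x) * flat_poly 1 (1 - x))"

lemma bump_0: "bump 0 = 1"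
  by (simp add: bump_def flat_poly_def exp_of_real[symmetric] exp_add[symmetric] flip: exp_minus)

lemma bump_eq_0: "\<bar>x\<bar> \<ge> 1 \<Longrightarrow> bump x = 0"
  by (auto simp: bump_def flat_poly_def)

lemma smooth_bump: "smooth bump"
proof -
  have "smooth (\<lambda>x. flat_poly 1 (1 + id x))"
    by (rule smooth_affine[where c = "\<lambda>_. 1" and \<sigma> = id]) (auto simp: smooth_flat_poly bounded_linear_ident id_def)
  moreover have "smooth (\<lambda>x. flat_poly 1 (1 + - x))"
    by (rule smooth_affine[where c = "\<lambda>_. -1" and \<sigma> = id]) (auto simp: smooth_flat_poly intro: bounded_linear_minus bounded_linear_ident)
  ultimately show ?thesis
    unfolding bump_def[abs_def] by (auto intro!: smooth_mult smooth_const)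
qed

lemma partials_eq_0_on_open:
  assumes "open U" "\<And>x. x \<in> U \<Longrightarrow> g x = 0" "x \<in> U"
  shows "partials bs g x = 0"
  using assms(3)
proof (induction bs arbitrary: x)
  case (Cons b bs)
  have "(partials bs g has_derivative (\<lambda>_. 0)) (at x)"
    by (rule has_derivative_transform_within_open[of "\<lambda>_. 0" _ _ _ U]) (use Cons assms in auto)
  then show ?case by (simp add: partial_eqI)
qed (use assms in simp)

lemma bump_derivs_bounded: "\<exists>M\<ge>0. \<forall>k\<le>L. \<forall>x. norm (partials (replicate k 1) bump x) \<le> M"
proof -
  have 1: "\<exists>M\<ge>0. \<forall>x. norm (partials (replicate k 1) bump x) \<le> M" for k
  proof -
    have s: "smooth (partials (replicate k 1) bump)"
      by (intro smooth_partials smooth_bump) auto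
    have "bounded (partials (replicate k 1) bump ` {-1..1})"
      by (intro compact_imp_bounded compact_continuous_image smooth_continuous[OF s]) simp
    then obtain M where M: "\<And>x. x \<in> {-1..1} \<Longrightarrow> norm (partials (replicate k 1) bump x) \<le> M"
      unfolding bounded_iff by blast
    have "norm (partials (replicate k 1) bump x) \<le> max M 0" for x
    proof (cases "x \<in> {-1..1}")
      case False
      then have "partials (replicate k 1) bump x = 0"
        by (intro partials_eq_0_on_open[of "- {-1..1}"]) (auto intro!: bump_eq_0)
      then show ?thesis by simp
    qed (use M[of x] in auto)
    then show ?thesis by (intro exI[of _ "max M 0"]) auto
  qed
  then obtain M where M: "\<And>k. M k \<ge> 0" "\<And>k x. norm (partials (replicate k 1) bump x) \<le> M k" by metis
  show ?thesis
  proof (intro exI[of _ "\<Sum>k\<le>L. M k"] conjI allI impI)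
    show "norm (partials (replicate k 1) bump x) \<le> (\<Sum>k\<le>L. M k)" if "k \<le> L" for k x
      using M(2)[of k x] member_le_sum[of k "{..L}" M] M(1) that by force
  qed (simp add: sum_nonneg M)
qed

definition cutoff :: "('a::euclidean_space \<Rightarrow> real) \<Rightarrow> 'a \<Rightarrow> complex"
  where "cutoff \<epsilon> z = (\<Prod>b\<in>Basis. bump (\<epsilon> b * (z \<bullet> b)))"

lemma
  fixes b0 :: "'a::euclidean_space"
  assumes b0: "b0 \<in> Basis"
  shows smooth_bump_coord: "smooth (\<lambda>z. bump (e * (z \<bullet> b0)))"
    and partials_bump_coord: "set bs \<subseteq> Basis \<Longrightarrow> partials bs (\<lambda>z. bump (e * (z \<bullet> b0))) z =
      prod_list (map (\<lambda>b. if b = b0 then e else 0) bs) *\<^sub>R partials (replicate (length bs) 1) bump (e * (z \<bullet> b0))"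
proof -
  have lin: "bounded_linear (\<lambda>z. e * (z \<bullet> b0))"
    by (intro bounded_linear_const_mult bounded_linear_inner_left)
  have c: "e * (b \<bullet> b0) = (if b = b0 then e else 0) *\<^sub>R 1" if "b \<in> Basis" for b
    using that b0 by (auto simp: inner_Basis)
  show "smooth (\<lambda>z. bump (e * (z \<bullet> b0)))"
    using smooth_affine[OF lin c _ smooth_bump, of "0"] by simp
  have "map (\<lambda>_. 1::real) bs = replicate (length bs) 1"
    by (rule map_replicate_const)
  then show "set bs \<subseteq> Basis \<Longrightarrow> partials bs (\<lambda>z. bump (e * (z \<bullet> b0))) z =
      prod_list (map (\<lambda>b. if b = b0 then e else 0) bs) *\<^sub>R partials (replicate (length bs) 1) bump (e * (z \<bullet> b0))"
    using partials_affine[OF lin c _ smooth_bump, of bs "0" z] by simp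
qed

lemma smooth_cutoff: "smooth (cutoff \<epsilon>)"
  unfolding cutoff_def[abs_def]
  using jet_bound_prod[of Basis "\<lambda>b z. bump (\<epsilon> b * (z \<bullet> b))" 0 "\<lambda>_. 0" 0 "\<lambda>b. norm (bump 0)"]
  by (auto simp: smooth_bump_coord jet_bound_def)

lemma jet_bound_bump_coord:
  assumes b0: "b0 \<in> Basis" and M: "\<And>k x. k \<le> L \<Longrightarrow> norm (partials (replicate k 1) bump x) \<le> M"
    and e: "0 \<le> e" "e \<le> W b0" and W: "\<And>b. b \<in> Basis \<Longrightarrow> 0 \<le> W b"
  shows "jet_bound L W z M (\<lambda>z. bump (e * (z \<bullet> b0)))"
  unfolding jet_bound_def
proof (intro allI impI)
  fix bs :: "'a list" assume bs: "set bs \<subseteq> Basis" "length bs \<le> L"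
  have M0: "0 \<le> M" using M[of 0 0] by (auto intro: order_trans[OF norm_ge_zero])
  have "0 \<le> prod_list (map (\<lambda>b. if b = b0 then e else 0) bs) \<and>
    prod_list (map (\<lambda>b. if b = b0 then e else 0) bs) \<le> prod_list (map W bs)"
    using bs(1)
  proof (induction bs)
    case (Cons b bs)
    then show ?case using e W by (auto intro!: mult_mono)
  qed simp
  then show "norm (partials bs (\<lambda>z. bump (e * (z \<bullet> b0))) z) \<le> M * prod_list (map W bs)"
    using M[OF bs(2), of "e * (z \<bullet> b0)"] M0
    by (simp add: partials_bump_coord[OF b0 bs(1)] mult.commute[of M] mult_mono)
qed

text \<open>The constant does not depend on the scales \<open>\<epsilon>\<close>. Either a derivative in direction \<open>b\<close> costs at most
  \<open>\<epsilon> b \<le> W b\<close>, or \<open>z\<close> lies in an open set on which the cutoff vanishes. The second alternative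
  matters because the weights involve \<open>f\<close>, which may be unbounded: it suffices to compare scales and
  weights on the support of the cutoff.\<close>

lemma jet_bound_cutoff:
  "\<exists>K\<ge>0. \<forall>\<epsilon> W (z::'a::euclidean_space). (\<forall>b\<in>Basis. 0 \<le> \<epsilon> b \<and> 0 \<le> W b) \<longrightarrow>
     (\<forall>b\<in>Basis. \<epsilon> b \<le> W b) \<or> (\<exists>b\<in>Basis. \<bar>\<epsilon> b * (z \<bullet> b)\<bar> > 1) \<longrightarrow> jet_bound L W z K (cutoff \<epsilon>)"
proof -
  obtain M where M: "M \<ge> 0" "\<And>k x. k \<le> L \<Longrightarrow> norm (partials (replicate k 1) bump x) \<le> M"
    using bump_derivs_bounded[of L] by auto
  define K where "K = (\<Prod>b\<in>(Basis::'a set). 2 ^ L * M)"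
  have K: "K \<ge> 0" using M(1) by (simp add: K_def)
  show ?thesis
  proof (intro exI[of _ K] conjI K allI impI)
    fix \<epsilon> W and z :: 'a
    assume nn: "\<forall>b\<in>Basis. 0 \<le> \<epsilon> b \<and> 0 \<le> W b"
      and alt: "(\<forall>b\<in>Basis. \<epsilon> b \<le> W b) \<or> (\<exists>b\<in>Basis. \<bar>\<epsilon> b * (z \<bullet> b)\<bar> > 1)"
    from alt show "jet_bound L W z K (cutoff \<epsilon>)"
    proof
      assume le: "\<forall>b\<in>Basis. \<epsilon> b \<le> W b"
      show ?thesis
        unfolding cutoff_def[abs_def] K_def
        by (intro jet_bound_prod[THEN conjunct2] smooth_bump_coord jet_bound_bump_coord M(2))
          (use nn le in auto)
    next
      assume "\<exists>b\<in>Basis. \<bar>\<epsilon> b * (z \<bullet> b)\<bar> > 1"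
      then obtain b where b: "b \<in> Basis" "\<bar>\<epsilon> b * (z \<bullet> b)\<bar> > 1" by auto
      have "partials bs (cutoff \<epsilon>) z = 0" for bs
      proof (rule partials_eq_0_on_open[of "{z. \<bar>\<epsilon> b * (z \<bullet> b)\<bar> > 1}"])
        show "open {z. \<bar>\<epsilon> b * (z \<bullet> b)\<bar> > 1}"
          by (intro open_Collect_less continuous_intros)
        show "cutoff \<epsilon> x = 0" if "x \<in> {z. \<bar>\<epsilon> b * (z \<bullet> b)\<bar> > 1}" for x
          unfolding cutoff_def using that b(1) by (intro prod_zero) (auto intro!: bump_eq_0 bexI[of _ b])
      qed (use b in simp)
      then show ?thesis
        unfolding jet_bound_def using K nn
        by (auto intro!: mult_nonneg_nonneg prod_list_nonneg simp: subset_iff)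
    qed
  qed
qed

section \<open>From the seminorm to pointwise bounds\<close>

text \<open>The natural length scales at a point are \<open>1\<close> in direction \<open>r\<close> and \<open>1 / f r\<close> in the directions
  \<open>\<theta>\<close>; these are the reciprocal scales.\<close>

definition scale_vec :: "(real \<Rightarrow> real) \<Rightarrow> real \<Rightarrow> 'n::{finite,linorder} \<Rightarrow> real"
  where "scale_vec f r j = (if j = r_idx then 1 else f r)"

text \<open>A derivative in \<open>q $ j\<close> costs the factor \<open>l j\<close> and a derivative in \<open>p $ j\<close> gains it back. Written as
  a product over all coordinates so that it is a total function on phase space without a choice of
  index.\<close>

definition phase_weight :: "('n::finite \<Rightarrow> real) \<Rightarrow> 'n phase \<Rightarrow> real"
  where "phase_weight l b = (\<Prod>j\<in>UNIV. (if b = (axis j 1, 0) then l j else 1) * (if b = (0, axis j 1) then inverse (l j) else 1))"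

lemma phase_weight_q: "phase_weight l (axis j 1, 0) = l j"
  unfolding phase_weight_def
  by (subst prod.remove[of _ j]) (auto simp: axis_eq_axis axis_eq_0_iff zero_prod_def intro!: prod.neutral)

lemma phase_weight_p: "phase_weight l (0, axis j 1) = inverse (l j)"
  unfolding phase_weight_def
  by (subst prod.remove[of _ j]) (auto simp: axis_eq_axis axis_eq_0_iff intro!: prod.neutral)

lemma Basis_phase:
  "(Basis :: 'n::finite phase set) = (\<lambda>j. (axis j 1, 0)) ` UNIV \<union> (\<lambda>j. (0, axis j 1)) ` UNIV"
  by (auto simp: Basis_prod_def Basis_vec_def)

lemma Basis_phase_cases:
  assumes "b \<in> (Basis :: 'n::finite phase set)"
  obtains j where "b = (axis j 1, 0)" | j where "b = (0, axis j 1)"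
  using assms unfolding Basis_phase by auto

text \<open>The order in which the seminorm applies its derivatives.\<close>

definition canonical_word :: "('n::{finite,linorder} \<Rightarrow> nat) \<Rightarrow> ('n \<Rightarrow> nat) \<Rightarrow> 'n phase list" where
  "canonical_word \<alpha> \<beta> =
    concat (map (\<lambda>i. replicate (\<alpha> i) (axis i 1, 0)) theta_idxs) @
    concat (map (\<lambda>i. replicate (\<beta> i) (0, axis i 1)) theta_idxs) @
    replicate (\<alpha> r_idx) (axis r_idx 1, 0) @ replicate (\<beta> r_idx) (0, axis r_idx 1)"

lemma set_theta_idxs: "set theta_idxs = UNIV - {r_idx}"
  by (simp add: theta_idxs_def)

lemma distinct_theta_idxs: "distinct theta_idxs"
  by (simp add: theta_idxs_def)

lemma count_list_concat_replicate:
  "distinct xs \<Longrightarrow> inj_on e (set xs) \<Longrightarrow>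
   count (mset (concat (map (\<lambda>i. replicate (k i) (e i)) xs))) b =
     (if b \<in> e ` set xs then k (the_inv_into (set xs) e b) else 0)"
proof (induction xs)
  case (Cons x xs)
  have inv: "the_inv_into (set (x # xs)) e (e y) = y" if "y \<in> set (x # xs)" for y
    using that Cons.prems by (intro the_inv_into_f_f) auto
  have inv': "the_inv_into (set xs) e (e y) = y" if "y \<in> set xs" for y
    using that Cons.prems by (intro the_inv_into_f_f) (auto simp: inj_on_def)
  have "e x \<notin> e ` set xs" using Cons.prems by (auto simp: inj_on_def)
  then show ?case
    using Cons inv inv' by (auto simp: inj_on_def)
qed simp

lemma mset_canonical_word:
  fixes bs :: "'n::{finite,linorder} phase list"
  assumes "set bs \<subseteq> Basis"
  shows "mset (canonical_word (\<lambda>j. count (mset bs) (axis j 1, 0)) (\<lambda>j. count (mset bs) (0, axis j 1))) = mset bs"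
    (is "mset (canonical_word ?\<alpha> ?\<beta>) = _")
proof (rule multiset_eqI)
  fix b :: "'n phase"
  have inj: "inj_on (\<lambda>i. (axis i 1, 0) :: 'n phase) A" "inj_on (\<lambda>i. (0, axis i 1) :: 'n phase) A" for A
    by (auto simp: inj_on_def axis_eq_axis)
  have inv1: "the_inv_into (set theta_idxs) (\<lambda>i. (axis i 1, 0) :: 'n phase) (axis j 1, 0) = j"
    and inv2: "the_inv_into (set theta_idxs) (\<lambda>i. (0, axis i 1) :: 'n phase) (0, axis j 1) = j" if "j \<noteq> r_idx" for j
    using that by (auto intro!: the_inv_into_f_eq inj simp: set_theta_idxs)
  show "count (mset (canonical_word ?\<alpha> ?\<beta>)) b = count (mset bs) b"
  proof (cases "b \<in> Basis")
    case True
    then show ?thesis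
    proof (cases rule: Basis_phase_cases)
      case (1 j)
      then show ?thesis
        using inv1[of j]
        by (auto simp: canonical_word_def count_list_concat_replicate[OF distinct_theta_idxs inj(1)]
           count_list_concat_replicate[OF distinct_theta_idxs inj(2)] set_theta_idxs axis_eq_axis axis_eq_0_iff image_iff
           simp del: mset_concat)
    next
      case (2 j)
      then show ?thesis
        using inv2[of j]
        by (auto simp: canonical_word_def count_list_concat_replicate[OF distinct_theta_idxs inj(1)]
           count_list_concat_replicate[OF distinct_theta_idxs inj(2)] set_theta_idxs axis_eq_axis axis_eq_0_iff image_iff
           simp del: mset_concat)
    qed
  next
    case False
    have "set (canonical_word ?\<alpha> ?\<beta>) \<subseteq> Basis"
      by (auto simp: canonical_word_def Basis_phase)
    with False assms have "b \<notin> set (canonical_word ?\<alpha> ?\<beta>)" "b \<notin> set bs" by auto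
    then show ?thesis by (metis count_mset_0_iff)
  qed
qed

lemma scaled_derivs:
  fixes a :: "'n::{finite,linorder} phase \<Rightarrow> complex"
  assumes a: "smooth a" and i: "i \<noteq> r_idx"
  shows "scaled_deriv_theta f i (\<lambda>z. c (fst z $ r_idx) *\<^sub>R a z) =
      (\<lambda>z. (inverse (f (fst z $ r_idx)) * c (fst z $ r_idx)) *\<^sub>R partial (axis i 1, 0) a z)"
    and "scaled_deriv_eta f i (\<lambda>z. c (fst z $ r_idx) *\<^sub>R a z) =
      (\<lambda>z. (f (fst z $ r_idx) * c (fst z $ r_idx)) *\<^sub>R partial (0, axis i 1) a z)"
proof -
  have *: "partial b (\<lambda>z. c (fst z $ r_idx) *\<^sub>R a z) z = c (fst z $ r_idx) *\<^sub>R partial b a z"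
    if "fst b $ r_idx = 0" for b z
  proof -
    have "partial b (\<lambda>z. c (fst z $ r_idx) *\<^sub>R a z) z = partial b (\<lambda>w. c (fst z $ r_idx) *\<^sub>R a w) z"
      using that by (simp add: partial_def)
    then show ?thesis using partial_scaleR[OF smoothD[OF a]] by simp
  qed
  show "scaled_deriv_theta f i (\<lambda>z. c (fst z $ r_idx) *\<^sub>R a z) =
      (\<lambda>z. (inverse (f (fst z $ r_idx)) * c (fst z $ r_idx)) *\<^sub>R partial (axis i 1, 0) a z)"
    using i by (auto simp: scaled_deriv_theta_def deriv_q_def * axis_def fun_eq_iff)
  show "scaled_deriv_eta f i (\<lambda>z. c (fst z $ r_idx) *\<^sub>R a z) =
      (\<lambda>z. (f (fst z $ r_idx) * c (fst z $ r_idx)) *\<^sub>R partial (0, axis i 1) a z)"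
    using i by (auto simp: scaled_deriv_eta_def deriv_p_def * fun_eq_iff)
qed

text \<open>The scaling factors depend on the point through \<open>r\<close> alone, so they commute with all derivatives in
  directions other than \<open>r\<close> and can be collected in front.\<close>

lemma theta_power_scaled:
  fixes a :: "'n::{finite,linorder} phase \<Rightarrow> complex"
  assumes D: "\<And>c a i. smooth a \<Longrightarrow> i \<noteq> r_idx \<Longrightarrow> D i (\<lambda>z. c (fst z $ r_idx) *\<^sub>R a z) =
      (\<lambda>z. (F (fst z $ r_idx) * c (fst z $ r_idx)) *\<^sub>R partial (e i) a z)"
    and e: "\<And>i. e i \<in> Basis" and a: "smooth a" and xs: "set xs \<subseteq> UNIV - {r_idx}"
  shows "foldr (\<lambda>i. D i ^^ \<alpha> i) xs (\<lambda>z. c (fst z $ r_idx) *\<^sub>R a z) =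
    (\<lambda>z. (F (fst z $ r_idx) ^ sum_list (map \<alpha> xs) * c (fst z $ r_idx)) *\<^sub>R
       partials (concat (map (\<lambda>i. replicate (\<alpha> i) (e i)) xs)) a z)"
  using xs
proof (induction xs)
  case (Cons i xs)
  define w where "w = partials (concat (map (\<lambda>i. replicate (\<alpha> i) (e i)) xs)) a"
  have w: "smooth w" unfolding w_def by (intro smooth_partials a) (use e in auto)
  have i: "i \<noteq> r_idx" using Cons.prems by auto
  have pow: "(D i ^^ k) (\<lambda>z. c (fst z $ r_idx) *\<^sub>R w z) =
     (\<lambda>z. (F (fst z $ r_idx) ^ k * c (fst z $ r_idx)) *\<^sub>R partials (replicate k (e i)) w z)" for k c
  proof (induction k)
    case (Suc k)
    have "smooth (partials (replicate k (e i)) w)" by (intro smooth_partials w) (use e in auto)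
    from D[OF this i, of "\<lambda>r. F r ^ k * c r"] show ?case
      by (simp add: Suc mult_ac)
  qed simp
  have IH: "foldr (\<lambda>i. D i ^^ \<alpha> i) xs (\<lambda>z. c (fst z $ r_idx) *\<^sub>R a z) =
    (\<lambda>z. (F (fst z $ r_idx) ^ sum_list (map \<alpha> xs) * c (fst z $ r_idx)) *\<^sub>R w z)"
    using Cons by (simp add: w_def)
  show ?case
    using pow[of "\<alpha> i" "\<lambda>r. F r ^ sum_list (map \<alpha> xs) * c r"]
    by (simp add: IH w_def power_add mult_ac)
qed simp

lemma weighted_deriv_eq:
  fixes a :: "'n::{finite,linorder} phase \<Rightarrow> complex"
  assumes a: "smooth a"
  shows "weighted_deriv f \<alpha> \<beta> a z =
    (inverse (f (fst z $ r_idx)) ^ sum \<alpha> (UNIV - {r_idx}) * f (fst z $ r_idx) ^ sum \<beta> (UNIV - {r_idx}))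
      *\<^sub>R partials (canonical_word \<alpha> \<beta>) a z"
proof -
  define w where "w = partials (replicate (\<alpha> r_idx) (axis r_idx 1, 0) @ replicate (\<beta> r_idx) (0, axis r_idx 1)) a"
  define w' where "w' = partials (concat (map (\<lambda>i. replicate (\<beta> i) (0, axis i 1)) theta_idxs)) w"
  have B: "(axis i 1, 0) \<in> (Basis :: 'n phase set)" "(0, axis i 1) \<in> (Basis :: 'n phase set)" for i
    by (auto simp: Basis_phase)
  have w: "smooth w" unfolding w_def by (intro smooth_partials a) (use B in auto)
  have w': "smooth w'" unfolding w'_def by (intro smooth_partials w) (use B in auto)
  have w_eq: "(deriv_q r_idx ^^ \<alpha> r_idx) ((deriv_p r_idx ^^ \<beta> r_idx) a) = w"
    by (simp add: w_def deriv_q_def deriv_p_def)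
  have sums: "sum_list (map k theta_idxs) = sum k (UNIV - {r_idx})" for k :: "'n \<Rightarrow> nat"
    by (simp add: sum_list_distinct_conv_sum_set distinct_theta_idxs set_theta_idxs)
  have 1: "theta_power (scaled_deriv_eta f) \<beta> w = (\<lambda>z. (f (fst z $ r_idx) ^ sum \<beta> (UNIV - {r_idx})) *\<^sub>R w' z)"
    using theta_power_scaled[of "scaled_deriv_eta f" f "\<lambda>i. (0, axis i 1)" w theta_idxs \<beta> "\<lambda>_. 1"] B w
    by (simp add: theta_power_def scaled_derivs set_theta_idxs sums w'_def)
  have 2: "theta_power (scaled_deriv_theta f) \<alpha> (\<lambda>z. (f (fst z $ r_idx) ^ sum \<beta> (UNIV - {r_idx})) *\<^sub>R w' z) =
    (\<lambda>z. (inverse (f (fst z $ r_idx)) ^ sum \<alpha> (UNIV - {r_idx}) * f (fst z $ r_idx) ^ sum \<beta> (UNIV - {r_idx})) *\<^sub>R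
       partials (concat (map (\<lambda>i. replicate (\<alpha> i) (axis i 1, 0)) theta_idxs)) w' z)"
    using theta_power_scaled[of "scaled_deriv_theta f" "\<lambda>r. inverse (f r)" "\<lambda>i. (axis i 1, 0)" w' theta_idxs \<alpha> "\<lambda>r. f r ^ sum \<beta> (UNIV - {r_idx})"] B w'
    by (simp add: theta_power_def scaled_derivs set_theta_idxs sums)
  show ?thesis
    unfolding weighted_deriv_def w_eq 1 2 by (simp add: w'_def w_def canonical_word_def)
qed

lemma scaled_bracket_ge_1: "1 \<le> scaled_bracket f z"
  by (auto simp: scaled_bracket_def case_prod_beta sum_nonneg)

text \<open>A continuous function that exceeds \<open>B\<close> at one point does so on a nonempty open set, which has positive
  measure.\<close>

lemma continuous_Linf_bound:
  fixes g :: "'a::euclidean_space \<Rightarrow> 'b::real_normed_vector"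
  assumes g: "continuous_on UNIV g" and B: "Linf_norm g \<le> ennreal B" "0 \<le> B"
  shows "norm (g x) \<le> B"
proof (rule ccontr)
  assume "\<not> norm (g x) \<le> B"
  then have x: "x \<in> {x. B < norm (g x)}" by simp
  have o: "open {x. B < norm (g x)}"
    by (intro open_Collect_less continuous_intros g)
  have "AE x in lborel. ennreal (norm (g x)) \<le> Linf_norm g"
    unfolding Linf_norm_def by (rule esssup_AE)
  then have "AE x in lborel. x \<notin> {x. B < norm (g x)}"
    by eventually_elim (use B in \<open>auto simp: not_less dest: order_trans\<close>)
  then have "{x. B < norm (g x)} \<in> null_sets lborel"
    using o by (subst (asm) AE_iff_null_sets[symmetric]) auto
  then have "{x. B < norm (g x)} \<in> null_sets lebesgue"
    by (rule null_sets_completionI)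
  then have "negligible {x. B < norm (g x)}" by (simp add: negligible_iff_null_sets)
  with open_not_negligible[OF o] x show False by blast
qed

lemma continuous_vec_nth_fst: "continuous_on A (\<lambda>z. fst z $ i)"
  by (intro continuous_intros)

text \<open>A word of derivatives is sorted into the order of the seminorm, and the corresponding term of the
  seminorm bounds it at every point. At order \<open>0\<close> the bracket only helps, since it is at least \<open>1\<close>
  and occurs with a nonnegative exponent.\<close>

lemma symbol_seminorm_jet:
  fixes a :: "'n::{finite,linorder} phase \<Rightarrow> complex"
  assumes f: "continuous_on UNIV f" "\<And>r. 1 \<le> f r" and a: "a \<in> symbol_class f 0"
    and bs: "set bs \<subseteq> Basis" "length bs \<le> N"
  shows "norm (partials bs a z) \<le> enn2real (symbol_seminorm f 0 N a) *
    prod_list (map (phase_weight (scale_vec f (fst z $ r_idx))) bs)"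
proof -
  have sm: "smooth a" and fin: "symbol_seminorm f 0 N a < \<infinity>"
    using a by (auto simp: symbol_class_def)
  define \<alpha> where "\<alpha> = (\<lambda>j. count (mset bs) (axis j 1, 0))"
  define \<beta> where "\<beta> = (\<lambda>j. count (mset bs) (0, axis j 1))"
  define B where "B = enn2real (symbol_seminorm f 0 N a)"
  define F where "F = f (fst z $ r_idx)"
  have F: "F \<ge> 1" by (simp add: F_def f)
  have m: "mset (canonical_word \<alpha> \<beta>) = mset bs"
    unfolding \<alpha>_def \<beta>_def by (rule mset_canonical_word[OF bs(1)])
  have len: "order_of \<alpha> + order_of \<beta> = length bs"
  proof -
    have split: "order_of k = sum k (UNIV - {r_idx}) + k r_idx" for k :: "'n \<Rightarrow> nat"
      by (simp add: sum.remove[of UNIV r_idx k])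
    have "length bs = length (canonical_word \<alpha> \<beta>)" using m by (metis size_mset)
    also have "\<dots> = order_of \<alpha> + order_of \<beta>"
      by (simp add: canonical_word_def length_concat split comp_def sum_list_distinct_conv_sum_set
         distinct_theta_idxs set_theta_idxs)
    finally show ?thesis by simp
  qed
  let ?g = "\<lambda>z. weighted_deriv f \<alpha> \<beta> a z /\<^sub>R scaled_bracket f z powr (0 - real (order_of \<beta>))"
  have "Linf_norm ?g \<le> symbol_seminorm f 0 N a"
  proof -
    have "(case (\<alpha>, \<beta>) of (\<alpha>, \<beta>) \<Rightarrow> Linf_norm (\<lambda>z. weighted_deriv f \<alpha> \<beta> a z /\<^sub>R scaled_bracket f z powr (0 - real (order_of \<beta>))))
      \<le> symbol_seminorm f 0 N a"
      unfolding symbol_seminorm_def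
      by (rule member_le_sum) (use finite_multiindices len bs in auto)
    then show ?thesis by simp
  qed
  also have "\<dots> = ennreal B" using fin by (simp add: B_def)
  finally have Linf: "Linf_norm ?g \<le> ennreal B" .
  have c1: "continuous_on UNIV (\<lambda>z :: 'n phase. f (fst z $ r_idx))"
    by (rule continuous_on_compose2[OF f(1) continuous_vec_nth_fst]) auto
  have fne: "f r \<noteq> 0" for r using f(2)[of r] by linarith
  have c2: "continuous_on UNIV (scaled_bracket f :: 'n phase \<Rightarrow> real)"
    unfolding scaled_bracket_def case_prod_beta by (intro continuous_intros c1) (use fne in auto)
  have sbne: "scaled_bracket f z \<noteq> 0" for z :: "'n phase" using scaled_bracket_ge_1[of f z] by linarith
  have c3: "continuous_on UNIV ?g"
    unfolding weighted_deriv_eq[OF sm]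
    by (intro continuous_intros c1 c2 smooth_continuous smooth_partials sm)
      (use fne sbne m bs(1) mset_eq_setD[OF m] in auto)
  have "norm (?g z) \<le> B"
    by (rule continuous_Linf_bound[OF c3 Linf]) (simp add: B_def)
  moreover have "norm (weighted_deriv f \<alpha> \<beta> a z) * 1 \<le> norm (weighted_deriv f \<alpha> \<beta> a z) * inverse (scaled_bracket f z powr (0 - real (order_of \<beta>)))"
    by (intro mult_left_mono) (use scaled_bracket_ge_1[of f z] in \<open>auto simp: powr_minus ge_one_powr_ge_zero sum_nonneg\<close>)
  ultimately have wd: "norm (weighted_deriv f \<alpha> \<beta> a z) \<le> B"
    by (simp add: mult.commute)
  have part: "partials (canonical_word \<alpha> \<beta>) a = partials bs a"
    by (rule partials_mset_cong[OF m sm]) (use bs(1) mset_eq_setD[OF m] in simp)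
  have wt: "prod_list (map (phase_weight (scale_vec f (fst z $ r_idx))) bs) = F ^ sum \<alpha> (UNIV - {r_idx}) * inverse F ^ sum \<beta> (UNIV - {r_idx})"
  proof -
    have "prod_list (map (phase_weight (scale_vec f (fst z $ r_idx))) bs) =
        prod_list (map (phase_weight (scale_vec f (fst z $ r_idx))) (canonical_word \<alpha> \<beta>))"
      using m by (metis mset_map prod_mset_prod_list)
    also have "\<dots> = F ^ sum \<alpha> (UNIV - {r_idx}) * inverse F ^ sum \<beta> (UNIV - {r_idx})"
    proof -
      have 1: "prod_list (map W (concat (map (\<lambda>i. replicate (k i) (e i)) theta_idxs))) = G ^ sum k (UNIV - {r_idx})"
        if "\<And>i. i \<noteq> r_idx \<Longrightarrow> W (e i) = G" for W :: "'n phase \<Rightarrow> real" and k e G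
      proof -
        have "set xs \<subseteq> UNIV - {r_idx} \<Longrightarrow> prod_list (map W (concat (map (\<lambda>i. replicate (k i) (e i)) xs))) = G ^ sum_list (map k xs)" for xs
          by (induction xs) (auto simp: that power_add)
        from this[of theta_idxs] show ?thesis
          by (simp add: sum_list_distinct_conv_sum_set distinct_theta_idxs set_theta_idxs)
      qed
      show ?thesis
        by (simp add: canonical_word_def 1[of _ _ F] 1[of _ _ "inverse F"] phase_weight_q phase_weight_p scale_vec_def F_def)
    qed
    finally show ?thesis .
  qed
  have "norm (weighted_deriv f \<alpha> \<beta> a z) = inverse F ^ sum \<alpha> (UNIV - {r_idx}) * F ^ sum \<beta> (UNIV - {r_idx}) * norm (partials bs a z)"
    unfolding weighted_deriv_eq[OF sm] part using F by (simp add: F_def abs_mult)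
  then have "(inverse F ^ sum \<alpha> (UNIV - {r_idx}) * F ^ sum \<beta> (UNIV - {r_idx})) * norm (partials bs a z) \<le> B"
    using wd by simp
  then have "norm (partials bs a z) \<le> B * (F ^ sum \<alpha> (UNIV - {r_idx}) * inverse F ^ sum \<beta> (UNIV - {r_idx}))"
    using F by (simp add: field_simps)
  then show ?thesis by (simp add: wt B_def)
qed

section \<open>Integration by parts and Green's function\<close>

lemma integrable_bounded_support:
  fixes g :: "'a::euclidean_space \<Rightarrow> 'b::{banach, second_countable_topology}"
  assumes [measurable]: "g \<in> borel_measurable borel" and B: "\<And>x. norm (g x) \<le> B"
    and R: "\<And>x. norm x > R \<Longrightarrow> g x = 0"
  shows "integrable lborel g"
proof (rule Bochner_Integration.integrable_bound)
  show "integrable lborel (\<lambda>x. B * indicat_real (cball (0::'a) R) x)"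
    by (intro integrable_mult_right integrable_real_indicator)
      (use emeasure_bounded_finite[of "cball (0::'a) R"] in \<open>auto simp: less_top\<close>)
  have "0 \<le> B" using B[of 0] norm_ge_zero order_trans by blast
  then show "AE x in lborel. norm (g x) \<le> norm (B * indicat_real (cball (0::'a) R) x)"
    using B R by (auto simp: indicator_def not_le intro!: AE_I2)
qed simp

lemma continuous_compact_support_bounded:
  fixes g :: "'a::euclidean_space \<Rightarrow> 'b::real_normed_vector"
  assumes "continuous_on UNIV g" "\<And>x. norm x > R \<Longrightarrow> g x = 0"
  obtains B where "B \<ge> 0" "\<And>x. norm (g x) \<le> B"
proof -
  have "compact (g ` cball 0 R)"
    by (intro compact_continuous_image continuous_on_subset[OF assms(1)]) auto
  then have "bounded (g ` cball 0 R)" by (rule compact_imp_bounded)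
  then obtain B where B: "\<And>x. x \<in> cball 0 R \<Longrightarrow> norm (g x) \<le> B"
    unfolding bounded_iff by blast
  have "norm (g x) \<le> max B 0" for x
    using B[of x] assms(2)[of x] by (cases "norm x \<le> R") auto
  then show ?thesis using that[of "max B 0"] by auto
qed

lemma integrable_continuous_support:
  fixes g :: "'a::euclidean_space \<Rightarrow> 'b::{banach, second_countable_topology}"
  assumes "continuous_on UNIV g" "\<And>x. norm x > R \<Longrightarrow> g x = 0"
  shows "integrable lborel g"
proof -
  obtain B where "\<And>x. norm (g x) \<le> B" using continuous_compact_support_bounded[OF assms] by blast
  then show ?thesis
    by (intro integrable_bounded_support assms(2) borel_measurable_continuous_onI assms(1))
qed

lemma integral_translate:
  fixes g :: "'a::euclidean_space \<Rightarrow> 'b::euclidean_space"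
  assumes "g \<in> borel_measurable borel"
  shows "(\<integral>x. g (x + c) \<partial>lborel) = (\<integral>x. g x \<partial>lborel)"
proof -
  have "(\<integral>x. g x \<partial>lborel) = (\<integral>x. g x \<partial>distr lborel borel ((+) c))"
    by (simp add: lborel_distr_plus)
  also have "\<dots> = (\<integral>x. g (c + x) \<partial>lborel)"
    using assms by (intro integral_distr) auto
  finally show ?thesis by (simp add: add.commute)
qed

lemma lborel_integrable_translate:
  fixes g :: "'a::euclidean_space \<Rightarrow> 'b::{banach, second_countable_topology}"
  assumes "integrable lborel g"
  shows "integrable lborel (\<lambda>x. g (x + c))"
proof -
  have "integrable (distr lborel borel ((+) c)) g" using assms by (simp add: lborel_distr_plus)
  then have "integrable lborel (\<lambda>x. g (c + x))"
    by (subst (asm) integrable_distr_eq) (use assms in auto)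
  then show ?thesis by (simp add: add.commute)
qed

lemma nn_integral_translate:
  fixes g :: "'a::euclidean_space \<Rightarrow> ennreal"
  assumes [measurable]: "g \<in> borel_measurable borel"
  shows "(\<integral>\<^sup>+x. g (x + c) \<partial>lborel) = (\<integral>\<^sup>+x. g x \<partial>lborel)"
proof -
  have "(\<integral>\<^sup>+x. g x \<partial>lborel) = (\<integral>\<^sup>+x. g x \<partial>distr lborel borel ((+) c))"
    by (simp add: lborel_distr_plus)
  also have "\<dots> = (\<integral>\<^sup>+x. g (c + x) \<partial>lborel)"
    by (intro nn_integral_distr) auto
  finally show ?thesis by (simp add: add.commute)
qed

text \<open>No boundary terms appear: the integral of \<open>F (x + b) - F x\<close> vanishes by translation
  invariance, and by the fundamental theorem of calculus it is the average over \<open>h\<close> between \<open>0\<close> and \<open>1\<close> of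
  the integrals of \<open>partial b F (x + h b)\<close>, none of which depends on \<open>h\<close>.\<close>

lemma integral_partial_eq_0:
  fixes F :: "'a::euclidean_space \<Rightarrow> 'b::euclidean_space"
  assumes d: "\<And>x. F differentiable (at x)" and c: "continuous_on UNIV (partial b F)"
    and intF: "integrable lborel F" and intD: "integrable lborel (partial b F)"
  shows "(\<integral>x. partial b F x \<partial>lborel) = 0"
proof -
  let ?H = "\<lambda>(h, x). indicat_real {0..1} h *\<^sub>R partial b F (x + h *\<^sub>R b)"
  have cH: "continuous_on UNIV (\<lambda>z::real \<times> 'a. partial b F (snd z + fst z *\<^sub>R b))"
    by (rule continuous_on_compose2[OF c]) (auto intro!: continuous_intros)
  have mH: "?H \<in> borel_measurable (lborel \<Otimes>\<^sub>M lborel)"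
    using borel_measurable_continuous_onI[OF cH] unfolding case_prod_beta
    by (intro borel_measurable_scaleR) (auto simp: borel_prod[symmetric])
  have [measurable]: "F \<in> borel_measurable borel" "partial b F \<in> borel_measurable borel"
    using intF intD by auto
  have shift: "integrable lborel (\<lambda>x. partial b F (x + v))" for v
    using lborel_integrable_translate[OF intD] .
  have nrm: "(\<integral>x. norm (?H (h, x)) \<partial>lborel) = indicat_real {0..1} h *\<^sub>R (\<integral>x. norm (partial b F x) \<partial>lborel)" for h
    using integral_translate[of "\<lambda>x. norm (partial b F x)" "h *\<^sub>R b"] by simp
  have int: "integrable (lborel \<Otimes>\<^sub>M lborel) ?H"
  proof (rule lborel_pair.Fubini_integrable[OF mH])
    show "integrable lborel (\<lambda>h. \<integral>x. norm (?H (h, x)) \<partial>lborel)"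
      unfolding nrm by (intro integrable_scaleR_left integrable_real_indicator) auto
    show "AE h in lborel. integrable lborel (\<lambda>x. ?H (h, x))"
      using shift by auto
  qed
  have FTC: "(\<integral>h. ?H (h, x) \<partial>lborel) = F (x + b) - F x" for x
  proof -
    have "(\<integral>h. indicat_real {0..1} h *\<^sub>R partial b F (x + h *\<^sub>R b) \<partial>lborel) = F (x + 1 *\<^sub>R b) - F (x + 0 *\<^sub>R b)"
      by (rule integral_FTC_Icc)
       (auto intro!: has_vector_derivative_at_within partial_along d continuous_on_compose2[OF c] continuous_intros)
    then show ?thesis by simp
  qed
  have intFb: "integrable lborel (\<lambda>x. F (x + b))"
    using lborel_integrable_translate[OF intF] .
  have "0 = (\<integral>x. F (x + b) - F x \<partial>lborel)"
    by (subst Bochner_Integration.integral_diff[OF intFb intF]) (simp add: integral_translate)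
  also have "\<dots> = (\<integral>x. \<integral>h. ?H (h, x) \<partial>lborel \<partial>lborel)" by (simp only: FTC)
  also have "\<dots> = (\<integral>h. \<integral>x. ?H (h, x) \<partial>lborel \<partial>lborel)"
    using lborel_pair.Fubini_integral[of "\<lambda>h x. ?H (h, x)"] int by simp
  also have "\<dots> = (\<integral>h. indicat_real {0..1::real} h *\<^sub>R (\<integral>x. partial b F x \<partial>lborel) \<partial>lborel)"
    by (simp add: integral_translate)
  also have "\<dots> = (\<integral>x. partial b F x \<partial>lborel)"
    by simp
  finally show ?thesis by simp
qed

lemma partial_zero_outside:
  fixes g :: "'a::euclidean_space \<Rightarrow> 'b::real_normed_vector"
  assumes "\<And>x. norm x > R \<Longrightarrow> g x = 0" "norm x > R"
  shows "partials bs g x = 0"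
  by (rule partials_eq_0_on_open[of "{x. norm x > R}"])
    (use assms in \<open>auto intro!: open_Collect_less continuous_intros\<close>)

lemma has_derivative_wave:
  "((\<lambda>p. exp (\<i> * complex_of_real (p \<bullet> s))) has_derivative
    (\<lambda>v. \<i> * of_real (v \<bullet> s) * exp (\<i> * complex_of_real (p \<bullet> s)))) (at p)"
proof -
  have "((\<lambda>p. \<i> * complex_of_real (p \<bullet> s)) has_derivative (\<lambda>v. \<i> * of_real (v \<bullet> s))) (at p)"
    by (intro has_derivative_mult_right has_derivative_of_real has_derivative_inner_left has_derivative_ident)
  from has_derivative_compose[OF this DERIV_exp[unfolded has_field_derivative_def]] show ?thesis
    by (simp add: mult.commute)
qed

text \<open>Integration by parts: a factor \<open>s \<bullet> b\<close> in front of the phase \<open>exp (i p s)\<close> becomes a derivative of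
  the amplitude.\<close>

lemma wave_integral_by_parts:
  fixes g :: "'a::euclidean_space \<Rightarrow> complex"
  assumes g: "smooth g" and R: "\<And>x. norm x > R \<Longrightarrow> g x = 0" and b: "b \<in> Basis"
  shows "(\<integral>p. exp (\<i> * of_real (p \<bullet> s)) * (\<i> * partial b g p) \<partial>lborel) =
    of_real (s \<bullet> b) * (\<integral>p. exp (\<i> * of_real (p \<bullet> s)) * g p \<partial>lborel)"
proof -
  let ?e = "\<lambda>p. exp (\<i> * complex_of_real (p \<bullet> s))"
  have ce: "continuous_on UNIV ?e" by (intro continuous_intros)
  have sb: "smooth (partial b g)" by (rule smooth_partial[OF g b])
  have *: "((\<lambda>p. ?e p * g p) has_derivative
      (\<lambda>v. ?e p * frechet_derivative g (at p) v + (\<i> * of_real (v \<bullet> s) * ?e p) * g p)) (at p)" for p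
    by (rule has_derivative_mult[OF has_derivative_wave smoothD[OF g, THEN frechet_derivative_works[THEN iffD1]]])
  have fd: "partial b g p = frechet_derivative g (at p) b" for p
    by (rule partial_eqI) (rule smoothD[OF g, THEN frechet_derivative_works[THEN iffD1]])
  have p: "partial b (\<lambda>p. ?e p * g p) = (\<lambda>p. ?e p * partial b g p + \<i> * of_real (s \<bullet> b) * (?e p * g p))"
    by (rule ext, rule partial_eqI[OF *, THEN trans]) (simp add: fd inner_commute[of b] mult_ac)
  have int1: "integrable lborel (\<lambda>p. ?e p * partial b g p)"
    using partial_zero_outside[of R g _ "[b]"] R
    by (intro integrable_continuous_support[where R = R] continuous_intros ce smooth_continuous sb) auto
  have int2: "integrable lborel (\<lambda>p. ?e p * g p)"
    using R by (intro integrable_continuous_support[where R = R] continuous_intros ce smooth_continuous g) auto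
  have "0 = (\<integral>p. partial b (\<lambda>p. ?e p * g p) p \<partial>lborel)"
  proof (rule integral_partial_eq_0[symmetric])
    show "(\<lambda>p. ?e p * g p) differentiable at x" for x using * unfolding differentiable_def by blast
    show "continuous_on UNIV (partial b (\<lambda>p. ?e p * g p))"
      unfolding p by (intro continuous_intros ce smooth_continuous sb g)
    show "integrable lborel (\<lambda>p. ?e p * g p)" by (rule int2)
    show "integrable lborel (partial b (\<lambda>p. ?e p * g p))"
      unfolding p by (intro Bochner_Integration.integrable_add int1 integrable_mult_right int2)
  qed
  also have "\<dots> = (\<integral>p. ?e p * partial b g p \<partial>lborel) + \<i> * of_real (s \<bullet> b) * (\<integral>p. ?e p * g p \<partial>lborel)"
    unfolding p by (subst Bochner_Integration.integral_add) (auto intro: int1 int2)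
  finally have "(\<integral>p. ?e p * partial b g p \<partial>lborel) = - (\<i> * of_real (s \<bullet> b) * (\<integral>p. ?e p * g p \<partial>lborel))"
    by (simp add: eq_neg_iff_add_eq_0)
  moreover have "(\<integral>p. ?e p * (\<i> * partial b g p) \<partial>lborel) = \<i> * (\<integral>p. ?e p * partial b g p \<partial>lborel)"
    by (subst integral_mult_right_zero[symmetric]) (simp add: mult_ac)
  ultimately show ?thesis by (simp add: mult.assoc[symmetric])
qed

definition green :: "real \<Rightarrow> real \<Rightarrow> real"
  where "green l s = l * exp (- (l * \<bar>s\<bar>)) / 2"

text \<open>\<open>green l\<close> is the fundamental solution of \<open>1 - l\<^sup>-\<^sup>2 d\<^sup>2/ds\<^sup>2\<close>, so a function is recovered from its image
  under this operator by convolution. On each half line the integrand has an explicit primitive; the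
  two boundary terms at \<open>0\<close> add up to the value there, because the derivative of \<open>green l\<close> jumps by
  \<open>- l\<^sup>2\<close>.\<close>

lemma green_representation:
  fixes g :: "'a::euclidean_space \<Rightarrow> complex"
  assumes g: "smooth g" and R: "\<And>x. norm x > R \<Longrightarrow> g x = 0" and b: "b \<in> Basis" and l: "l > 0"
  shows "(\<integral>s. green l s *\<^sub>R (g (x + s *\<^sub>R b) - (1 / l)\<^sup>2 *\<^sub>R partial b (partial b g) (x + s *\<^sub>R b)) \<partial>lborel) = g x"
proof -
  \<comment> \<open>outside \<open>{- T..T}\<close> the line leaves the support of \<open>g\<close>\<close>
  define T where "T = \<bar>R\<bar> + norm x + 1"
  define \<phi>0 where "\<phi>0 s = g (x + s *\<^sub>R b)" for s
  define \<phi>1 where "\<phi>1 s = partial b g (x + s *\<^sub>R b)" for s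
  define \<phi>2 where "\<phi>2 s = partial b (partial b g) (x + s *\<^sub>R b)" for s
  have d0: "(\<phi>0 has_vector_derivative \<phi>1 s) (at s within A)" for s A
    unfolding \<phi>0_def \<phi>1_def by (rule has_vector_derivative_at_within, rule partial_along, rule smoothD[OF g])
  have d1: "(\<phi>1 has_vector_derivative \<phi>2 s) (at s within A)" for s A
    unfolding \<phi>1_def \<phi>2_def
    by (rule has_vector_derivative_at_within, rule partial_along, rule smoothD[OF smooth_partial[OF g b]])
  have cont': "continuous_on A (\<lambda>s. h (x + s *\<^sub>R b))" if "smooth h" for h :: "'a \<Rightarrow> complex" and A
    by (rule continuous_on_compose2[OF smooth_continuous[OF that, of UNIV]]) (auto intro!: continuous_intros)
  have cont: "continuous_on A \<phi>0" "continuous_on A \<phi>2" for A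
    unfolding \<phi>0_def \<phi>2_def by (rule cont', intro smooth_partial g b)+
  have T: "T > 0" by (auto simp: T_def intro: add_nonneg_pos)
  have outside: "R < norm (x + s *\<^sub>R b)" if "\<bar>s\<bar> \<ge> T" for s
    using norm_diff_ineq[of "s *\<^sub>R b" x] that b by (simp add: T_def add.commute)
  have z: "\<phi>0 s = 0" "\<phi>1 s = 0" "\<phi>2 s = 0" if "\<bar>s\<bar> \<ge> T" for s
    using partial_zero_outside[OF R outside[OF that], where bs = "[b]"] partial_zero_outside[OF R outside[OF that], where bs = "[b,b]"]
      R[OF outside[OF that]] by (auto simp: \<phi>0_def \<phi>1_def \<phi>2_def)
  \<comment> \<open>the primitive on the half line of sign \<open>\<sigma>\<close>\<close>
  have half: "((\<lambda>s. (- \<sigma> / 2 * exp (- (\<sigma> * l * s))) *\<^sub>R (\<phi>0 s + (\<sigma> / l) *\<^sub>R \<phi>1 s))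
      has_vector_derivative (l * exp (- (\<sigma> * l * s)) / 2) *\<^sub>R (\<phi>0 s - (1 / l)\<^sup>2 *\<^sub>R \<phi>2 s)) (at s within A)"
    if \<sigma>: "\<sigma> * \<sigma> = 1" for \<sigma> s A
  proof -
    have "((\<lambda>s. - \<sigma> / 2 * exp (- (\<sigma> * l * s))) has_field_derivative (l / 2 * exp (- (\<sigma> * l * s)))) (at s within A)"
      using \<sigma> by (auto intro!: derivative_eq_intros simp: algebra_simps)
    moreover have "((\<lambda>s. \<phi>0 s + (\<sigma> / l) *\<^sub>R \<phi>1 s) has_vector_derivative (\<phi>1 s + (\<sigma> / l) *\<^sub>R \<phi>2 s)) (at s within A)"
      by (intro has_vector_derivative_add d0 d1 bounded_linear.has_vector_derivative[OF bounded_linear_scaleR_right])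
    ultimately have "((\<lambda>s. (- \<sigma> / 2 * exp (- (\<sigma> * l * s))) *\<^sub>R (\<phi>0 s + (\<sigma> / l) *\<^sub>R \<phi>1 s)) has_vector_derivative
      (- \<sigma> / 2 * exp (- (\<sigma> * l * s))) *\<^sub>R (\<phi>1 s + (\<sigma> / l) *\<^sub>R \<phi>2 s) +
      (l / 2 * exp (- (\<sigma> * l * s))) *\<^sub>R (\<phi>0 s + (\<sigma> / l) *\<^sub>R \<phi>1 s)) (at s within A)"
      by (rule has_vector_derivative_scaleR)
    moreover have "(- \<sigma> / 2 * exp (- (\<sigma> * l * s))) *\<^sub>R (\<phi>1 s + (\<sigma> / l) *\<^sub>R \<phi>2 s) +
      (l / 2 * exp (- (\<sigma> * l * s))) *\<^sub>R (\<phi>0 s + (\<sigma> / l) *\<^sub>R \<phi>1 s) =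
      (l * exp (- (\<sigma> * l * s)) / 2) *\<^sub>R (\<phi>0 s - (1 / l)\<^sup>2 *\<^sub>R \<phi>2 s)"
    proof -
      have "(- \<sigma> / 2 * E) *\<^sub>R (u + (\<sigma> / l) *\<^sub>R v) + (l / 2 * E) *\<^sub>R (w + (\<sigma> / l) *\<^sub>R u) = (l * E / 2) *\<^sub>R (w - (1 / l)\<^sup>2 *\<^sub>R v)"
        for E :: real and u v w :: complex
        using l \<sigma> by (simp add: complex_eq_iff field_simps power2_eq_square)
      then show ?thesis .
    qed
    ultimately show ?thesis by simp
  qed
  let ?I = "\<lambda>\<sigma> s. (l * exp (- (\<sigma> * l * s)) / 2) *\<^sub>R (\<phi>0 s - (1 / l)\<^sup>2 *\<^sub>R \<phi>2 s)"
  have cI: "continuous_on A (?I \<sigma>)" for \<sigma> A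
    by (intro continuous_intros cont) auto
  have r: "has_bochner_integral lborel (\<lambda>s. indicator {0..T} s *\<^sub>R ?I 1 s) ((1/2) *\<^sub>R (\<phi>0 0 + (1 / l) *\<^sub>R \<phi>1 0))"
    using has_bochner_integral_FTC_Icc[of 0 T _ "?I 1", OF _ half[of 1 _ "{0..T}"] cI] T z[of T]
    by simp
  have n: "has_bochner_integral lborel (\<lambda>s. indicator {-T..0} s *\<^sub>R ?I (-1) s) ((1/2) *\<^sub>R (\<phi>0 0 - (1 / l) *\<^sub>R \<phi>1 0))"
    using has_bochner_integral_FTC_Icc[of "-T" 0 _ "?I (-1)", OF _ half[of "-1" _ "{-T..0}"] cI] T z[of "-T"]
    by simp
  have "has_bochner_integral lborel (\<lambda>s. indicator {0..T} s *\<^sub>R ?I 1 s + indicator {-T..0} s *\<^sub>R ?I (-1) s) (\<phi>0 0)"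
    using has_bochner_integral_add[OF r n] by (simp add: scaleR_add_right scaleR_diff_right scaleR_half_double)
  then have "(\<integral>s. indicator {0..T} s *\<^sub>R ?I 1 s + indicator {-T..0} s *\<^sub>R ?I (-1) s \<partial>lborel) = \<phi>0 0"
    by (rule has_bochner_integral_integral_eq)
  moreover have "(\<integral>s. green l s *\<^sub>R (\<phi>0 s - (1 / l)\<^sup>2 *\<^sub>R \<phi>2 s) \<partial>lborel) =
     (\<integral>s. indicator {0..T} s *\<^sub>R ?I 1 s + indicator {-T..0} s *\<^sub>R ?I (-1) s \<partial>lborel)"
  proof (rule integral_cong_AE)
    show "AE s in lborel. green l s *\<^sub>R (\<phi>0 s - (1 / l)\<^sup>2 *\<^sub>R \<phi>2 s) = indicator {0..T} s *\<^sub>R ?I 1 s + indicator {-T..0} s *\<^sub>R ?I (-1) s"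
      using AE_lborel_singleton[of 0]
    proof eventually_elim
      case (elim s)
      consider "s > T" | "0 < s" "s \<le> T" | "s < 0" "- T \<le> s" | "s < - T" using elim by (smt (verit))
      then show ?case
        by cases (use z[of s] T in \<open>simp_all add: indicator_def green_def\<close>)
    qed
    show "(\<lambda>s. green l s *\<^sub>R (\<phi>0 s - (1 / l)\<^sup>2 *\<^sub>R \<phi>2 s)) \<in> borel_measurable lborel"
    proof -
      have "continuous_on UNIV (\<lambda>s. green l s *\<^sub>R (\<phi>0 s - (1 / l)\<^sup>2 *\<^sub>R \<phi>2 s))"
        unfolding green_def by (intro continuous_intros cont) auto
      then show ?thesis by (simp add: borel_measurable_continuous_onI)
    qed
    show "(\<lambda>s. indicator {0..T} s *\<^sub>R ?I 1 s + indicator {-T..0} s *\<^sub>R ?I (-1) s) \<in> borel_measurable lborel"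
      by (rule borel_measurable_add[OF borel_measurable_has_bochner_integral[OF r] borel_measurable_has_bochner_integral[OF n]])
  qed
  ultimately show ?thesis by (simp add: \<phi>0_def \<phi>2_def)
qed

section \<open>Fourier transforms\<close>

text \<open>The coordinates with respect to the basis are independent under Lebesgue measure, as it is a
  product measure.\<close>

lemma lborel_product_function:
  fixes h :: "'a::euclidean_space \<Rightarrow> real \<Rightarrow> complex"
  assumes int: "\<And>b. b \<in> Basis \<Longrightarrow> integrable lborel (h b)"
  shows integrable_product_function: "integrable lborel (\<lambda>x::'a. \<Prod>b\<in>Basis. h b (x \<bullet> b))"
    and integral_product_function: "(\<integral>x. (\<Prod>b\<in>Basis. h b (x \<bullet> b)) \<partial>(lborel :: 'a measure)) = (\<Prod>b\<in>Basis. \<integral>t. h b t \<partial>lborel)"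
proof -
  interpret product_sigma_finite "\<lambda>_::'a. lborel :: real measure" ..
  let ?T = "\<lambda>f. \<Sum>b\<in>Basis. f b *\<^sub>R (b::'a)"
  have T: "?T \<in> measurable (Pi\<^sub>M Basis (\<lambda>_. lborel)) borel" by measurable
  have L: "lborel = distr (Pi\<^sub>M Basis (\<lambda>_. lborel)) borel ?T"
    unfolding lborel_def[where 'a='a] lborel_eq_real ..
  have Tb: "(\<Prod>b\<in>Basis. h b (?T f \<bullet> b)) = (\<Prod>b\<in>Basis. h b (f b))" for f
    by (rule prod.cong) (auto simp: inner_sum_left_Basis)
  have m: "(\<lambda>x::'a. \<Prod>b\<in>Basis. h b (x \<bullet> b)) \<in> borel_measurable borel"
  proof (rule borel_measurable_prod)
    fix b :: 'a assume "b \<in> Basis"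
    then have [measurable]: "h b \<in> borel_measurable borel" using int[of b] by auto
    show "(\<lambda>x. h b (x \<bullet> b)) \<in> borel_measurable borel" by measurable
  qed
  show "integrable lborel (\<lambda>x::'a. \<Prod>b\<in>Basis. h b (x \<bullet> b))"
    by (subst L, subst integrable_distr_eq[OF T m]) (unfold Tb, intro product_integrable_prod int finite_Basis)
  show "(\<integral>x. (\<Prod>b\<in>Basis. h b (x \<bullet> b)) \<partial>(lborel :: 'a measure)) = (\<Prod>b\<in>Basis. \<integral>t. h b t \<partial>lborel)"
    by (subst L, subst integral_distr[OF T m]) (unfold Tb, intro product_integral_prod int finite_Basis)
qed

definition gauss :: "real \<Rightarrow> real \<Rightarrow> real"
  where "gauss e t = exp (- (e\<^sup>2 * t\<^sup>2 / 2))"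

lemma gauss_measurable [measurable]: "gauss e \<in> borel_measurable borel"
  unfolding gauss_def[abs_def] by measurable

lemma gauss_bounds: "0 < gauss e t" "gauss e t \<le> 1"
  by (auto simp: gauss_def)

lemma gauss_fourier:
  assumes e: "e > 0"
  shows gauss_integrable: "integrable lborel (gauss e)"
    and gauss_fourier_integral:
      "(\<integral>t. exp (\<i> * of_real (t * x)) * of_real (gauss e t) \<partial>lborel) = of_real (sqrt (2 * pi) / e * gauss (1 / e) x)"
proof -
  have "integrable lborel (\<lambda>t::real. std_normal_density (0 + e * t))"
    by (rule lborel_integrable_real_affine) (use e integrable_std_normal_moment[of 0] in auto)
  then have "integrable lborel (\<lambda>t::real. sqrt (2 * pi) * std_normal_density (0 + e * t))"
    by (rule integrable_mult_right)
  moreover have "(\<lambda>t::real. sqrt (2 * pi) * std_normal_density (0 + e * t)) = gauss e"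
    by (auto simp: std_normal_density_def gauss_def power_mult_distrib fun_eq_iff)
  ultimately show "integrable lborel (gauss e)" by (simp only:)
  have "complex_of_real (exp (- ((x / e)\<^sup>2) / 2)) = (\<integral>y. exp (\<i> * of_real ((x / e) * y)) \<partial>std_normal_distribution)"
    using fun_cong[OF char_std_normal_distribution, of "x / e"] by (simp add: char_def)
  also have "\<dots> = (\<integral>y. std_normal_density y *\<^sub>R exp (\<i> * of_real ((x / e) * y)) \<partial>lborel)"
    by (subst integral_density) (auto simp: normal_density_nonneg)
  also have "\<dots> = e *\<^sub>R (\<integral>t. std_normal_density (0 + e * t) *\<^sub>R exp (\<i> * of_real ((x / e) * (0 + e * t))) \<partial>lborel)"
    by (subst lborel_integral_real_affine[of e _ 0]) (use e in auto)
  also have "(\<integral>t. std_normal_density (0 + e * t) *\<^sub>R exp (\<i> * of_real ((x / e) * (0 + e * t))) \<partial>lborel) =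
      (\<integral>t. of_real (1 / sqrt (2 * pi)) * (exp (\<i> * of_real (t * x)) * of_real (gauss e t)) \<partial>lborel)"
    using e by (intro Bochner_Integration.integral_cong)
      (auto simp: std_normal_density_def gauss_def scaleR_conv_of_real power_mult_distrib mult_ac)
  finally have *: "complex_of_real (exp (- ((x / e)\<^sup>2) / 2)) = of_real (e / sqrt (2 * pi)) * (\<integral>t. exp (\<i> * of_real (t * x)) * of_real (gauss e t) \<partial>lborel)"
    by (simp add: scaleR_conv_of_real)
  have "(\<integral>t. exp (\<i> * of_real (t * x)) * of_real (gauss e t) \<partial>lborel) =
    of_real (sqrt (2 * pi) / e) * (of_real (e / sqrt (2 * pi)) * (\<integral>t. exp (\<i> * of_real (t * x)) * of_real (gauss e t) \<partial>lborel))"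
  proof -
    have "sqrt (2 * pi) / e * (e / sqrt (2 * pi)) = 1" using e by simp
    then show ?thesis by (simp only: mult.assoc[symmetric] of_real_mult[symmetric] of_real_1 mult_1_left)
  qed
  also have "\<dots> = of_real (sqrt (2 * pi) / e * gauss (1 / e) x)"
    unfolding *[symmetric] by (simp add: gauss_def power_divide)
  finally show "(\<integral>t. exp (\<i> * of_real (t * x)) * of_real (gauss e t) \<partial>lborel) = of_real (sqrt (2 * pi) / e * gauss (1 / e) x)" .
qed

lemma gauss_integral: "e > 0 \<Longrightarrow> (\<integral>t. gauss e t \<partial>lborel) = sqrt (2 * pi) / e"
  using gauss_fourier_integral[of e 0] by (simp add: gauss_def flip: of_real_divide)

definition gauss_vec :: "real \<Rightarrow> 'a::euclidean_space \<Rightarrow> real"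
  where "gauss_vec e x = (\<Prod>b\<in>Basis. gauss e (x \<bullet> b))"

lemma gauss_vec_measurable [measurable]: "gauss_vec e \<in> borel_measurable borel"
  unfolding gauss_vec_def[abs_def] by measurable

lemma gauss_vec_bounds: "0 < gauss_vec e x" "gauss_vec e x \<le> 1"
  unfolding gauss_vec_def
  by (intro prod_pos ballI gauss_bounds) (intro prod_le_1 conjI gauss_bounds less_imp_le[OF gauss_bounds(1)])

lemma gauss_vec_minus: "gauss_vec e (- x) = gauss_vec e x"
  by (simp add: gauss_vec_def gauss_def)

lemma gauss_vec_integrable:
  assumes e: "e > 0"
  shows "integrable lborel (gauss_vec e :: 'a::euclidean_space \<Rightarrow> real)"
    and "(\<integral>x. gauss_vec e x \<partial>(lborel :: 'a measure)) = (sqrt (2 * pi) / e) ^ DIM('a)"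
proof -
  have i: "integrable lborel (\<lambda>t. complex_of_real (gauss e t))"
    using gauss_integrable[OF e] by simp
  have eq: "(\<Prod>b\<in>Basis. complex_of_real (gauss e (x \<bullet> b))) = of_real (gauss_vec e x)" for x :: 'a
    by (simp add: gauss_vec_def)
  show "integrable lborel (gauss_vec e :: 'a \<Rightarrow> real)"
    using integrable_product_function[of "\<lambda>_::'a. \<lambda>t. complex_of_real (gauss e t)", OF i]
    unfolding eq complex_of_real_integrable_eq .
  have "complex_of_real (\<integral>x. gauss_vec e x \<partial>(lborel :: 'a measure)) = (\<Prod>b\<in>(Basis::'a set). \<integral>t. complex_of_real (gauss e t) \<partial>lborel)"
    using integral_product_function[of "\<lambda>_::'a. \<lambda>t. complex_of_real (gauss e t)", OF i] unfolding eq by simp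
  also have "\<dots> = of_real ((sqrt (2 * pi) / e) ^ DIM('a))"
    using e by (simp add: gauss_integral)
  finally show "(\<integral>x. gauss_vec e x \<partial>(lborel :: 'a measure)) = (sqrt (2 * pi) / e) ^ DIM('a)"
    by (simp only: of_real_eq_iff)
qed

lemma gauss_vec_fourier:
  fixes x :: "'a::euclidean_space"
  assumes e: "e > 0"
  shows "(\<integral>p. exp (\<i> * of_real (x \<bullet> p)) * of_real (gauss_vec e p) \<partial>lborel) =
    of_real ((sqrt (2 * pi) / e) ^ DIM('a) * gauss_vec (1 / e) x)"
proof -
  have eq: "exp (\<i> * of_real (x \<bullet> p)) * of_real (gauss_vec e p) =
    (\<Prod>b\<in>Basis. exp (\<i> * of_real ((p \<bullet> b) * (x \<bullet> b))) * complex_of_real (gauss e (p \<bullet> b)))" for p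
  proof -
    have "exp (\<i> * of_real (x \<bullet> p)) = (\<Prod>b\<in>Basis. exp (\<i> * complex_of_real ((p \<bullet> b) * (x \<bullet> b))))"
      by (subst euclidean_inner) (simp add: exp_sum[symmetric] sum_distrib_left mult_ac)
    then show ?thesis by (simp add: gauss_vec_def prod.distrib)
  qed
  have prod_const: "(\<Prod>b\<in>(Basis::'a set). c * g b) = c ^ DIM('a) * (\<Prod>b\<in>Basis. g b)" for c :: real and g
    by (simp add: prod.distrib)
  have i: "integrable lborel (\<lambda>t. exp (\<i> * of_real (t * (x \<bullet> b))) * complex_of_real (gauss e t))" for b
  proof (rule Bochner_Integration.integrable_bound[OF gauss_integrable[OF e]])
    show "AE t in lborel. norm (exp (\<i> * of_real (t * (x \<bullet> b))) * complex_of_real (gauss e t)) \<le> norm (gauss e t)"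
      by (auto simp: norm_mult)
  qed measurable
  show ?thesis
    unfolding eq
    by (subst integral_product_function[of "\<lambda>b t. exp (\<i> * of_real (t * (x \<bullet> b))) * complex_of_real (gauss e t)", OF i])
      (simp only: gauss_fourier_integral[OF e] gauss_vec_def of_real_prod[symmetric] prod_const)
qed

subsection \<open>Bessel's inequality for the Fourier transform\<close>

lemma integrable_pair_product:
  fixes g h :: "'a::euclidean_space \<Rightarrow> complex"
  assumes "integrable lborel g" "integrable lborel h"
  shows "integrable (lborel \<Otimes>\<^sub>M lborel) (\<lambda>(x, y). g x * h y)"
proof -
  have [measurable]: "g \<in> borel_measurable borel" "h \<in> borel_measurable borel" using assms by auto
  show ?thesis
    by (rule lborel_pair.Fubini_integrable) (use assms in \<open>auto simp: norm_mult intro!: integrable_mult_left integrable_norm\<close>)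
qed

lemma norm_integral_le_nn_integral:
  fixes g :: "'a \<Rightarrow> 'b::{banach, second_countable_topology}"
  shows "ennreal (norm (\<integral>x. g x \<partial>M)) \<le> (\<integral>\<^sup>+x. ennreal (norm (g x)) \<partial>M)"
  by (cases "integrable M g") (auto intro: integral_norm_bound_ennreal simp: not_integrable_integral_eq)

text \<open>The Gaussian weight makes Fubini's theorem applicable. After exchanging the integrals the weight
  becomes its Fourier transform, a multiple of \<open>gauss_vec (1 / e) (x - y)\<close> with total mass
  \<open>(2 * pi) ^ DIM('a)\<close> whatever \<open>e\<close> is, and Schur's test for this convolution kernel gives the bound.\<close>

lemma bessel_gauss:
  fixes w :: "'a::euclidean_space \<Rightarrow> complex"
  assumes w: "integrable lborel w" and w2: "integrable lborel (\<lambda>x. (norm (w x))\<^sup>2)" and e: "e > 0"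
  shows "(\<integral>\<^sup>+p. ennreal (gauss_vec e p * (norm (\<integral>x. exp (\<i> * of_real (x \<bullet> p)) * w x \<partial>lborel))\<^sup>2) \<partial>lborel)
    \<le> ennreal ((2 * pi) ^ DIM('a) * (\<integral>x. (norm (w x))\<^sup>2 \<partial>lborel))"
proof -
  have [measurable]: "w \<in> borel_measurable borel" using w by auto
  define A where "A p = (\<integral>x. exp (\<i> * of_real (x \<bullet> p)) * w x \<partial>lborel)" for p
  define c where "c = (sqrt (2 * pi) / e) ^ DIM('a)"
  have c: "c > 0" using e by (simp add: c_def)
  have [measurable]: "A \<in> borel_measurable borel"
    unfolding A_def by measurable
  have iw: "integrable lborel (\<lambda>x. exp (\<i> * of_real (x \<bullet> p)) * w x)" for p
    by (rule Bochner_Integration.integrable_bound[OF w]) (auto simp: norm_mult)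
  have Abound: "norm (A p) \<le> (\<integral>x. norm (w x) \<partial>lborel)" for p
    unfolding A_def by (rule order_trans[OF integral_norm_bound]) (simp add: norm_mult)
  have iG: "integrable lborel (\<lambda>p::'a. gauss_vec e p * (norm (A p))\<^sup>2)"
  proof (rule Bochner_Integration.integrable_bound)
    show "integrable lborel (\<lambda>p::'a. gauss_vec e p * (\<integral>x. norm (w x) \<partial>lborel)\<^sup>2)"
      by (intro integrable_mult_left gauss_vec_integrable e)
    show "AE p in lborel. norm (gauss_vec e p * (norm (A p))\<^sup>2) \<le> norm (gauss_vec e p * (\<integral>x. norm (w x) \<partial>lborel)\<^sup>2)"
      by (intro AE_I2) (auto simp: abs_mult intro!: mult_left_mono power_mono Abound)
  qed measurable
  define W where "W z = w (fst z) * cnj (w (snd z))" for z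
  have [measurable]: "cnj \<in> borel_measurable borel"
    by (intro borel_measurable_continuous_onI continuous_intros)
  have [measurable]: "W \<in> borel_measurable (borel \<Otimes>\<^sub>M borel)" unfolding W_def by measurable
  have cw: "integrable lborel (\<lambda>y. cnj (w y))" using w by simp
  have iW: "integrable (lborel \<Otimes>\<^sub>M lborel) W"
    using integrable_pair_product[OF w cw] unfolding W_def[abs_def] case_prod_beta' .
  have sq: "complex_of_real ((norm (A p))\<^sup>2) = (\<integral>z. exp (\<i> * of_real ((fst z - snd z) \<bullet> p)) * W z \<partial>(lborel \<Otimes>\<^sub>M lborel))" for p
  proof -
    have "integrable (lborel \<Otimes>\<^sub>M lborel) (\<lambda>(x, y). (exp (\<i> * of_real (x \<bullet> p)) * w x) * cnj (exp (\<i> * of_real (y \<bullet> p)) * w y))"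
      by (rule integrable_pair_product[OF iw iw[THEN integrable_cnj]])
    from lborel_pair.integral_fst'[OF this]
    have "(\<integral>z. (case z of (x, y) \<Rightarrow> (exp (\<i> * of_real (x \<bullet> p)) * w x) * cnj (exp (\<i> * of_real (y \<bullet> p)) * w y)) \<partial>(lborel \<Otimes>\<^sub>M lborel)) = A p * cnj (A p)"
      by (simp only: prod.case integral_mult_right_zero integral_mult_left_zero Bochner_Integration.integral_cnj A_def)
    moreover have "(case z of (x, y) \<Rightarrow> (exp (\<i> * of_real (x \<bullet> p)) * w x) * cnj (exp (\<i> * of_real (y \<bullet> p)) * w y))
       = exp (\<i> * of_real ((fst z - snd z) \<bullet> p)) * W z" for z
      by (simp add: W_def case_prod_beta exp_cnj inner_diff_left right_diff_distrib exp_diff exp_minus field_simps)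
    ultimately show ?thesis unfolding complex_norm_square by simp
  qed
  interpret P: pair_sigma_finite "lborel :: 'a measure" "(lborel :: 'a measure) \<Otimes>\<^sub>M (lborel :: 'a measure)"
    by (intro pair_sigma_finite.intro lborel.sigma_finite_measure_axioms lborel_pair.sigma_finite_measure_axioms)
  let ?J = "\<lambda>p z. exp (\<i> * of_real ((fst z - snd z) \<bullet> p)) * of_real (gauss_vec e p) * W z"
  have iJ: "integrable (lborel \<Otimes>\<^sub>M (lborel \<Otimes>\<^sub>M lborel)) (\<lambda>(p, z). ?J p z)"
  proof (rule P.Fubini_integrable)
    have "(\<integral>z. norm ((\<lambda>(p, z). ?J p z) (p, z)) \<partial>(lborel \<Otimes>\<^sub>M lborel)) = gauss_vec e p * (\<integral>z. norm (W z) \<partial>(lborel \<Otimes>\<^sub>M lborel))" for p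
      using gauss_vec_bounds(1)[of e p] by (simp add: norm_mult)
    then show "integrable lborel (\<lambda>p. \<integral>z. norm ((\<lambda>(p, z). ?J p z) (p, z)) \<partial>(lborel \<Otimes>\<^sub>M lborel))"
      by (simp add: gauss_vec_integrable e)
    show "AE p in lborel. integrable (lborel \<Otimes>\<^sub>M lborel) (\<lambda>z. (\<lambda>(p, z). ?J p z) (p, z))"
    proof (rule AE_I2)
      fix p :: 'a
      have "integrable (lborel \<Otimes>\<^sub>M lborel) (?J p)"
      proof (rule Bochner_Integration.integrable_bound[OF iW])
        show "AE z in lborel \<Otimes>\<^sub>M lborel. norm (?J p z) \<le> norm (W z)"
          using gauss_vec_bounds[of e p] by (intro AE_I2) (simp add: norm_mult mult_left_le_one_le)
      qed measurable
      then show "integrable (lborel \<Otimes>\<^sub>M lborel) (\<lambda>z. (\<lambda>(p, z). ?J p z) (p, z))" by simp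
    qed
  qed measurable
  have "complex_of_real (\<integral>p. gauss_vec e p * (norm (A p))\<^sup>2 \<partial>lborel) = (\<integral>p. complex_of_real (gauss_vec e p) * of_real ((norm (A p))\<^sup>2) \<partial>lborel)"
    by (subst integral_complex_of_real[symmetric]) simp
  also have "\<dots> = (\<integral>p. \<integral>z. ?J p z \<partial>(lborel \<Otimes>\<^sub>M lborel) \<partial>lborel)"
    unfolding sq by (subst integral_mult_right_zero[symmetric]) (simp add: mult_ac)
  also have "\<dots> = (\<integral>z. \<integral>p. ?J p z \<partial>lborel \<partial>(lborel \<Otimes>\<^sub>M lborel))"
    by (rule P.Fubini_integral[symmetric, OF iJ])
  also have "\<dots> = (\<integral>z. of_real (c * gauss_vec (1 / e) (fst z - snd z)) * W z \<partial>(lborel \<Otimes>\<^sub>M lborel))"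
    by (simp add: gauss_vec_fourier[OF e] c_def)
  finally have eq: "complex_of_real (\<integral>p. gauss_vec e p * (norm (A p))\<^sup>2 \<partial>lborel) =
    (\<integral>z. of_real (c * gauss_vec (1 / e) (fst z - snd z)) * W z \<partial>(lborel \<Otimes>\<^sub>M lborel))" .
  have tot: "(\<integral>\<^sup>+y. ennreal (c * gauss_vec (1 / e) (y::'a)) \<partial>lborel) = ennreal ((2 * pi) ^ DIM('a))" (is "?t = _")
  proof -
    have "?t = ennreal (\<integral>y. c * gauss_vec (1 / e) (y::'a) \<partial>lborel)"
      by (intro nn_integral_eq_integral integrable_mult_right gauss_vec_integrable AE_I2 mult_nonneg_nonneg
          less_imp_le[OF gauss_vec_bounds(1)]) (use c e in auto)
    also have "(\<integral>y. c * gauss_vec (1 / e) (y::'a) \<partial>lborel) = (2 * pi) ^ DIM('a)"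
    proof -
      have "sqrt (2 * pi) / e * (sqrt (2 * pi) / (1 / e)) = 2 * pi" using e by simp
      moreover have "0 < 1 / e" using e by simp
      ultimately show ?thesis
        by (simp only: integral_mult_right_zero gauss_vec_integrable(2) c_def power_mult_distrib[symmetric])
    qed
    finally show ?thesis .
  qed
  have shift1: "(\<integral>\<^sup>+y. ennreal (c * gauss_vec (1 / e) (x - y)) \<partial>lborel) = ennreal ((2 * pi) ^ DIM('a))" for x :: 'a
  proof -
    have "gauss_vec (1 / e) (x - y) = gauss_vec (1 / e) (y + (- x))" for y
      using gauss_vec_minus[of "1/e" "x - y"] by simp
    then show ?thesis using nn_integral_translate[of "\<lambda>y. ennreal (c * gauss_vec (1 / e) y)" "- x"] tot by simp
  qed
  have shift2: "(\<integral>\<^sup>+x. ennreal (c * gauss_vec (1 / e) (x - y)) \<partial>lborel) = ennreal ((2 * pi) ^ DIM('a))" for y :: 'a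
    using nn_integral_translate[of "\<lambda>x. ennreal (c * gauss_vec (1 / e) x)" "- y"] tot by simp
  let ?\<Gamma> = "\<lambda>x y. ennreal (c * gauss_vec (1 / e) (x - y))"
  let ?n = "\<integral>\<^sup>+x. ennreal ((norm (w x))\<^sup>2) \<partial>lborel"
  have "ennreal (\<integral>p. gauss_vec e p * (norm (A p))\<^sup>2 \<partial>lborel) \<le> ennreal (norm (complex_of_real (\<integral>p. gauss_vec e p * (norm (A p))\<^sup>2 \<partial>lborel)))"
    by (intro ennreal_leI) simp
  also have "\<dots> \<le> (\<integral>\<^sup>+z. ennreal (norm (of_real (c * gauss_vec (1 / e) (fst z - snd z)) * W z)) \<partial>(lborel \<Otimes>\<^sub>M lborel))"
    unfolding eq by (rule norm_integral_le_nn_integral)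
  also have "\<dots> \<le> (\<integral>\<^sup>+z. ennreal (1/2) * (ennreal ((norm (w (fst z)))\<^sup>2) * ?\<Gamma> (fst z) (snd z) + ennreal ((norm (w (snd z)))\<^sup>2) * ?\<Gamma> (fst z) (snd z)) \<partial>(lborel \<Otimes>\<^sub>M lborel))"
  proof (rule nn_integral_mono)
    fix z :: "'a \<times> 'a"
    have G: "0 < c * gauss_vec (1 / e) (fst z - snd z)" by (rule mult_pos_pos[OF c gauss_vec_bounds(1)])
    have "2 * (norm (w (fst z)) * norm (w (snd z))) \<le> (norm (w (fst z)))\<^sup>2 + (norm (w (snd z)))\<^sup>2"
      using sum_squares_bound[of "norm (w (fst z))" "norm (w (snd z))"] by simp
    then have "norm (W z) \<le> 1/2 * ((norm (w (fst z)))\<^sup>2 + (norm (w (snd z)))\<^sup>2)"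
      by (simp add: W_def norm_mult)
    then have "norm (of_real (c * gauss_vec (1 / e) (fst z - snd z)) * W z)
      \<le> (c * gauss_vec (1 / e) (fst z - snd z)) * (1/2 * ((norm (w (fst z)))\<^sup>2 + (norm (w (snd z)))\<^sup>2))"
      using G by (simp only: norm_mult norm_of_real abs_of_pos) (rule mult_left_mono, auto)
    also have "\<dots> = 1/2 * ((norm (w (fst z)))\<^sup>2 * (c * gauss_vec (1 / e) (fst z - snd z)) + (norm (w (snd z)))\<^sup>2 * (c * gauss_vec (1 / e) (fst z - snd z)))"
      by (simp add: algebra_simps)
    finally show "ennreal (norm (of_real (c * gauss_vec (1 / e) (fst z - snd z)) * W z)) \<le> ennreal (1/2) * (ennreal ((norm (w (fst z)))\<^sup>2) * ?\<Gamma> (fst z) (snd z) + ennreal ((norm (w (snd z)))\<^sup>2) * ?\<Gamma> (fst z) (snd z))"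
      using G by (simp add: ennreal_leI flip: ennreal_mult ennreal_plus del: ennreal_half)
  qed
  also have "\<dots> = ennreal (1/2) * ((\<integral>\<^sup>+z. ennreal ((norm (w (fst z)))\<^sup>2) * ?\<Gamma> (fst z) (snd z) \<partial>(lborel \<Otimes>\<^sub>M lborel)) + (\<integral>\<^sup>+z. ennreal ((norm (w (snd z)))\<^sup>2) * ?\<Gamma> (fst z) (snd z) \<partial>(lborel \<Otimes>\<^sub>M lborel)))"
    by (subst nn_integral_cmult, measurable, subst nn_integral_add) measurable
  also have "(\<integral>\<^sup>+z. ennreal ((norm (w (fst z)))\<^sup>2) * ?\<Gamma> (fst z) (snd z) \<partial>(lborel \<Otimes>\<^sub>M lborel)) = ?n * ennreal ((2 * pi) ^ DIM('a))"
    by (subst lborel.nn_integral_fst[symmetric], measurable) (simp add: nn_integral_cmult shift1 nn_integral_multc)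
  also have "(\<integral>\<^sup>+z. ennreal ((norm (w (snd z)))\<^sup>2) * ?\<Gamma> (fst z) (snd z) \<partial>(lborel \<Otimes>\<^sub>M lborel)) = ?n * ennreal ((2 * pi) ^ DIM('a))"
    by (subst lborel_pair.nn_integral_snd[symmetric], measurable) (simp add: nn_integral_cmult shift2 nn_integral_multc)
  also have "?n = ennreal (\<integral>x. (norm (w x))\<^sup>2 \<partial>lborel)"
    by (intro nn_integral_eq_integral w2) auto
  also have "ennreal (1/2) * (ennreal (\<integral>x. (norm (w x))\<^sup>2 \<partial>lborel) * ennreal ((2 * pi) ^ DIM('a)) + ennreal (\<integral>x. (norm (w x))\<^sup>2 \<partial>lborel) * ennreal ((2 * pi) ^ DIM('a)))
     = ennreal ((2 * pi) ^ DIM('a) * (\<integral>x. (norm (w x))\<^sup>2 \<partial>lborel))"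
    by (simp add: mult.commute flip: ennreal_mult ennreal_plus del: ennreal_half)
  finally have "ennreal (\<integral>p. gauss_vec e p * (norm (A p))\<^sup>2 \<partial>lborel) \<le> ennreal ((2 * pi) ^ DIM('a) * (\<integral>x. (norm (w x))\<^sup>2 \<partial>lborel))" .
  moreover have "(\<integral>\<^sup>+p. ennreal (gauss_vec e p * (norm (A p))\<^sup>2) \<partial>lborel) = ennreal (\<integral>p. gauss_vec e p * (norm (A p))\<^sup>2 \<partial>lborel)"
    by (intro nn_integral_eq_integral iG AE_I2 mult_nonneg_nonneg less_imp_le[OF gauss_vec_bounds(1)] zero_le_power2)
  ultimately show ?thesis by (simp add: A_def)
qed

text \<open>The weights increase to \<open>1\<close> as \<open>e\<close> tends to \<open>0\<close>; Fatou's lemma removes them.\<close>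

lemma bessel:
  fixes w :: "'a::euclidean_space \<Rightarrow> complex"
  assumes w: "integrable lborel w" and w2: "integrable lborel (\<lambda>x. (norm (w x))\<^sup>2)"
  shows "(\<integral>\<^sup>+p. ennreal ((norm (\<integral>x. exp (\<i> * of_real (x \<bullet> p)) * w x \<partial>lborel))\<^sup>2) \<partial>lborel)
    \<le> ennreal ((2 * pi) ^ DIM('a) * (\<integral>x. (norm (w x))\<^sup>2 \<partial>lborel))"
proof -
  have [measurable]: "w \<in> borel_measurable borel" using w by auto
  define A where "A p = (norm (\<integral>x. exp (\<i> * of_real (x \<bullet> p)) * w x \<partial>lborel))\<^sup>2" for p
  have [measurable]: "A \<in> borel_measurable borel" unfolding A_def by measurable
  have lim: "(\<lambda>k. gauss_vec (1 / real (Suc k)) p * A p) \<longlonglongrightarrow> A p" for p :: 'a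
  proof -
    have "(\<lambda>k. \<Prod>b\<in>Basis. exp (- ((1 / real (Suc k))\<^sup>2 * (p \<bullet> b)\<^sup>2 / 2))) \<longlonglongrightarrow> (\<Prod>b\<in>(Basis::'a set). exp (- (0\<^sup>2 * (p \<bullet> b)\<^sup>2 / 2)))"
      by (intro tendsto_intros LIMSEQ_Suc[OF lim_1_over_n]) auto
    then have "(\<lambda>k. gauss_vec (1 / real (Suc k)) p) \<longlonglongrightarrow> 1" by (simp add: gauss_vec_def gauss_def)
    from tendsto_mult[OF this tendsto_const[of "A p"]] show ?thesis by simp
  qed
  have "(\<integral>\<^sup>+p. ennreal (A p) \<partial>lborel) = (\<integral>\<^sup>+p. liminf (\<lambda>k. ennreal (gauss_vec (1 / real (Suc k)) p * A p)) \<partial>lborel)"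
    by (intro nn_integral_cong lim_imp_Liminf[symmetric] tendsto_ennrealI lim) auto
  also have "\<dots> \<le> liminf (\<lambda>k. \<integral>\<^sup>+p. ennreal (gauss_vec (1 / real (Suc k)) p * A p) \<partial>lborel)"
    by (rule nn_integral_liminf) measurable
  also have "\<dots> \<le> ennreal ((2 * pi) ^ DIM('a) * (\<integral>x. (norm (w x))\<^sup>2 \<partial>lborel))"
    using bessel_gauss[OF w w2] by (intro Liminf_le always_eventually) (auto simp: A_def)
  finally show ?thesis by (simp add: A_def)
qed

section \<open>Superpositions over boxes\<close>

text \<open>The vector with its coordinate \<open>j\<close> replaced by \<open>s\<close>, written as a translate along an axis so that
  translation invariance of Lebesgue measure applies.\<close>

definition upd :: "real ^ 'n \<Rightarrow> 'n \<Rightarrow> real \<Rightarrow> real ^ 'n::finite"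
  where "upd w j s = w + (s - w $ j) *\<^sub>R axis j 1"

lemma upd_nth: "upd w j s $ i = (if i = j then s else w $ i)"
  by (simp add: upd_def axis_def)

lemma upd_measurable [measurable]:
  assumes [measurable]: "g \<in> M \<rightarrow>\<^sub>M borel" "h \<in> borel_measurable M"
  shows "(\<lambda>x. upd (g x) j (h x)) \<in> M \<rightarrow>\<^sub>M (borel :: (real ^ 'n::finite) measure)"
proof -
  have c: "continuous_on UNIV (\<lambda>z. upd (fst z) j (snd z) :: real ^ 'n)"
    unfolding upd_def by (intro continuous_intros)
  have "(\<lambda>x. (\<lambda>z. upd (fst z) j (snd z)) (g x, h x)) \<in> M \<rightarrow>\<^sub>M borel"
    by (rule measurable_compose[OF _ borel_measurable_continuous_onI[OF c]]) (simp add: borel_prod[symmetric])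
  then show ?thesis by simp
qed

lemma vec_nth_measurable [measurable]: "(\<lambda>x. x $ j) \<in> borel_measurable (borel :: (real ^ 'n::finite) measure)"
  by (intro borel_measurable_continuous_onI continuous_intros)

text \<open>A coordinate that has been averaged over the unit interval may be replaced by a free
  integration variable. This lets iterated one-dimensional integrals be written as integrals
  over the whole space without splitting the space into a product.\<close>

lemma nn_integral_upd:
  fixes F :: "real ^ 'n::finite \<Rightarrow> ennreal"
  assumes [measurable]: "F \<in> borel_measurable borel"
  shows "(\<integral>\<^sup>+w. \<integral>\<^sup>+s. indicator {0..1} (w $ j) * F (upd w j s) \<partial>lborel \<partial>lborel) = (\<integral>\<^sup>+z. F z \<partial>lborel)"
proof -
  have "(\<integral>\<^sup>+w. \<integral>\<^sup>+s. indicator {0..1} (w $ j) * F (upd w j s) \<partial>lborel \<partial>lborel)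
      = (\<integral>\<^sup>+w. \<integral>\<^sup>+s. indicator {0..1} (w $ j) * F (w + s *\<^sub>R axis j 1) \<partial>lborel \<partial>lborel)"
  proof (rule nn_integral_cong)
    fix w :: "real ^ 'n"
    have "(\<integral>\<^sup>+s. indicator {0..1} (w $ j) * F (w + s *\<^sub>R axis j 1) \<partial>lborel) =
      (\<integral>\<^sup>+s. indicator {0..1} (w $ j) * F (w + (s + - (w $ j)) *\<^sub>R axis j 1) \<partial>lborel)"
      by (rule nn_integral_translate[symmetric]) measurable
    then show "(\<integral>\<^sup>+s. indicator {0..1} (w $ j) * F (upd w j s) \<partial>lborel) =
        (\<integral>\<^sup>+s. indicator {0..1} (w $ j) * F (w + s *\<^sub>R axis j 1) \<partial>lborel)"
      by (simp add: upd_def)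
  qed
  also have "\<dots> = (\<integral>\<^sup>+s. \<integral>\<^sup>+w. indicator {0..1} (w $ j) * F (w + s *\<^sub>R axis j 1) \<partial>lborel \<partial>lborel)"
    by (rule lborel_pair.Fubini') measurable
  also have "\<dots> = (\<integral>\<^sup>+s. \<integral>\<^sup>+w. indicator {0..1} (w $ j - s) * F w \<partial>lborel \<partial>lborel)"
  proof (rule nn_integral_cong)
    fix s :: real
    have "(\<integral>\<^sup>+w. indicator {0..1} ((w + s *\<^sub>R axis j 1) $ j - s) * F (w + s *\<^sub>R axis j 1) \<partial>lborel) =
      (\<integral>\<^sup>+w. indicator {0..1} (w $ j - s) * F w \<partial>lborel)"
      by (rule nn_integral_translate) measurable
    then show "(\<integral>\<^sup>+w. indicator {0..1} (w $ j) * F (w + s *\<^sub>R axis j 1) \<partial>lborel) =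
      (\<integral>\<^sup>+w. indicator {0..1} (w $ j - s) * F w \<partial>lborel)"
      by (simp add: axis_def)
  qed
  also have "\<dots> = (\<integral>\<^sup>+w. \<integral>\<^sup>+s. indicator {0..1} (w $ j - s) * F w \<partial>lborel \<partial>lborel)"
    by (rule lborel_pair.Fubini') measurable
  also have "\<dots> = (\<integral>\<^sup>+w. F w \<partial>lborel)"
  proof (rule nn_integral_cong)
    fix w :: "real ^ 'n"
    have "(\<integral>\<^sup>+s. indicator {0..1} (w $ j - s) * F w \<partial>lborel) = (\<integral>\<^sup>+s. F w * indicator {w $ j - 1..w $ j} s \<partial>lborel)"
      by (intro nn_integral_cong) (auto simp: indicator_def)
    also have "\<dots> = F w" by (simp add: nn_integral_cmult_indicator)
    finally show "(\<integral>\<^sup>+s. indicator {0..1} (w $ j - s) * F w \<partial>lborel) = F w" .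
  qed
  finally show ?thesis .
qed

lemma integral_upd:
  fixes F :: "real ^ 'n::finite \<Rightarrow> complex"
  assumes F: "integrable lborel F"
  shows "(\<integral>w. indicat_real {0..1} (w $ j) *\<^sub>R (\<integral>s. F (upd w j s) \<partial>lborel) \<partial>lborel) = (\<integral>z. F z \<partial>lborel)"
proof -
  have [measurable]: "F \<in> borel_measurable borel" using F by auto
  let ?G = "\<lambda>(w, s). indicat_real {0..1} (w $ j) *\<^sub>R F (upd w j s)"
  let ?D = "density (lborel \<Otimes>\<^sub>M lborel) (\<lambda>(w, s::real). indicator {0..1} (w $ j)) :: ((real ^ 'n) \<times> real) measure"
  have T: "(\<lambda>(w, s). upd w j s) \<in> ?D \<rightarrow>\<^sub>M borel" by measurable
  have L: "distr ?D borel (\<lambda>(w, s). upd w j s) = lborel"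
  proof (rule measure_eqI)
    fix A assume "A \<in> sets (distr ?D borel (\<lambda>(w, s). upd w j s))"
    then have [measurable]: "A \<in> sets borel" by simp
    have "emeasure (distr ?D borel (\<lambda>(w, s). upd w j s)) A = (\<integral>\<^sup>+z. indicator A z \<partial>distr ?D borel (\<lambda>(w, s). upd w j s))"
      by simp
    also have "\<dots> = (\<integral>\<^sup>+z. indicator A (case z of (w, s) \<Rightarrow> upd w j s) \<partial>?D)"
      by (rule nn_integral_distr[OF T]) simp
    also have "\<dots> = (\<integral>\<^sup>+z. (case z of (w, s) \<Rightarrow> indicator {0..1} (w $ j)) * indicator A (case z of (w, s) \<Rightarrow> upd w j s) \<partial>(lborel \<Otimes>\<^sub>M lborel))"
      by (rule nn_integral_density) measurable
    also have "\<dots> = (\<integral>\<^sup>+w. \<integral>\<^sup>+s. indicator {0..1} (w $ j) * indicator A (upd w j s) \<partial>lborel \<partial>lborel)"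
      using lborel.nn_integral_fst[of "\<lambda>z. (case z of (w, s) \<Rightarrow> indicator {0..1} (w $ j)) * indicator A (case z of (w, s::real) \<Rightarrow> upd w j s)" "lborel :: (real ^ 'n) measure"]
      by simp
    also have "\<dots> = emeasure lborel A" by (subst nn_integral_upd) simp_all
    finally show "emeasure (distr ?D borel (\<lambda>(w, s). upd w j s)) A = emeasure lborel A" .
  qed simp
  have "integrable (distr ?D borel (\<lambda>(w, s). upd w j s)) F" unfolding L by (rule F)
  then have "integrable ?D (\<lambda>z. F (case z of (w, s) \<Rightarrow> upd w j s))"
    by (subst (asm) integrable_distr_eq[OF T]) simp_all
  then have "integrable (density (lborel \<Otimes>\<^sub>M lborel) (\<lambda>z. ennreal (indicat_real {0..1} (fst z $ j)))) (\<lambda>z. F (case z of (w, s) \<Rightarrow> upd w j s))"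
    by (simp add: case_prod_beta' ennreal_indicator)
  then have G: "integrable (lborel \<Otimes>\<^sub>M lborel) ?G"
    by (subst (asm) integrable_density) (auto simp: case_prod_beta')
  have "(\<integral>z. F z \<partial>lborel) = (\<integral>z. F z \<partial>distr ?D borel (\<lambda>(w, s). upd w j s))" unfolding L ..
  also have "\<dots> = (\<integral>z. F (case z of (w, s) \<Rightarrow> upd w j s) \<partial>?D)"
    by (rule integral_distr[OF T]) simp
  also have "\<dots> = (\<integral>z. F (case z of (w, s) \<Rightarrow> upd w j s) \<partial>density (lborel \<Otimes>\<^sub>M lborel) (\<lambda>z. ennreal (indicat_real {0..1} (fst z $ j))))"
    by (simp add: case_prod_beta' ennreal_indicator)
  also have "\<dots> = (\<integral>z. ?G z \<partial>(lborel \<Otimes>\<^sub>M lborel))"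
    by (subst integral_density) (auto simp: case_prod_beta')
  also have "\<dots> = (\<integral>w. \<integral>s. ?G (w, s) \<partial>lborel \<partial>lborel)"
    by (rule lborel_pair.integral_fst'[OF G, symmetric])
  finally show ?thesis by simp
qed

text \<open>Coordinates are integrated out from the head of the list to its end. The coordinate \<open>r\<close>, on which
  the scales depend, has to come last.\<close>

definition admissible_order :: "'n::{finite,linorder} list \<Rightarrow> bool"
  where "admissible_order js \<longleftrightarrow> distinct js \<and> (js \<noteq> [] \<longrightarrow> last js = r_idx)"

lemma admissible_order_Cons:
  assumes "admissible_order (j # js)"
  shows "admissible_order js" "j \<notin> set js" "js \<noteq> [] \<Longrightarrow> j \<noteq> r_idx"
  using assms last_in_set[of js] by (auto simp: admissible_order_def split: if_splits)

lemma admissible_order_exists: "\<exists>js :: 'n::{finite,linorder} list. admissible_order js \<and> set js = UNIV"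
  by (rule exI[of _ "theta_idxs @ [r_idx]"]) (auto simp: admissible_order_def distinct_theta_idxs set_theta_idxs)

lemma scale_vec_upd:
  assumes "admissible_order (j # js)" "i \<in> set (j # js)"
  shows "scale_vec f (upd w j s $ r_idx) i = scale_vec f (w $ r_idx) i"
proof (cases "js = []")
  case True
  then show ?thesis using assms by (simp add: admissible_order_def scale_vec_def)
next
  case False
  then show ?thesis using admissible_order_Cons[OF assms(1)] by (simp add: upd_nth)
qed

lemma scale_vec_pos: "(\<And>r. 1 \<le> f r) \<Longrightarrow> 1 \<le> scale_vec f r j"
  by (simp add: scale_vec_def)

lemma scale_vec_measurable [measurable]:
  assumes [measurable]: "f \<in> borel_measurable borel"
  shows "(\<lambda>z. scale_vec f (z $ r_idx) j) \<in> borel_measurable (borel :: (real ^ 'n::{finite,linorder}) measure)"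
  unfolding scale_vec_def by measurable

lemma nn_integral_affine_real:
  fixes \<phi> :: "real \<Rightarrow> ennreal"
  assumes [measurable]: "\<phi> \<in> borel_measurable borel" and l: "l > 0"
  shows "(\<integral>\<^sup>+s. ennreal l * \<phi> (l * (s - c)) \<partial>lborel) = (\<integral>\<^sup>+s. \<phi> s \<partial>lborel)"
proof -
  have "(\<integral>\<^sup>+s. \<phi> s \<partial>lborel) = ennreal \<bar>l\<bar> * (\<integral>\<^sup>+s. \<phi> (- (l * c) + l * s) \<partial>lborel)"
    by (rule nn_integral_real_affine) (use l in auto)
  also have "\<dots> = (\<integral>\<^sup>+s. ennreal l * \<phi> (l * (s - c)) \<partial>lborel)"
    using l by (subst nn_integral_cmult[symmetric]) (auto simp: algebra_simps)
  finally show ?thesis by simp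
qed

text \<open>The scale in the directions other than \<open>r\<close> depends on the coordinate \<open>z $ r_idx\<close> of the
  integration variable. That coordinate is the last entry of the list and is integrated last, so
  every one-dimensional integral before it sees a constant scale, and its own scale is \<open>1\<close>.\<close>

lemma nn_integral_scaled_box:
  fixes \<phi> :: "real \<Rightarrow> ennreal" and y :: "real ^ 'n::{finite,linorder}"
  assumes [measurable]: "\<phi> \<in> borel_measurable borel" "f \<in> borel_measurable borel"
    and \<phi>: "(\<integral>\<^sup>+s. \<phi> s \<partial>lborel) = 1" and f: "\<And>r. 1 \<le> f r" and js: "admissible_order js"
  shows "(\<integral>\<^sup>+z. (\<Prod>i\<in>UNIV. if i \<in> set js
      then ennreal (scale_vec f (z $ r_idx) i) * \<phi> (scale_vec f (z $ r_idx) i * (z $ i - y $ i))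
      else indicator {0..1} (z $ i)) \<partial>lborel) = 1"
  using js
proof (induction js)
  case Nil
  have "(\<integral>\<^sup>+z. (\<Prod>i\<in>UNIV. indicator {0..1} (z $ i)) \<partial>(lborel :: (real, 'n) vec measure)) = (\<integral>\<^sup>+z. indicator (cbox 0 One) z \<partial>(lborel :: (real, 'n) vec measure))"
  proof (rule nn_integral_cong)
    fix z :: "(real, 'n) vec"
    have "z \<in> cbox 0 One \<longleftrightarrow> (\<forall>i. z $ i \<in> {0..1})"
    proof -
      have "z \<in> cbox 0 One \<longleftrightarrow> (\<forall>b\<in>Basis. 0 \<le> z \<bullet> b \<and> z \<bullet> b \<le> 1)" by (simp add: mem_box)
      then show ?thesis by (auto simp: Basis_vec_def cart_eq_inner_axis)
    qed
    then show "(\<Prod>i\<in>UNIV. indicator {0..1} (z $ i)) = (indicator (cbox 0 One) z :: ennreal)"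
      by (auto simp: indicator_def prod_zero_iff)
  qed
  also have "\<dots> = 1" by (simp add: emeasure_lborel_cbox_eq)
  finally show ?case by simp
next
  case (Cons j js)
  note adm = admissible_order_Cons[OF Cons.prems]
  let ?l = "\<lambda>z i. scale_vec f (z $ r_idx) i"
  let ?P = "\<lambda>js (z::(real, 'n) vec) i. if i \<in> set js then ennreal (?l z i) * \<phi> (?l z i * (z $ i - y $ i)) else indicator {0..1} (z $ i)"
  have "(\<integral>\<^sup>+z. (\<Prod>i\<in>UNIV. ?P (j # js) z i) \<partial>lborel) =
    (\<integral>\<^sup>+w. \<integral>\<^sup>+s. indicator {0..1} (w $ j) * (\<Prod>i\<in>UNIV. ?P (j # js) (upd w j s) i) \<partial>lborel \<partial>lborel)"
    by (rule nn_integral_upd[symmetric]) measurable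
  also have "\<dots> = (\<integral>\<^sup>+w. (\<Prod>i\<in>UNIV. ?P js w i) \<partial>lborel)"
  proof (rule nn_integral_cong)
    fix w :: "(real, 'n) vec"
    have l1: "1 \<le> ?l w j" by (rule scale_vec_pos[OF f])
    have "(\<Prod>i\<in>UNIV. ?P (j # js) (upd w j s) i) =
       (ennreal (?l w j) * \<phi> (?l w j * (s - y $ j))) * (\<Prod>i\<in>UNIV - {j}. ?P js w i)" for s
    proof -
      have "?P (j # js) (upd w j s) i = ?P js w i" if "i \<noteq> j" for i
        using that scale_vec_upd[OF Cons.prems, of i f w s] by (auto simp: upd_nth)
      moreover have "?P (j # js) (upd w j s) j = ennreal (?l w j) * \<phi> (?l w j * (s - y $ j))"
        using scale_vec_upd[OF Cons.prems, of j f w s] by (simp add: upd_nth)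
      ultimately show ?thesis by (subst prod.remove[of _ j]) auto
    qed
    then have "(\<integral>\<^sup>+s. indicator {0..1} (w $ j) * (\<Prod>i\<in>UNIV. ?P (j # js) (upd w j s) i) \<partial>lborel) =
      (\<integral>\<^sup>+s. (indicator {0..1} (w $ j) * (\<Prod>i\<in>UNIV - {j}. ?P js w i)) * (ennreal (?l w j) * \<phi> (?l w j * (s - y $ j))) \<partial>lborel)"
      by (simp only: mult_ac)
    also have "\<dots> = (indicator {0..1} (w $ j) * (\<Prod>i\<in>UNIV - {j}. ?P js w i)) * 1"
      using l1 by (subst nn_integral_cmult, measurable) (simp add: nn_integral_affine_real \<phi>)
    also have "\<dots> = (\<Prod>i\<in>UNIV. ?P js w i)"
      using adm(2) by (subst (2) prod.remove[of _ j]) auto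
    finally show "(\<integral>\<^sup>+s. indicator {0..1} (w $ j) * (\<Prod>i\<in>UNIV. ?P (j # js) (upd w j s) i) \<partial>lborel) = (\<Prod>i\<in>UNIV. ?P js w i)" .
  qed
  also have "\<dots> = 1" by (rule Cons.IH[OF adm(1)])
  finally show ?case .
qed

section \<open>The exponential kernel as a superposition of waves\<close>

lemma nn_integral_even:
  fixes h :: "real \<Rightarrow> real"
  assumes [measurable]: "h \<in> borel_measurable borel" and even: "\<And>x. h (- x) = h x"
  shows "(\<integral>\<^sup>+x. ennreal (h x) \<partial>lborel) = 2 * (\<integral>\<^sup>+x. ennreal (h x) * indicator {0..} x \<partial>lborel)"
proof -
  have "(\<integral>\<^sup>+x. ennreal (h x) \<partial>lborel) = (\<integral>\<^sup>+x. ennreal (h x) * indicator {0..} x + ennreal (h x) * indicator {..0} x \<partial>lborel)"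
    by (rule nn_integral_cong_AE) (use AE_lborel_singleton[of "0::real"] in \<open>eventually_elim, auto simp: indicator_def\<close>)
  also have "\<dots> = (\<integral>\<^sup>+x. ennreal (h x) * indicator {0..} x \<partial>lborel) + (\<integral>\<^sup>+x. ennreal (h x) * indicator {..0} x \<partial>lborel)"
    by (rule nn_integral_add) measurable
  also have "(\<integral>\<^sup>+x. ennreal (h x) * indicator {..0} x \<partial>lborel) = ennreal \<bar>-1\<bar> * (\<integral>\<^sup>+x. ennreal (h (0 + (-1) * x)) * indicator {..0} (0 + (-1) * x) \<partial>lborel)"
    by (rule nn_integral_real_affine) auto
  also have "\<dots> = (\<integral>\<^sup>+x. ennreal (h x) * indicator {0..} x \<partial>lborel)"
    by (simp add: even) (auto intro!: nn_integral_cong simp: indicator_def)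
  finally show ?thesis by (simp add: mult_2)
qed

lemma nn_integral_exp_abs: "(\<integral>\<^sup>+x. ennreal (exp (- \<bar>x\<bar>) / 2) \<partial>lborel) = 1"
proof -
  have "(\<integral>\<^sup>+x. ennreal (exp (- \<bar>x\<bar>) / 2) * indicator {0..} x \<partial>lborel) = (\<integral>\<^sup>+x. ennreal (exp (- x) / 2) * indicator {0..} x \<partial>lborel)"
    by (intro nn_integral_cong) (auto simp: indicator_def)
  also have "\<dots> = ennreal (0 - (- exp (- 0) / 2))"
  proof (rule nn_integral_FTC_atLeast)
    show "((\<lambda>x. - exp (- x) / 2 :: real) \<longlongrightarrow> 0) at_top"
      using tendsto_divide[OF tendsto_minus[OF filterlim_compose[OF exp_at_bot filterlim_uminus_at_bot_at_top]] tendsto_const[of "2::real"]]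
      by simp
  qed (auto intro!: derivative_eq_intros)
  finally have *: "(\<integral>\<^sup>+x. ennreal (exp (- \<bar>x\<bar>) / 2) * indicator {0..} x \<partial>lborel) = ennreal (1/2)" by simp
  have "(\<integral>\<^sup>+x. ennreal (exp (- \<bar>x\<bar>) / 2) \<partial>lborel) = ennreal 2 * ennreal (1/2)"
    by (subst nn_integral_even) (auto simp: *)
  also have "\<dots> = ennreal (2 * (1/2))" by (rule ennreal_mult[symmetric]) auto
  finally show ?thesis by simp
qed

lemma nn_integral_cauchy: "(\<integral>\<^sup>+x. ennreal (1 / (1 + x\<^sup>2)) \<partial>lborel) = ennreal pi"
proof -
  have "(\<integral>\<^sup>+x. ennreal (1 / (1 + x\<^sup>2)) * indicator {0..} x \<partial>lborel) = ennreal (pi / 2 - arctan 0)"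
  proof (rule nn_integral_FTC_atLeast)
    show "(arctan has_real_derivative 1 / (1 + x\<^sup>2)) (at x)" for x
      using DERIV_arctan[of x] by (simp add: inverse_eq_divide)
  qed (auto intro: tendsto_arctan_at_top)
  then have "(\<integral>\<^sup>+x. ennreal (1 / (1 + x\<^sup>2)) \<partial>lborel) = ennreal 2 * ennreal (pi / 2)"
    by (subst nn_integral_even) auto
  also have "\<dots> = ennreal (2 * (pi/2))" by (rule ennreal_mult[symmetric]) auto
  finally show ?thesis by simp
qed

lemma integrable_nn:
  fixes h :: "real \<Rightarrow> real"
  assumes "h \<in> borel_measurable borel" "\<And>x. 0 \<le> h x" "(\<integral>\<^sup>+x. ennreal (h x) \<partial>lborel) = ennreal c"
  shows "integrable lborel h"
  by (rule integrableI_nonneg) (use assms in auto)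

lemma integrable_exp_abs: "integrable lborel (\<lambda>x::real. exp (- \<bar>x\<bar>) / 2)"
  by (rule integrable_nn[of _ 1]) (auto simp: nn_integral_exp_abs)

lemma integrable_cauchy: "integrable lborel (\<lambda>x::real. 1 / (1 + x\<^sup>2))"
  by (rule integrable_nn[of _ pi]) (auto simp: nn_integral_cauchy intro: add_nonneg_nonneg)

lemma one_i_nonzero: "1 + \<i> * complex_of_real t \<noteq> 0" "1 - \<i> * complex_of_real t \<noteq> 0"
  by (auto simp: complex_eq_iff)

text \<open>On each half line the integrand has an explicit exponential primitive; the full integral is the limit
  over the intervals from \<open>- k\<close> to \<open>k\<close>.\<close>

lemma fourier_exp_abs:
  "(\<integral>y. of_real (exp (- \<bar>y\<bar>) / 2) * exp (- (\<i> * of_real (t * y))) \<partial>lborel) = complex_of_real (1 / (1 + t\<^sup>2))"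
proof -
  let ?f = "\<lambda>y. complex_of_real (exp (- \<bar>y\<bar>) / 2) * exp (- (\<i> * of_real (t * y)))"
  define P where "P \<sigma> y = (exp (- of_real y * (\<sigma> + \<i> * of_real t))) / (-2 * (\<sigma> + \<i> * of_real t))" for \<sigma> :: complex and y :: real
  have nz: "\<sigma> + \<i> * of_real t \<noteq> 0" if "\<sigma> = 1 \<or> \<sigma> = -1" for \<sigma> :: complex
    using that by (auto simp: complex_eq_iff)
  have dP: "(P \<sigma> has_vector_derivative (exp (- of_real y * (\<sigma> + \<i> * of_real t)) / 2)) (at y within A)" if "\<sigma> = 1 \<or> \<sigma> = -1" for \<sigma> y A
  proof -
    have "((\<lambda>y. exp (- y * c) / (-2 * c)) has_field_derivative (exp (- of_real y * c) / 2)) (at (of_real y))"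
      if "c \<noteq> 0" for c :: complex
      using that by (auto intro!: derivative_eq_intros simp: field_simps)
    note this[OF nz[OF that]]
    from has_vector_derivative_real_field[OF this] show ?thesis
      unfolding P_def by (rule has_vector_derivative_at_within)
  qed
  have int: "integrable lborel ?f"
    by (rule Bochner_Integration.integrable_bound[OF integrable_exp_abs]) (auto simp: norm_mult)
  have lim1: "(\<lambda>k. \<integral>y. indicat_real {- real k..real k} y *\<^sub>R ?f y \<partial>lborel) \<longlonglongrightarrow> (\<integral>y. ?f y \<partial>lborel)"
  proof (rule integral_dominated_convergence[where w = "\<lambda>y. exp (- \<bar>y\<bar>) / 2"])
    show "AE y in lborel. (\<lambda>k. indicat_real {- real k..real k} y *\<^sub>R ?f y) \<longlonglongrightarrow> ?f y"
    proof (rule AE_I2)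
      fix y :: real
      have "eventually (\<lambda>k. indicat_real {- real k..real k} y *\<^sub>R ?f y = ?f y) sequentially"
        using eventually_ge_at_top[of "nat \<lceil>\<bar>y\<bar>\<rceil>"] by eventually_elim (auto simp: indicator_def)
      then show "(\<lambda>k. indicat_real {- real k..real k} y *\<^sub>R ?f y) \<longlonglongrightarrow> ?f y"
        by (rule tendsto_eventually)
    qed
  qed (auto intro: integrable_exp_abs simp: norm_mult indicator_def)
  have fin: "(\<integral>y. indicat_real {- real k..real k} y *\<^sub>R ?f y \<partial>lborel) = (P 1 (real k) - P 1 0) + (P (-1) 0 - P (-1) (- real k))" for k
  proof -
    have a: "has_bochner_integral lborel (\<lambda>y. indicat_real {0..real k} y *\<^sub>R (exp (- of_real y * (1 + \<i> * of_real t)) / 2)) (P 1 (real k) - P 1 0)"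
      by (rule has_bochner_integral_FTC_Icc, simp, rule dP, simp) (intro continuous_intros, auto)
    have b: "has_bochner_integral lborel (\<lambda>y. indicat_real {- real k..0} y *\<^sub>R (exp (- of_real y * (-1 + \<i> * of_real t)) / 2)) (P (-1) 0 - P (-1) (- real k))"
      by (rule has_bochner_integral_FTC_Icc, simp, rule dP, simp) (intro continuous_intros, auto)
    have "(\<integral>y. indicat_real {- real k..real k} y *\<^sub>R ?f y \<partial>lborel) =
      (\<integral>y. indicat_real {0..real k} y *\<^sub>R (exp (- of_real y * (1 + \<i> * of_real t)) / 2) + indicat_real {- real k..0} y *\<^sub>R (exp (- of_real y * (-1 + \<i> * of_real t)) / 2) \<partial>lborel)"
    proof (rule integral_cong_AE)
      show "AE y in lborel. indicat_real {- real k..real k} y *\<^sub>R ?f y =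
        indicat_real {0..real k} y *\<^sub>R (exp (- of_real y * (1 + \<i> * of_real t)) / 2) + indicat_real {- real k..0} y *\<^sub>R (exp (- of_real y * (-1 + \<i> * of_real t)) / 2)"
        using AE_lborel_singleton[of "0::real"]
      proof eventually_elim
        case (elim y)
        have e: "complex_of_real (exp r) * exp z = exp (of_real r + z)" for r z
          by (simp add: exp_of_real exp_add)
        show ?case
        proof (cases "y > 0")
          case True
          then have "?f y = exp (- of_real y * (1 + \<i> * of_real t)) / 2" by (simp add: e algebra_simps)
          then show ?thesis using True by (simp add: indicator_def)
        next
          case False
          then have "?f y = exp (- of_real y * (-1 + \<i> * of_real t)) / 2" by (simp add: e algebra_simps)
          then show ?thesis using False elim by (simp add: indicator_def)
        qed
      qed
    qed measurable
    also have "\<dots> = (P 1 (real k) - P 1 0) + (P (-1) 0 - P (-1) (- real k))"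
      by (rule has_bochner_integral_integral_eq[OF has_bochner_integral_add[OF a b]])
    finally show ?thesis .
  qed
  have P0: "(\<lambda>k. P \<sigma> (s * real k)) \<longlonglongrightarrow> 0" if "(\<sigma> = 1 \<and> s = 1) \<or> (\<sigma> = -1 \<and> s = -1)" for \<sigma> s
  proof (rule tendsto_norm_zero_cancel)
    have "norm (P \<sigma> (s * real k)) = exp (- real k) * (1 / norm (-2 * (\<sigma> + \<i> * of_real t)))" for k
      using that by (auto simp: P_def norm_divide)
    moreover have "(\<lambda>k. exp (- real k) * (1 / norm (-2 * (\<sigma> + \<i> * of_real t)))) \<longlonglongrightarrow> 0 * (1 / norm (-2 * (\<sigma> + \<i> * of_real t)))"
      by (intro tendsto_mult tendsto_const filterlim_compose[OF exp_at_bot]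
        filterlim_compose[OF filterlim_uminus_at_bot_at_top filterlim_real_sequentially])
    ultimately show "(\<lambda>k. norm (P \<sigma> (s * real k))) \<longlonglongrightarrow> 0" by simp
  qed
  have "(\<lambda>k. (P 1 (1 * real k) - P 1 0) + (P (-1) 0 - P (-1) (-1 * real k))) \<longlonglongrightarrow> (0 - P 1 0) + (P (-1) 0 - 0)"
    by (intro tendsto_add tendsto_diff tendsto_const P0) auto
  then have "(\<lambda>k. \<integral>y. indicat_real {- real k..real k} y *\<^sub>R ?f y \<partial>lborel) \<longlonglongrightarrow> (0 - P 1 0) + (P (-1) 0 - 0)"
    unfolding fin by simp
  from LIMSEQ_unique[OF lim1 this] have "(\<integral>y. ?f y \<partial>lborel) = P (-1) 0 - P 1 0" by simp
  also have "\<dots> = complex_of_real (1 / (1 + t\<^sup>2))"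
  proof -
    define z where "z = \<i> * complex_of_real t"
    have z: "1 + z \<noteq> 0" "- 1 + z \<noteq> 0" using nz[of 1] nz[of "-1"] by (auto simp: z_def)
    have "1 - z * z = - ((1 + z) * (- 1 + z))" by (simp add: algebra_simps)
    with z have "1 - z * z \<noteq> 0" by simp
    have "P (-1) 0 - P 1 0 = 1 / (-2 * (- 1 + z)) - 1 / (-2 * (1 + z))"
      by (simp add: P_def z_def)
    also have "\<dots> = 1 / (1 - z * z)"
    proof -
      have "1 / (-2 * B) - 1 / (-2 * A) = (B - A) / (2 * (A * B))" if "A \<noteq> 0" "B \<noteq> 0" for A B :: complex
        using that by (simp add: field_simps)
      from this[OF z] have "1 / (-2 * (- 1 + z)) - 1 / (-2 * (1 + z)) = - 2 / (2 * ((1 + z) * (- 1 + z)))"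
        by simp
      also have "\<dots> = 1 / (- ((1 + z) * (- 1 + z)))"
      proof -
        have "2 / (2 * w) = 1 / w" for w :: complex by simp
        then show ?thesis by (simp only: minus_divide_left[symmetric] minus_divide_right[symmetric])
      qed
      finally show ?thesis by (simp only: \<open>1 - z * z = - ((1 + z) * (- 1 + z))\<close>)
    qed
    also have "1 - z * z = complex_of_real (1 + t\<^sup>2)" by (simp add: z_def complex_eq_iff power2_eq_square)
    finally show ?thesis by simp
  qed
  finally show ?thesis .
qed

text \<open>Fourier inversion by Gaussian regularization: the regularized integral is an average of
  \<open>exp (- \<bar>x + e y\<bar>)\<close> over \<open>y\<close> with a Gaussian weight, and \<open>e\<close> tends to \<open>0\<close>.\<close>

lemma inverse_fourier_exp_abs:
  "(\<integral>t. of_real (1 / (1 + t\<^sup>2)) * exp (\<i> * of_real (t * x)) \<partial>lborel) = complex_of_real (pi * exp (- \<bar>x\<bar>))"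
proof -
  let ?E = "\<lambda>y. complex_of_real (exp (- \<bar>y\<bar>) / 2)"
  have smoothed: "(\<integral>t. of_real (gauss e t) * (of_real (1 / (1 + t\<^sup>2)) * exp (\<i> * of_real (t * x))) \<partial>lborel)
     = of_real (sqrt (2 * pi)) * (\<integral>y. of_real (gauss 1 y) * ?E (x + e * y) \<partial>lborel)" if e: "e > 0" for e
  proof -
    let ?J = "\<lambda>t y. of_real (gauss e t) * exp (\<i> * of_real (t * (x - y))) * ?E y"
    have [measurable]: "integrable lborel (gauss e)" by (rule gauss_integrable[OF e])
    have iE: "integrable lborel ?E"
      using integrable_exp_abs by (subst complex_of_real_integrable_eq)
    have iJ: "integrable (lborel \<Otimes>\<^sub>M lborel) (\<lambda>(t, y). ?J t y)"
    proof (rule Bochner_Integration.integrable_bound[OF integrable_pair_product])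
      show "integrable lborel (\<lambda>t. complex_of_real (gauss e t))" using gauss_integrable[OF e] by (subst complex_of_real_integrable_eq)
      show "integrable lborel ?E" by (rule iE)
      show "AE z in lborel \<Otimes>\<^sub>M lborel. norm (case z of (t, y) \<Rightarrow> ?J t y) \<le> norm (case z of (t, y) \<Rightarrow> complex_of_real (gauss e t) * ?E y)"
        by (intro AE_I2) (auto simp: norm_mult)
    qed measurable
    have "(\<integral>t. of_real (gauss e t) * (of_real (1 / (1 + t\<^sup>2)) * exp (\<i> * of_real (t * x))) \<partial>lborel) = (\<integral>t. \<integral>y. ?J t y \<partial>lborel \<partial>lborel)"
    proof (rule Bochner_Integration.integral_cong)
      fix t :: real
      have "of_real (gauss e t) * (of_real (1 / (1 + t\<^sup>2)) * exp (\<i> * of_real (t * x))) =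
        of_real (gauss e t) * exp (\<i> * of_real (t * x)) * (\<integral>y. ?E y * exp (- (\<i> * of_real (t * y))) \<partial>lborel)"
        unfolding fourier_exp_abs by (simp only: mult_ac)
      also have "\<dots> = (\<integral>y. ?J t y \<partial>lborel)"
        by (subst integral_mult_right_zero[symmetric], rule Bochner_Integration.integral_cong)
          (auto simp: right_diff_distrib exp_diff exp_minus field_simps)
      finally show "of_real (gauss e t) * (of_real (1 / (1 + t\<^sup>2)) * exp (\<i> * of_real (t * x))) = (\<integral>y. ?J t y \<partial>lborel)" .
    qed simp
    also have "\<dots> = (\<integral>y. \<integral>t. ?J t y \<partial>lborel \<partial>lborel)"
      by (rule lborel_pair.Fubini_integral[symmetric, OF iJ])
    also have "\<dots> = (\<integral>y. of_real (sqrt (2 * pi) / e * gauss (1 / e) (x - y)) * ?E y \<partial>lborel)"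
      using gauss_fourier_integral[OF e] by (simp only: integral_mult_left_zero mult.commute[of "complex_of_real (gauss e _)"])
    also have "\<dots> = \<bar>e\<bar> *\<^sub>R (\<integral>y. of_real (sqrt (2 * pi) / e * gauss (1 / e) (x - (x + e * y))) * ?E (x + e * y) \<partial>lborel)"
      by (rule lborel_integral_real_affine) (use e in auto)
    also have "\<dots> = \<bar>e\<bar> *\<^sub>R (\<integral>y. of_real (sqrt (2 * pi) / e) * (of_real (gauss 1 y) * ?E (x + e * y)) \<partial>lborel)"
    proof -
      have "gauss (1 / e) (x - (x + e * y)) = gauss 1 y" for y
        using e by (simp add: gauss_def power_mult_distrib power_divide)
      then show ?thesis by (simp add: mult.assoc)
    qed
    also have "\<dots> = of_real (sqrt (2 * pi)) * (\<integral>y. of_real (gauss 1 y) * ?E (x + e * y) \<partial>lborel)"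
      using e by (simp only: integral_mult_right_zero) (simp add: scaleR_conv_of_real)
    finally show ?thesis .
  qed
  let ?e = "\<lambda>k. 1 / real (Suc k)"
  have e0: "?e \<longlonglongrightarrow> 0" by (rule LIMSEQ_Suc[OF lim_1_over_n])
  have lhs: "(\<lambda>k. \<integral>t. of_real (gauss (?e k) t) * (of_real (1 / (1 + t\<^sup>2)) * exp (\<i> * of_real (t * x))) \<partial>lborel)
    \<longlonglongrightarrow> (\<integral>t. of_real (1 / (1 + t\<^sup>2)) * exp (\<i> * of_real (t * x)) \<partial>lborel)"
  proof (rule integral_dominated_convergence[where w = "\<lambda>t. 1 / (1 + t\<^sup>2)"])
    show "AE t in lborel. (\<lambda>k. of_real (gauss (?e k) t) * (of_real (1 / (1 + t\<^sup>2)) * exp (\<i> * of_real (t * x)))) \<longlonglongrightarrow> of_real (1 / (1 + t\<^sup>2)) * exp (\<i> * of_real (t * x))"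
    proof (rule AE_I2)
      fix t :: real
      have "(\<lambda>k. of_real (exp (- ((?e k)\<^sup>2 * t\<^sup>2 / 2)))) \<longlonglongrightarrow> complex_of_real (exp (- (0\<^sup>2 * t\<^sup>2 / 2)))"
        by (intro tendsto_intros e0) auto
      then have "(\<lambda>k. complex_of_real (gauss (?e k) t)) \<longlonglongrightarrow> 1" by (simp add: gauss_def)
      from tendsto_mult_right[OF this, of "of_real (1 / (1 + t\<^sup>2)) * exp (\<i> * of_real (t * x))"]
      show "(\<lambda>k. of_real (gauss (?e k) t) * (of_real (1 / (1 + t\<^sup>2)) * exp (\<i> * of_real (t * x)))) \<longlonglongrightarrow> of_real (1 / (1 + t\<^sup>2)) * exp (\<i> * of_real (t * x))"
        by simp
    qed
    show "AE t in lborel. norm (of_real (gauss (?e k) t) * (of_real (1 / (1 + t\<^sup>2)) * exp (\<i> * of_real (t * x)))) \<le> 1 / (1 + t\<^sup>2)" for k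
    proof (rule AE_I2)
      fix t :: real
      have "norm (of_real (gauss (?e k) t) * (of_real (1 / (1 + t\<^sup>2)) * exp (\<i> * of_real (t * x)))) = gauss (?e k) t * (1 / (1 + t\<^sup>2))"
        using gauss_bounds(1)[of "?e k" t] by (simp only: norm_mult norm_of_real norm_exp_i_times abs_of_pos) (simp add: abs_of_nonneg)
      also have "\<dots> \<le> 1 / (1 + t\<^sup>2)"
        using gauss_bounds[of "?e k" t] by (intro mult_left_le_one_le) auto
      finally show "norm (of_real (gauss (?e k) t) * (of_real (1 / (1 + t\<^sup>2)) * exp (\<i> * of_real (t * x)))) \<le> 1 / (1 + t\<^sup>2)" .
    qed
  qed (use integrable_cauchy in measurable)
  have rhs: "(\<lambda>k. of_real (sqrt (2 * pi)) * (\<integral>y. of_real (gauss 1 y) * ?E (x + ?e k * y) \<partial>lborel)) \<longlonglongrightarrow> of_real (sqrt (2 * pi)) * (\<integral>y. of_real (gauss 1 y) * ?E x \<partial>lborel)"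
  proof (rule tendsto_mult_left, rule integral_dominated_convergence[where w = "gauss 1"])
    show "AE y in lborel. (\<lambda>k. of_real (gauss 1 y) * ?E (x + ?e k * y)) \<longlonglongrightarrow> of_real (gauss 1 y) * ?E x"
    proof (rule AE_I2)
      fix y :: real
      have "(\<lambda>k. of_real (gauss 1 y) * ?E (x + ?e k * y)) \<longlonglongrightarrow> of_real (gauss 1 y) * ?E (x + 0 * y)"
        by (intro tendsto_intros e0) auto
      then show "(\<lambda>k. of_real (gauss 1 y) * ?E (x + ?e k * y)) \<longlonglongrightarrow> of_real (gauss 1 y) * ?E x" by simp
    qed
    show "integrable lborel (gauss 1)" by (rule gauss_integrable) simp
    show "AE y in lborel. norm (of_real (gauss 1 y) * ?E (x + ?e k * y)) \<le> gauss 1 y" for k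
    proof (rule AE_I2)
      fix y :: real
      have "exp (- \<bar>x + ?e k * y\<bar>) \<le> 1" by simp
      then have "norm (?E (x + ?e k * y)) \<le> 1"
        by (simp only: norm_of_real abs_divide abs_exp_cancel abs_numeral)
      then show "norm (of_real (gauss 1 y) * ?E (x + ?e k * y)) \<le> gauss 1 y"
        using gauss_bounds(1)[of 1 y] by (simp only: norm_mult norm_of_real abs_of_pos mult_right_le_one_le norm_ge_zero less_imp_le)
    qed
  qed measurable
  have "?e k > 0" for k by simp
  note smoothed[OF this]
  from LIMSEQ_unique[OF lhs[unfolded this] rhs]
  have "(\<integral>t. of_real (1 / (1 + t\<^sup>2)) * exp (\<i> * of_real (t * x)) \<partial>lborel) = of_real (sqrt (2 * pi)) * (\<integral>y. of_real (gauss 1 y) * ?E x \<partial>lborel)" .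
  also have "\<dots> = complex_of_real (sqrt (2 * pi) * (sqrt (2 * pi) / 1) * (exp (- \<bar>x\<bar>) / 2))"
  proof -
    have "(\<integral>y. complex_of_real (gauss 1 y) * ?E x \<partial>lborel) = of_real (sqrt (2 * pi) / 1) * ?E x"
      by (simp only: integral_mult_left_zero integral_complex_of_real gauss_integral[OF zero_less_one])
    then show ?thesis by (simp only: of_real_mult mult.assoc)
  qed
  also have "sqrt (2 * pi) * (sqrt (2 * pi) / 1) * (exp (- \<bar>x\<bar>) / 2) = pi * exp (- \<bar>x\<bar>)" by simp
  finally show ?thesis .
qed

text \<open>Multiplication by \<open>\<i> * X\<close> corresponds to \<open>- d/dt\<close> on the density of waves, so
  the polynomial factors only cost derivatives of \<open>1 / (1 + t\<^sup>2)\<close>, which stay integrable.\<close>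

lemma wave_derivative:
  fixes g g' :: "real \<Rightarrow> real"
  assumes d: "\<And>t. (g has_real_derivative g' t) (at t)" and c: "continuous_on UNIV g'"
    and g: "integrable lborel g" and g': "integrable lborel g'"
  shows "(\<integral>t. of_real (g' t) * exp (\<i> * of_real (t * x)) \<partial>lborel) =
    - (\<i> * of_real x) * (\<integral>t. of_real (g t) * exp (\<i> * of_real (t * x)) \<partial>lborel)"
proof -
  let ?F = "\<lambda>t. complex_of_real (g t) * exp (\<i> * of_real (t * x))"
  have ig: "integrable lborel ?F"
    by (rule Bochner_Integration.integrable_bound[OF g]) (use g in \<open>auto simp: norm_mult\<close>)
  have ig': "integrable lborel (\<lambda>t. complex_of_real (g' t) * exp (\<i> * of_real (t * x)))"
    by (rule Bochner_Integration.integrable_bound[OF g']) (use g' in \<open>auto simp: norm_mult\<close>)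
  have D: "(?F has_derivative (\<lambda>v. v *\<^sub>R (of_real (g' t) * exp (\<i> * of_real (t * x)) + (\<i> * of_real x) * ?F t))) (at t)" for t
  proof -
    have v1: "((\<lambda>t. complex_of_real (g t)) has_vector_derivative of_real (g' t)) (at t)"
      by (rule has_vector_derivative_of_real[OF d])
    have v2: "((\<lambda>t. exp (\<i> * complex_of_real (t * x))) has_vector_derivative (\<i> * of_real x * exp (\<i> * of_real (t * x)))) (at t)"
      using has_derivative_wave[of x t] by (simp add: has_vector_derivative_def scaleR_conv_of_real mult_ac)
    have "complex_of_real (g t) * (\<i> * of_real x * exp (\<i> * of_real (t * x))) + of_real (g' t) * exp (\<i> * of_real (t * x))
       = of_real (g' t) * exp (\<i> * of_real (t * x)) + (\<i> * of_real x) * ?F t"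
      by (simp only: mult_ac add_ac)
    with has_vector_derivative_mult[OF v1 v2] show ?thesis
      unfolding has_vector_derivative_def by (simp only:)
  qed
  have p: "partial 1 ?F = (\<lambda>t. of_real (g' t) * exp (\<i> * of_real (t * x)) + (\<i> * of_real x) * ?F t)"
    by (rule ext, rule partial_eqI[OF D, THEN trans]) simp
  have cg: "continuous_on UNIV g"
    using d by (meson DERIV_isCont continuous_at_imp_continuous_on)
  have "0 = (\<integral>t. partial 1 ?F t \<partial>lborel)"
  proof (rule integral_partial_eq_0[symmetric])
    show "?F differentiable (at t)" for t using D unfolding differentiable_def by blast
    show "continuous_on UNIV (partial 1 ?F)" unfolding p by (intro continuous_intros c cg)
    show "integrable lborel ?F" by (rule ig)
    show "integrable lborel (partial 1 ?F)" unfolding p by (intro Bochner_Integration.integrable_add ig' integrable_mult_right ig)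
  qed
  also have "\<dots> = (\<integral>t. of_real (g' t) * exp (\<i> * of_real (t * x)) \<partial>lborel) + (\<i> * of_real x) * (\<integral>t. ?F t \<partial>lborel)"
    unfolding p Bochner_Integration.integral_add[OF ig' integrable_mult_right[OF ig]] integral_mult_right_zero ..
  finally show ?thesis by (simp add: eq_neg_iff_add_eq_0 mult.assoc)
qed

text \<open>Why exponential kernels are useful: multiplied by a polynomial of degree at most two they are still
  superpositions of plane waves with an integrable density, and a plane wave in \<open>X\<close> factors when \<open>X\<close> is a
  linear combination of several variables. The densities are combinations of
  \<open>1 / (2 * pi * (1 + t\<^sup>2))\<close> and its first two derivatives.\<close>

lemma exp_kernel_waves:
  "\<exists>\<gamma> :: nat \<Rightarrow> real \<Rightarrow> complex. (\<forall>k\<le>2. integrable lborel (\<gamma> k)) \<and>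
    (\<forall>k\<le>2. \<forall>x. (\<integral>t. \<gamma> k t * exp (\<i> * of_real (t * x)) \<partial>lborel) = (1 + \<i> * of_real x) ^ (2 - k) * of_real (exp (- \<bar>x\<bar>) / 2))"
proof -
  define g where "g = (\<lambda>t::real. 1 / (1 + t\<^sup>2) * (1 / (2 * pi)))"
  define g' where "g' = (\<lambda>t::real. (- 2 * t / (1 + t\<^sup>2)\<^sup>2) * (1 / (2 * pi)))"
  define g'' where "g'' = (\<lambda>t::real. ((6 * t\<^sup>2 - 2) / (1 + t\<^sup>2) ^ 3) * (1 / (2 * pi)))"
  have pos: "1 + t\<^sup>2 > 0" for t :: real by (simp add: add_pos_nonneg)
  then have nz: "1 + t\<^sup>2 \<noteq> 0" for t :: real by (metis less_irrefl)
  have d: "(g has_real_derivative g' t) (at t)" for t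
    unfolding g_def g'_def using nz[of t]
    by (intro DERIV_cmult_right) (auto intro!: derivative_eq_intros simp: power2_eq_square)
  have d': "(g' has_real_derivative g'' t) (at t)" for t
    unfolding g'_def g''_def using nz[of t]
    by (intro DERIV_cmult_right) (auto intro!: derivative_eq_intros simp: divide_simps, algebra)
  have c: "continuous_on UNIV g" "continuous_on UNIV g'" "continuous_on UNIV g''"
    unfolding g_def g'_def g''_def using nz by (auto intro!: continuous_intros)
  have ig: "integrable lborel g" unfolding g_def by (intro integrable_mult_left integrable_cauchy)
  have m: "g \<in> borel_measurable borel" "g' \<in> borel_measurable borel" "g'' \<in> borel_measurable borel"
    using c by (auto intro: borel_measurable_continuous_onI)
  have b1: "\<bar>- 2 * t / (1 + t\<^sup>2)\<^sup>2\<bar> \<le> 1 / (1 + t\<^sup>2)" for t :: real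
  proof -
    have "2 * \<bar>t\<bar> \<le> 1 + t\<^sup>2" using sum_squares_bound[of 1 "\<bar>t\<bar>"] by simp
    then show ?thesis using pos[of t] by (simp add: divide_simps power2_eq_square abs_mult)
  qed
  have b2: "\<bar>(6 * t\<^sup>2 - 2) / (1 + t\<^sup>2) ^ 3\<bar> \<le> 6 * (1 / (1 + t\<^sup>2))" for t :: real
  proof -
    have "\<bar>6 * t\<^sup>2 - 2\<bar> \<le> 6 * (1 + t\<^sup>2) * 1" by (simp add: abs_le_iff)
    also have "\<dots> \<le> 6 * (1 + t\<^sup>2) * (1 + t\<^sup>2)" by (intro mult_left_mono) auto
    finally have "\<bar>6 * t\<^sup>2 - 2\<bar> / (1 + t\<^sup>2) ^ 3 \<le> 6 * (1 + t\<^sup>2) * (1 + t\<^sup>2) / (1 + t\<^sup>2) ^ 3"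
      using pos[of t] by (intro divide_right_mono) auto
    also have "\<dots> = 6 * (1 / (1 + t\<^sup>2))"
    proof -
      have "6 * w * w / w ^ 3 = 6 * (1 / w)" if "w \<noteq> 0" for w :: real
        using that by (simp add: power3_eq_cube)
      from this[OF nz] show ?thesis .
    qed
    finally show ?thesis using pos[of t] by simp
  qed
  have ig': "integrable lborel g'"
  proof (rule Bochner_Integration.integrable_bound[OF ig])
    show "AE t in lborel. norm (g' t) \<le> norm (g t)"
      unfolding g_def g'_def real_norm_def abs_mult
      by (intro AE_I2 mult_right_mono order_trans[OF b1] abs_ge_self abs_ge_zero)
  qed (use m in auto)
  have ig'': "integrable lborel g''"
  proof (rule Bochner_Integration.integrable_bound)
    show "integrable lborel (\<lambda>t::real. 6 * (1 / (1 + t\<^sup>2)) * (1 / (2 * pi)))"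
      by (intro integrable_mult_left integrable_mult_right integrable_cauchy)
    show "AE t in lborel. norm (g'' t) \<le> norm (6 * (1 / (1 + t\<^sup>2)) * (1 / (2 * pi)))"
      unfolding g''_def real_norm_def abs_mult[of _ "1 / (2 * pi)"]
      by (intro AE_I2 mult_right_mono order_trans[OF b2] abs_ge_self abs_ge_zero)
  qed (use m in auto)
  define I where "I h x = (\<integral>t. complex_of_real (h t) * exp (\<i> * of_real (t * x)) \<partial>lborel)" for h :: "real \<Rightarrow> real" and x
  define \<gamma> where "\<gamma> k t = (if k = 0 then of_real (g t - 2 * g' t + g'' t) else if k = 1 then of_real (g t - g' t) else complex_of_real (g t))" for k :: nat and t
  have I0: "I g x = of_real (exp (- \<bar>x\<bar>) / 2)" for x
  proof -
    have "I g x = (\<integral>t. of_real (1 / (2 * pi)) * (of_real (1 / (1 + t\<^sup>2)) * exp (\<i> * of_real (t * x))) \<partial>lborel)"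
      unfolding I_def g_def by (intro Bochner_Integration.integral_cong) auto
    also have "\<dots> = of_real (1 / (2 * pi)) * complex_of_real (pi * exp (- \<bar>x\<bar>))"
      by (simp only: integral_mult_right_zero inverse_fourier_exp_abs)
    also have "\<dots> = complex_of_real ((1 / (2 * pi)) * (pi * exp (- \<bar>x\<bar>)))" by (simp only: of_real_mult)
    also have "(1 / (2 * pi)) * (pi * exp (- \<bar>x\<bar>)) = exp (- \<bar>x\<bar>) / 2" by simp
    finally show ?thesis .
  qed
  have I1: "I g' x = - (\<i> * of_real x) * I g x" for x
    unfolding I_def by (rule wave_derivative[OF d c(2) ig ig'])
  have I2: "I g'' x = - (\<i> * of_real x) * I g' x" for x
    unfolding I_def by (rule wave_derivative[OF d' c(3) ig' ig''])
  have iw: "integrable lborel (\<lambda>t. complex_of_real (h t) * exp (\<i> * of_real (t * x)))" if "integrable lborel h" for h x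
    by (rule Bochner_Integration.integrable_bound[OF that]) (use that in \<open>auto simp: norm_mult\<close>)
  show ?thesis
  proof (intro exI[of _ \<gamma>] conjI allI impI)
    fix k :: nat assume k: "k \<le> 2"
    show "integrable lborel (\<gamma> k)"
      unfolding \<gamma>_def using ig ig' ig'' by (cases "k = 0"; cases "k = 1") auto
    fix x :: real
    consider "k = 0" | "k = 1" | "k = 2" using k by linarith
    then show "(\<integral>t. \<gamma> k t * exp (\<i> * of_real (t * x)) \<partial>lborel) = (1 + \<i> * of_real x) ^ (2 - k) * of_real (exp (- \<bar>x\<bar>) / 2)"
    proof cases
      case 1
      have "(\<integral>t. \<gamma> k t * exp (\<i> * of_real (t * x)) \<partial>lborel) =
        (\<integral>t. (of_real (g t) * exp (\<i> * of_real (t * x)) - 2 * (of_real (g' t) * exp (\<i> * of_real (t * x)))) + of_real (g'' t) * exp (\<i> * of_real (t * x)) \<partial>lborel)"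
        by (intro Bochner_Integration.integral_cong) (auto simp: \<gamma>_def 1 algebra_simps)
      also have "\<dots> = (I g x - 2 * I g' x) + I g'' x"
        unfolding I_def by (simp add: iw ig ig' ig'' del: of_real_mult)
      also have "\<dots> = (1 + \<i> * of_real x) ^ 2 * I g x"
        by (simp add: I1 I2 power2_eq_square algebra_simps)
      finally show ?thesis by (simp only: I0 1) simp
    next
      case 2
      have "(\<integral>t. \<gamma> k t * exp (\<i> * of_real (t * x)) \<partial>lborel) =
        (\<integral>t. of_real (g t) * exp (\<i> * of_real (t * x)) - of_real (g' t) * exp (\<i> * of_real (t * x)) \<partial>lborel)"
        by (intro Bochner_Integration.integral_cong) (auto simp: \<gamma>_def 2 algebra_simps)
      also have "\<dots> = I g x - I g' x"
        unfolding I_def by (simp add: iw ig ig' del: of_real_mult)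
      also have "\<dots> = (1 + \<i> * of_real x) * I g x"
        by (simp add: I1 algebra_simps)
      finally show ?thesis by (simp only: I0 2) simp
    next
      case 3
      then have "(\<integral>t. \<gamma> k t * exp (\<i> * of_real (t * x)) \<partial>lborel) = I g x"
        unfolding I_def by (intro Bochner_Integration.integral_cong) (auto simp: \<gamma>_def)
      then show ?thesis by (simp only: I0 3) simp
    qed
  qed
qed

section \<open>Representation of a symbol by exponential kernels\<close>

abbreviation dir_q :: "'n::finite \<Rightarrow> 'n phase" where "dir_q j \<equiv> (axis j 1, 0)"
abbreviation dir_p :: "'n::finite \<Rightarrow> 'n phase" where "dir_p j \<equiv> (0, axis j 1)"

lemma dir_Basis [simp]: "dir_q j \<in> Basis" "dir_p j \<in> Basis"
  by (auto simp: Basis_phase)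

text \<open>The product over \<open>j \<in> set js\<close> of the operators \<open>1 - (l j)\<^sup>-\<^sup>2 \<partial>\<^sup>2\<close> in the variables \<open>q $ j\<close>, with
  frozen scales \<open>l\<close>.\<close>

primrec green_op :: "('n::finite \<Rightarrow> real) \<Rightarrow> 'n list \<Rightarrow> ('n phase \<Rightarrow> complex) \<Rightarrow> 'n phase \<Rightarrow> complex" where
  "green_op l [] a = a"
| "green_op l (j # js) a = (\<lambda>z. green_op l js a z +
     (- (1 / l j)\<^sup>2) *\<^sub>R partial (dir_q j) (partial (dir_q j) (green_op l js a)) z)"

lemma smooth_green_op: "smooth a \<Longrightarrow> smooth (green_op l js a)"
proof (induction js)
  case (Cons j js)
  then show ?case
    unfolding green_op.simps by (intro smooth_add smooth_scaleR smooth_partial dir_Basis)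
qed simp

lemma green_op_support:
  assumes "\<And>z. norm z > R \<Longrightarrow> a z = 0" "norm z > R"
  shows "green_op l js a z = 0"
  using assms(2)
proof (induction js arbitrary: z)
  case (Cons j js)
  then show ?case
    using partial_zero_outside[of R "green_op l js a" z "[dir_q j, dir_q j]"] by simp
qed (simp add: assms)

lemma green_op_cong: "(\<And>i. i \<in> set js \<Longrightarrow> l i = l' i) \<Longrightarrow> green_op l js a = green_op l' js a"
  by (induction js) auto

lemma partials_green_op_Cons:
  assumes a: "smooth a" and bs: "set bs \<subseteq> Basis"
  shows "partials bs (green_op l (j # js) a) z = partials bs (green_op l js a) z +
    (- (1 / l j)\<^sup>2) *\<^sub>R partials (bs @ [dir_q j, dir_q j]) (green_op l js a) z"
proof -
  have s: "smooth (green_op l js a)" by (rule smooth_green_op[OF a])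
  have s2: "smooth (partial (dir_q j) (partial (dir_q j) (green_op l js a)))"
    by (intro smooth_partial s dir_Basis)
  show ?thesis
    unfolding green_op.simps partials_add[OF s smooth_scaleR[OF s2] bs] partials_scaleR[OF s2 bs]
    by (simp only: foldr_append foldr.simps o_apply id_apply)
qed

text \<open>Each factor of the operator costs two derivatives and a factor two: the second derivative in \<open>q $ j\<close>
  costs \<open>(W (dir_q j))\<^sup>2\<close>, which the coefficient \<open>1 / (l j)\<^sup>2\<close> compensates.\<close>

lemma jet_bound_green_op:
  assumes a: "smooth a" and "jet_bound (L + 2 * length js) W z A a"
    and W: "\<And>b. b \<in> Basis \<Longrightarrow> 0 \<le> W b" and l: "\<And>j. j \<in> set js \<Longrightarrow> 0 < l j \<and> W (dir_q j) \<le> l j"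
  shows "jet_bound L W z (2 ^ length js * A) (green_op l js a)"
  using assms(2) l
proof (induction js arbitrary: L)
  case Nil
  then show ?case by simp
next
  case (Cons j js)
  let ?g = "green_op l js a"
  have s: "smooth ?g" by (rule smooth_green_op[OF a])
  have A: "0 \<le> A" using jet_bound_norm[OF Cons.prems(1)] norm_ge_zero order_trans by blast
  have g: "jet_bound (Suc (Suc L)) W z (2 ^ length js * A) ?g"
    using Cons.prems by (intro Cons.IH) (auto simp: algebra_simps)
  have lj: "0 < l j" "0 \<le> W (dir_q j)" "W (dir_q j) \<le> l j" using Cons.prems(2) W by auto
  have "jet_bound L W z (2 ^ length js * A * W (dir_q j) * W (dir_q j)) (partial (dir_q j) (partial (dir_q j) ?g))"
    by (intro jet_bound_partial g dir_Basis)
  then have "jet_bound L W z (\<bar>- (1 / l j)\<^sup>2\<bar> * (2 ^ length js * A * W (dir_q j) * W (dir_q j)))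
     (\<lambda>z. (- (1 / l j)\<^sup>2) *\<^sub>R partial (dir_q j) (partial (dir_q j) ?g) z)"
    by (rule jet_bound_scaleR) (intro smooth_partial s dir_Basis)
  moreover have "\<bar>- (1 / l j)\<^sup>2\<bar> * (2 ^ length js * A * W (dir_q j) * W (dir_q j)) \<le> 2 ^ length js * A"
  proof -
    have "\<bar>- (1 / l j)\<^sup>2\<bar> * (2 ^ length js * A * W (dir_q j) * W (dir_q j)) = (2 ^ length js * A) * (W (dir_q j) / l j)\<^sup>2"
      by (simp add: power2_eq_square)
    also have "\<dots> \<le> (2 ^ length js * A) * 1"
      using lj A by (intro mult_left_mono power_le_one) (auto simp: field_simps)
    finally show ?thesis by simp
  qed
  ultimately have h: "jet_bound L W z (2 ^ length js * A) (\<lambda>z. (- (1 / l j)\<^sup>2) *\<^sub>R partial (dir_q j) (partial (dir_q j) ?g) z)"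
    using W by (rule jet_bound_mono) auto
  have "jet_bound L W z (2 ^ length js * A) ?g"
    by (rule jet_bound_mono[OF g order_refl W]) auto
  from jet_bound_add[OF this h s smooth_scaleR[OF smooth_partial[OF smooth_partial[OF s dir_Basis(1)] dir_Basis(1)]]]
  have "jet_bound L W z (2 ^ length js * A + 2 ^ length js * A) (green_op l (j # js) a)"
    unfolding green_op.simps .
  then show ?case by (simp only: length_Cons power_Suc mult_2 distrib_right)
qed

lemma measurable_green_op:
  fixes h :: "'x \<Rightarrow> 'n::finite phase"
  assumes a: "smooth a" and h [measurable]: "h \<in> M \<rightarrow>\<^sub>M borel"
    and l [measurable]: "\<And>j. (\<lambda>x. l x j) \<in> borel_measurable M" and bs: "set bs \<subseteq> Basis"
  shows "(\<lambda>x. partials bs (green_op (l x) js a) (h x)) \<in> borel_measurable M"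
  using bs
proof (induction js arbitrary: bs)
  case Nil
  have "continuous_on UNIV (partials bs a)" by (intro smooth_continuous smooth_partials a Nil)
  then show ?case
    by (simp add: measurable_compose[OF h borel_measurable_continuous_onI])
next
  case (Cons j js)
  have [measurable]: "(\<lambda>x. partials bs (green_op (l x) js a) (h x)) \<in> borel_measurable M"
    "(\<lambda>x. partials (bs @ [dir_q j, dir_q j]) (green_op (l x) js a) (h x)) \<in> borel_measurable M"
    by (intro Cons.IH, use Cons.prems in simp)+
  show ?case
    unfolding partials_green_op_Cons[OF a Cons.prems] by measurable
qed

lemma compact_support_jet_bound:
  fixes a :: "'a::euclidean_space \<Rightarrow> 'b::real_normed_vector"
  assumes a: "smooth a" and R: "\<And>z. norm z > R \<Longrightarrow> a z = 0"
  shows "\<exists>A\<ge>0. \<forall>z. jet_bound L (\<lambda>_. 1) z A a"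
proof -
  have "\<exists>B\<ge>0. \<forall>z. norm (partials bs a z) \<le> B" if bs: "set bs \<subseteq> Basis" for bs
  proof -
    have z: "partials bs a z = 0" if "norm z > R" for z by (rule partial_zero_outside[OF R that])
    obtain B where "B \<ge> 0" "\<And>z. norm (partials bs a z) \<le> B"
      using continuous_compact_support_bounded[OF smooth_continuous[OF smooth_partials[OF a bs]] z] by blast
    then show ?thesis by blast
  qed
  then obtain B where B: "\<And>bs. set bs \<subseteq> Basis \<Longrightarrow> B bs \<ge> 0" "\<And>bs z. set bs \<subseteq> Basis \<Longrightarrow> norm (partials bs a z) \<le> B bs"
    by metis
  let ?S = "{bs :: 'a list. set bs \<subseteq> Basis \<and> length bs \<le> L}"
  have fin: "finite ?S" by (rule finite_lists_length_le) simp
  show ?thesis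
  proof (intro exI[of _ "sum B ?S"] conjI allI)
    show "0 \<le> sum B ?S" by (intro sum_nonneg) (auto simp: B)
    fix z show "jet_bound L (\<lambda>_. 1) z (sum B ?S) a"
      unfolding jet_bound_def
    proof (intro allI impI)
      fix bs :: "'a list" assume bs: "set bs \<subseteq> Basis" "length bs \<le> L"
      have "norm (partials bs a z) \<le> B bs" using B bs by auto
      also have "\<dots> \<le> sum B ?S" using bs by (intro member_le_sum fin) (auto simp: B)
      finally show "norm (partials bs a z) \<le> sum B ?S * prod_list (map (\<lambda>_. 1) bs)"
        by (simp add: map_replicate_const)
    qed
  qed
qed

text \<open>The coordinates in \<open>js\<close> have already been replaced by integration variables, the others have not.\<close>

definition mix :: "'n list \<Rightarrow> real ^ 'n \<Rightarrow> real ^ 'n \<Rightarrow> real ^ 'n::finite"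
  where "mix js z m = (\<chi> i. if i \<in> set js then z $ i else m $ i)"

lemma mix_measurable [measurable]: "(\<lambda>z. mix js z m) \<in> borel \<rightarrow>\<^sub>M (borel :: (real ^ 'n::finite) measure)"
proof -
  have "continuous_on UNIV (\<lambda>z. mix js z m)"
  proof -
    have "continuous_on UNIV (\<lambda>z. if i \<in> set js then z $ i else m $ i)" for i
      by (cases "i \<in> set js") (auto intro!: continuous_intros)
    then show ?thesis unfolding mix_def by (intro continuous_on_vec_lambda)
  qed
  then show ?thesis by (rule borel_measurable_continuous_onI)
qed

lemma green_nonneg: "0 \<le> l \<Longrightarrow> 0 \<le> green l s"
  by (simp add: green_def)

lemma green_measurable [measurable]:
  assumes [measurable]: "f \<in> borel_measurable M" "g \<in> borel_measurable M"
  shows "(\<lambda>x. green (f x) (g x)) \<in> borel_measurable M"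
  unfolding green_def by measurable

text \<open>Coordinates outside \<open>js\<close> carry the indicator of the unit interval, a probability density that keeps the
  integral over the whole space meaningful while the coordinates are treated one by one.\<close>

definition green_box :: "(real \<Rightarrow> real) \<Rightarrow> 'n::{finite,linorder} list \<Rightarrow> (real, 'n) vec \<Rightarrow> (real, 'n) vec \<Rightarrow> real"
  where "green_box f js m z = (\<Prod>i\<in>UNIV. if i \<in> set js then green (scale_vec f (z $ r_idx) i) (z $ i - m $ i) else indicator {0..1} (z $ i))"

lemma green_box_nonneg: "(\<And>r. 1 \<le> f r) \<Longrightarrow> 0 \<le> green_box f js m z"
  unfolding green_box_def
  by (intro prod_nonneg) (auto intro!: green_nonneg order_trans[OF zero_le_one scale_vec_pos])

lemma green_box_measurable [measurable]:
  assumes [measurable]: "f \<in> borel_measurable borel"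
  shows "green_box f js m \<in> borel_measurable borel"
  unfolding green_box_def[abs_def] by measurable

lemma green_box_integrable:
  fixes m :: "(real, 'n::{finite,linorder}) vec"
  assumes [measurable]: "f \<in> borel_measurable borel" and f: "\<And>r. 1 \<le> f r" and js: "admissible_order js"
  shows "integrable lborel (green_box f js m)"
proof (rule integrableI_nonneg)
  show "AE z in lborel. 0 \<le> green_box f js m z" by (intro AE_I2 green_box_nonneg f)
  have "(\<integral>\<^sup>+z. ennreal (green_box f js m z) \<partial>lborel) =
     (\<integral>\<^sup>+z. (\<Prod>i\<in>UNIV. if i \<in> set js
      then ennreal (scale_vec f (z $ r_idx) i) * ennreal (exp (- \<bar>scale_vec f (z $ r_idx) i * (z $ i - m $ i)\<bar>) / 2)
      else indicator {0..1} (z $ i)) \<partial>lborel)"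
  proof (rule nn_integral_cong)
    fix z :: "(real, 'n) vec"
    have l: "1 \<le> scale_vec f (z $ r_idx) i" for i by (rule scale_vec_pos[OF f])
    then have l0: "0 \<le> scale_vec f (z $ r_idx) i" for i by (rule order_trans[OF zero_le_one])
    have "ennreal (green_box f js m z) = (\<Prod>i\<in>UNIV. ennreal (if i \<in> set js then green (scale_vec f (z $ r_idx) i) (z $ i - m $ i) else indicator {0..1} (z $ i)))"
      unfolding green_box_def by (rule prod_ennreal[symmetric]) (auto intro!: green_nonneg l0)
    also have "\<dots> = (\<Prod>i\<in>UNIV. if i \<in> set js
      then ennreal (scale_vec f (z $ r_idx) i) * ennreal (exp (- \<bar>scale_vec f (z $ r_idx) i * (z $ i - m $ i)\<bar>) / 2)
      else indicator {0..1} (z $ i))"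
    proof -
      have "ennreal (green c d) = ennreal c * ennreal (exp (- \<bar>c * d\<bar>) / 2)" if "0 \<le> c" for c d
        using that by (simp add: green_def abs_mult flip: ennreal_mult)
      from this[OF l0] show ?thesis by (intro prod.cong) (auto simp: ennreal_indicator)
    qed
    finally show "ennreal (green_box f js m z) = \<dots>" .
  qed
  also have "\<dots> = 1"
    by (rule nn_integral_scaled_box[OF _ _ nn_integral_exp_abs f js]) measurable
  finally show "(\<integral>\<^sup>+z. ennreal (green_box f js m z) \<partial>lborel) < \<infinity>" by simp
qed measurable

text \<open>One coordinate at a time, the one-dimensional Green representation replaces \<open>m $ j\<close> by the
  integration variable \<open>z $ j\<close>. For the full list of coordinates this writes \<open>a (m, p)\<close> as a superposition
  of kernels \<open>exp (- l \<bar>m - z\<bar>)\<close> whose coefficients are evaluated at \<open>z\<close>: the dependence of the symbol on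
  \<open>m\<close> becomes explicit.\<close>

lemma symbol_representation:
  fixes a :: "'n::{finite,linorder} phase \<Rightarrow> complex"
  assumes a: "smooth a" and R: "\<And>z. norm z > R \<Longrightarrow> a z = 0"
    and f_meas [measurable]: "f \<in> borel_measurable borel" and f: "\<And>r. 1 \<le> f r" and js: "admissible_order js"
  shows "integrable lborel (\<lambda>z. green_box f js m z *\<^sub>R green_op (scale_vec f (z $ r_idx)) js a (mix js z m, p))"
    and "(\<integral>z. green_box f js m z *\<^sub>R green_op (scale_vec f (z $ r_idx)) js a (mix js z m, p) \<partial>lborel) = a (m, p)"
proof -
  let ?F = "\<lambda>js z. green_box f js m z *\<^sub>R green_op (scale_vec f (z $ r_idx)) js a (mix js z m, p)"
  have int: "integrable lborel (?F js)" if js: "admissible_order js" for js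
  proof -
    obtain A where A: "A \<ge> 0" "\<And>z. jet_bound (0 + 2 * length js) (\<lambda>_. 1) z A a"
      using compact_support_jet_bound[OF a R, where L = "0 + 2 * length js"] by blast
    have G: "norm (green_op (scale_vec f r) js a z) \<le> 2 ^ length js * A" for r z
      by (rule jet_bound_norm[OF jet_bound_green_op[OF a A(2)]])
        (auto intro: scale_vec_pos f less_le_trans[OF zero_less_one scale_vec_pos])
    have [measurable]: "(\<lambda>z. green_op (scale_vec f (z $ r_idx)) js a (mix js z m, p)) \<in> borel_measurable borel"
      using measurable_green_op[OF a, of "\<lambda>z. (mix js z m, p)" borel "\<lambda>z. scale_vec f (z $ r_idx)" "[]" js]
      by (simp add: borel_prod[symmetric])
    show ?thesis
    proof (rule Bochner_Integration.integrable_bound)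
      show "integrable lborel (\<lambda>z. green_box f js m z * (2 ^ length js * A))"
        by (intro integrable_mult_left green_box_integrable f js f_meas)
      show "AE z in lborel. norm (?F js z) \<le> norm (green_box f js m z * (2 ^ length js * A))"
        using A(1) G green_box_nonneg[OF f] by (intro AE_I2) (simp add: abs_mult mult_left_mono)
    qed measurable
  qed
  show "integrable lborel (?F js)" by (rule int[OF js])
  show "(\<integral>z. ?F js z \<partial>lborel) = a (m, p)"
    using js
  proof (induction js)
    case Nil
    have "(\<integral>z. green_box f [] m z \<partial>lborel) = 1"
    proof -
      have "(\<integral>\<^sup>+z. ennreal (green_box f [] m z) \<partial>lborel) = (\<integral>\<^sup>+z. (\<Prod>i\<in>UNIV. indicator {0..1} (z $ i)) \<partial>(lborel :: (real, 'n) vec measure))"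
      proof (rule nn_integral_cong)
        fix z :: "(real, 'n) vec"
        have "ennreal (green_box f [] m z) = ennreal (\<Prod>i\<in>UNIV. indicat_real {0..1} (z $ i))"
          by (simp only: green_box_def list.set empty_iff if_False)
        also have "\<dots> = (\<Prod>i\<in>UNIV. ennreal (indicat_real {0..1} (z $ i)))"
          by (rule prod_ennreal[symmetric]) simp
        finally show "ennreal (green_box f [] m z) = (\<Prod>i\<in>UNIV. indicator {0..1} (z $ i))"
          by (simp only: ennreal_indicator)
      qed
      also have "\<dots> = 1"
        using nn_integral_scaled_box[OF _ f_meas nn_integral_exp_abs f Nil, where y = m] by simp
      finally have nn: "(\<integral>\<^sup>+z. ennreal (green_box f [] m z) \<partial>lborel) = 1" .
      have "(\<integral>z. green_box f [] m z \<partial>lborel) = enn2real (\<integral>\<^sup>+z. ennreal (green_box f [] m z) \<partial>lborel)"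
        by (rule integral_eq_nn_integral) (auto intro!: green_box_nonneg f)
      then show ?thesis by (simp only: nn enn2real_1)
    qed
    moreover have "mix [] z m = m" for z by (simp add: mix_def vec_eq_iff)
    ultimately show ?case using green_box_integrable[OF f_meas f Nil, of m] by simp
  next
    case (Cons j js)
    note adm = admissible_order_Cons[OF Cons.prems]
    let ?l = "\<lambda>w. scale_vec f (w $ r_idx)"
    have inner: "(\<integral>s. ?F (j # js) (upd w j s) \<partial>lborel) =
       (\<Prod>i\<in>UNIV - {j}. if i \<in> set js then green (?l w i) (w $ i - m $ i) else indicator {0..1} (w $ i)) *\<^sub>R
         green_op (?l w) js a (mix js w m, p)" for w :: "(real, 'n) vec"
    proof -
      let ?\<Pi> = "\<Prod>i\<in>UNIV - {j}. if i \<in> set js then green (?l w i) (w $ i - m $ i) else indicator {0..1} (w $ i)"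
      let ?g = "green_op (?l w) js a"
      have lw: "?l (upd w j s) i = ?l w i" if "i \<in> set (j # js)" for i s
        by (rule scale_vec_upd[OF Cons.prems that])
      have fac: "(if i \<in> set (j # js) then green (?l (upd w j s) i) (upd w j s $ i - m $ i) else indicator {0..1} (upd w j s $ i)) =
        (if i \<in> set js then green (?l w i) (w $ i - m $ i) else indicat_real {0..1} (w $ i))" if "i \<noteq> j" for i s
        using that lw[of i s] by (auto simp: upd_nth)
      have fac_j: "(if j \<in> set (j # js) then green (?l (upd w j s) j) (upd w j s $ j - m $ j) else indicat_real {0..1} (upd w j s $ j)) =
        green (?l w j) (s - m $ j)" for s
        using lw[of j s] by (auto simp: upd_nth)
      have box: "green_box f (j # js) m (upd w j s) = ?\<Pi> * green (?l w j) (s - m $ j)" for s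
      proof -
        have "green_box f (j # js) m (upd w j s) = green (?l w j) (s - m $ j) *
          (\<Prod>i\<in>UNIV - {j}. if i \<in> set (j # js) then green (?l (upd w j s) i) (upd w j s $ i - m $ i) else indicator {0..1} (upd w j s $ i))"
          unfolding green_box_def by (subst prod.remove[of _ j]) (simp_all only: fac_j finite UNIV_I)
        also have "(\<Prod>i\<in>UNIV - {j}. if i \<in> set (j # js) then green (?l (upd w j s) i) (upd w j s $ i - m $ i) else indicator {0..1} (upd w j s $ i)) = ?\<Pi>"
          by (intro prod.cong refl fac) auto
        finally show ?thesis by (simp add: mult.commute)
      qed
      have op: "green_op (?l (upd w j s)) (j # js) a = green_op (?l w) (j # js) a" for s
        by (rule green_op_cong) (rule lw)
      have pt: "(mix (j # js) (upd w j s) m, p) = (mix js w m, p) + (s - m $ j) *\<^sub>R dir_q j" for s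
        using adm(2) by (auto simp: mix_def upd_nth vec_eq_iff axis_def)
      have sg: "smooth ?g" by (rule smooth_green_op[OF a])
      define H where "H s = green (?l w j) s *\<^sub>R green_op (?l w) (j # js) a ((mix js w m, p) + s *\<^sub>R dir_q j)" for s
      have cont: "continuous_on UNIV H"
        unfolding H_def green_def
        by (intro continuous_intros continuous_on_compose2[OF smooth_continuous[OF smooth_green_op[OF a], of UNIV]]) auto
      have "(\<integral>s. ?F (j # js) (upd w j s) \<partial>lborel) = (\<integral>s. ?\<Pi> *\<^sub>R H (s + - (m $ j)) \<partial>lborel)"
        unfolding box op pt H_def by simp
      also have "\<dots> = ?\<Pi> *\<^sub>R (\<integral>s. H s \<partial>lborel)"
        using integral_translate[of H "- (m $ j)"] borel_measurable_continuous_onI[OF cont]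
        by (simp only: integral_scaleR_right)
      also have "(\<integral>s. H s \<partial>lborel) = ?g (mix js w m, p)"
      proof -
        have supp: "?g z = 0" if "norm z > R" for z by (rule green_op_support[OF R that])
        have "0 < ?l w j" by (rule less_le_trans[OF zero_less_one scale_vec_pos[OF f]])
        from green_representation[OF sg supp dir_Basis(1)[of j] this, where x = "(mix js w m, p)"]
        show ?thesis by (simp add: H_def)
      qed
      finally show ?thesis .
    qed
    have "(\<integral>z. ?F (j # js) z \<partial>lborel) = (\<integral>w. indicat_real {0..1} (w $ j) *\<^sub>R (\<integral>s. ?F (j # js) (upd w j s) \<partial>lborel) \<partial>lborel)"
      by (rule integral_upd[OF int[OF Cons.prems], symmetric])
    also have "\<dots> = (\<integral>w. ?F js w \<partial>lborel)"
    proof (rule Bochner_Integration.integral_cong)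
      fix w :: "(real, 'n) vec"
      have "green_box f js m w = indicator {0..1} (w $ j) *
        (\<Prod>i\<in>UNIV - {j}. if i \<in> set js then green (?l w i) (w $ i - m $ i) else indicator {0..1} (w $ i))"
        unfolding green_box_def using adm(2) by (subst prod.remove[of _ j]) auto
      then show "indicat_real {0..1} (w $ j) *\<^sub>R (\<integral>s. ?F (j # js) (upd w j s) \<partial>lborel) = ?F js w"
        unfolding inner by simp
    qed simp
    also have "\<dots> = a (m, p)" by (rule Cons.IH[OF adm(1)])
    finally show ?case .
  qed
qed

section \<open>Windowed Fourier transforms\<close>

text \<open>Square integrable in \<open>x\<close>, with a reciprocal that is a polynomial of degree one in each \<open>x $ j\<close>;
  the latter is what lets the windows be split off the kernel.\<close>

definition window :: "(real \<Rightarrow> real) \<Rightarrow> (real, 'n::{finite,linorder}) vec \<Rightarrow> (real, 'n) vec \<Rightarrow> complex"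
  where "window f z x = (\<Prod>j\<in>UNIV. 1 / (1 + \<i> * of_real (scale_vec f (z $ r_idx) j * (x $ j - z $ j))))"

definition window_sq :: "(real \<Rightarrow> real) \<Rightarrow> (real, 'n::{finite,linorder}) vec \<Rightarrow> (real, 'n) vec \<Rightarrow> real"
  where "window_sq f z x = (\<Prod>j\<in>UNIV. 1 / (1 + (scale_vec f (z $ r_idx) j * (x $ j - z $ j))\<^sup>2))"

text \<open>The Jacobian of the rescaling by the scales at \<open>z\<close>.\<close>

definition scale_det :: "(real \<Rightarrow> real) \<Rightarrow> (real, 'n::{finite,linorder}) vec \<Rightarrow> real"
  where "scale_det f z = (\<Prod>j\<in>(UNIV :: 'n set). scale_vec f (z $ r_idx) j)"

lemma cmod_one_plus_i: "(cmod (1 + \<i> * of_real t))\<^sup>2 = 1 + t\<^sup>2"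
  by (simp add: cmod_power2)

lemma window_norm_sq:
  "(norm (window f z x))\<^sup>2 = window_sq f z x"
  unfolding window_def window_sq_def prod_norm[symmetric] prod_power_distrib
  by (intro prod.cong refl) (simp only: norm_divide power_divide cmod_one_plus_i norm_one power_one)

lemma window_sq_bounds: "0 < window_sq f z x" "window_sq f z x \<le> 1"
  unfolding window_sq_def
  by (intro prod_pos) (auto simp: add_pos_nonneg, intro prod_le_1, auto simp: add_pos_nonneg)

lemma window_norm_le: "norm (window f z x) \<le> 1"
  using window_norm_sq[of f z x] window_sq_bounds(2)[of f z x]
  by (metis norm_ge_zero abs_of_nonneg power2_le_iff_abs_le power_one one_power2 zero_le_one)

lemma window_measurable [measurable]:
  fixes g h :: "'x \<Rightarrow> (real, 'n::{finite,linorder}) vec"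
  assumes [measurable]: "f \<in> borel_measurable borel" "g \<in> M \<rightarrow>\<^sub>M borel" "h \<in> M \<rightarrow>\<^sub>M borel"
  shows "(\<lambda>x. window f (g x) (h x)) \<in> borel_measurable M"
    "(\<lambda>x. window_sq f (g x) (h x)) \<in> borel_measurable M"
    "(\<lambda>x. scale_det f (g x)) \<in> borel_measurable M"
  unfolding window_def window_sq_def scale_det_def scale_vec_def by measurable

lemma scale_det_pos: "(\<And>r. 1 \<le> f r) \<Longrightarrow> 0 < scale_det f z"
  unfolding scale_det_def by (intro prod_pos) (auto intro: less_le_trans[OF zero_less_one scale_vec_pos])

text \<open>After rescaling, each coordinate contributes the integral \<open>pi\<close> of \<open>1 / (1 + s\<^sup>2)\<close>. The
  integration runs over the centre \<open>z\<close>, so the scales vary with the integration variable.\<close>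

lemma nn_integral_window_sq:
  fixes x :: "(real, 'n::{finite,linorder}) vec"
  assumes [measurable]: "f \<in> borel_measurable borel" and f: "\<And>r. 1 \<le> f r"
  shows "(\<integral>\<^sup>+z. ennreal (scale_det f z * window_sq f z x) \<partial>lborel) = ennreal (pi ^ CARD('n))"
proof -
  obtain js :: "'n list" where js: "admissible_order js" "set js = UNIV" using admissible_order_exists by blast
  let ?\<phi> = "\<lambda>s::real. ennreal (1 / pi * (1 / (1 + s\<^sup>2)))"
  have \<phi>: "(\<integral>\<^sup>+s. ?\<phi> s \<partial>lborel) = 1"
  proof -
    have "(\<integral>\<^sup>+s. ?\<phi> s \<partial>lborel) = (\<integral>\<^sup>+s. ennreal (1 / pi) * ennreal (1 / (1 + s\<^sup>2)) \<partial>lborel)"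
      by (intro nn_integral_cong ennreal_mult) (auto intro: add_nonneg_nonneg)
    also have "\<dots> = ennreal (1 / pi) * ennreal pi"
      by (subst nn_integral_cmult) (auto simp: nn_integral_cauchy)
    also have "\<dots> = ennreal (1 / pi * pi)" by (rule ennreal_mult[symmetric]) auto
    finally show ?thesis by simp
  qed
  have eq: "ennreal (scale_det f z * window_sq f z x) = ennreal (pi ^ CARD('n)) *
    (\<Prod>i\<in>UNIV. if i \<in> set js then ennreal (scale_vec f (z $ r_idx) i) * ?\<phi> (scale_vec f (z $ r_idx) i * (z $ i - x $ i)) else indicator {0..1} (z $ i))" for z
  proof -
    have l: "0 \<le> scale_vec f (z $ r_idx) i" for i by (rule order_trans[OF zero_le_one scale_vec_pos[OF f]])
    have sq: "(scale_vec f (z $ r_idx) i * (z $ i - x $ i))\<^sup>2 = (scale_vec f (z $ r_idx) i * (x $ i - z $ i))\<^sup>2" for i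
      by (simp add: power_mult_distrib power2_commute)
    let ?h = "\<lambda>i. 1 / pi * (1 / (1 + (scale_vec f (z $ r_idx) i * (x $ i - z $ i))\<^sup>2))"
    have h: "0 \<le> ?h i" for i by (intro mult_nonneg_nonneg) (auto intro: add_nonneg_nonneg)
    have "scale_det f z * window_sq f z x = pi ^ CARD('n) * (\<Prod>i\<in>UNIV. scale_vec f (z $ r_idx) i * ?h i)"
      unfolding scale_det_def window_sq_def prod.distrib by (simp add: power_one_over)
    then have "ennreal (scale_det f z * window_sq f z x) = ennreal (pi ^ CARD('n)) * ennreal (\<Prod>i\<in>UNIV. scale_vec f (z $ r_idx) i * ?h i)"
      using l h by (simp only:) (intro ennreal_mult prod_nonneg mult_nonneg_nonneg, auto)
    also have "ennreal (\<Prod>i\<in>UNIV. scale_vec f (z $ r_idx) i * ?h i) = (\<Prod>i\<in>UNIV. ennreal (scale_vec f (z $ r_idx) i * ?h i))"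
      by (rule prod_ennreal[symmetric]) (intro mult_nonneg_nonneg l h)
    also have "\<dots> = (\<Prod>i\<in>UNIV. ennreal (scale_vec f (z $ r_idx) i) * ?\<phi> (scale_vec f (z $ r_idx) i * (z $ i - x $ i)))"
      unfolding sq by (intro prod.cong refl ennreal_mult l h)
    finally show ?thesis using js(2) by simp
  qed
  have "(\<integral>\<^sup>+z. ennreal (scale_det f z * window_sq f z x) \<partial>lborel) = ennreal (pi ^ CARD('n)) * 1"
    unfolding eq
    by (subst nn_integral_cmult, measurable) (subst nn_integral_scaled_box[OF _ _ \<phi> f js(1)], auto)
  then show ?thesis by simp
qed

definition window_transform :: "(real \<Rightarrow> real) \<Rightarrow> ((real, 'n::{finite,linorder}) vec \<Rightarrow> complex) \<Rightarrow> (real, 'n) vec \<Rightarrow> (real, 'n) vec \<Rightarrow> complex"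
  where "window_transform f u z \<xi> = (\<integral>x. exp (\<i> * of_real (x \<bullet> \<xi>)) * (u x * window f z x) \<partial>lborel)"

lemma window_transform_measurable [measurable]:
  fixes g h :: "'x \<Rightarrow> (real, 'n::{finite,linorder}) vec"
  assumes [measurable]: "f \<in> borel_measurable borel" "u \<in> borel_measurable borel" "g \<in> M \<rightarrow>\<^sub>M borel" "h \<in> M \<rightarrow>\<^sub>M borel"
  shows "(\<lambda>x. window_transform f u (g x) (h x)) \<in> borel_measurable M"
  unfolding window_transform_def by measurable

text \<open>The family of windows resolves the identity: this is the orthogonality relation (Moyal identity) of the
  short-time Fourier transform, here only as an inequality, with a window whose width in the
  directions other than \<open>r\<close> is adapted to its centre.\<close>

lemma window_transform_L2:
  fixes u :: "(real, 'n::{finite,linorder}) vec \<Rightarrow> complex"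
  assumes f_meas [measurable]: "f \<in> borel_measurable borel" and f: "\<And>r. 1 \<le> f r"
    and u: "integrable lborel u" and u2: "integrable lborel (\<lambda>x. (norm (u x))\<^sup>2)"
  shows "(\<integral>\<^sup>+z. ennreal (scale_det f z) * (\<integral>\<^sup>+\<xi>. ennreal ((norm (window_transform f u z \<xi>))\<^sup>2) \<partial>lborel) \<partial>lborel)
    \<le> ennreal ((2 * pi) ^ CARD('n) * pi ^ CARD('n) * (\<integral>x. (norm (u x))\<^sup>2 \<partial>lborel))"
proof -
  have [measurable]: "u \<in> borel_measurable borel" using u by auto
  have b: "(\<integral>\<^sup>+\<xi>. ennreal ((norm (window_transform f u z \<xi>))\<^sup>2) \<partial>lborel)
     \<le> ennreal ((2 * pi) ^ CARD('n)) * (\<integral>\<^sup>+x. ennreal ((norm (u x))\<^sup>2 * window_sq f z x) \<partial>lborel)" for z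
  proof -
    have i1: "integrable lborel (\<lambda>x. u x * window f z x)"
      by (rule Bochner_Integration.integrable_bound[OF u])
        (auto simp: norm_mult intro!: AE_I2 mult_right_le_one_le window_norm_le)
    have sq: "(norm (u x * window f z x))\<^sup>2 = (norm (u x))\<^sup>2 * window_sq f z x" for x
      by (simp add: norm_mult power_mult_distrib window_norm_sq)
    have i2: "integrable lborel (\<lambda>x. (norm (u x * window f z x))\<^sup>2)"
      unfolding sq
      by (rule Bochner_Integration.integrable_bound[OF u2])
        (auto simp: abs_mult less_imp_le[OF window_sq_bounds(1)] intro!: AE_I2 mult_right_le_one_le window_sq_bounds(2))
    have "(\<integral>\<^sup>+\<xi>. ennreal ((norm (window_transform f u z \<xi>))\<^sup>2) \<partial>lborel) \<le> ennreal ((2 * pi) ^ CARD('n) * (\<integral>x. (norm (u x * window f z x))\<^sup>2 \<partial>lborel))"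
      using bessel[OF i1 i2] by (simp add: window_transform_def)
    also have "\<dots> = ennreal ((2 * pi) ^ CARD('n)) * ennreal (\<integral>x. (norm (u x * window f z x))\<^sup>2 \<partial>lborel)"
      by (intro ennreal_mult) auto
    also have "ennreal (\<integral>x. (norm (u x * window f z x))\<^sup>2 \<partial>lborel) = (\<integral>\<^sup>+x. ennreal ((norm (u x))\<^sup>2 * window_sq f z x) \<partial>lborel)"
      using nn_integral_eq_integral[OF i2] by (simp only: sq[symmetric]) simp
    finally show ?thesis .
  qed
  have "(\<integral>\<^sup>+z. ennreal (scale_det f z) * (\<integral>\<^sup>+\<xi>. ennreal ((norm (window_transform f u z \<xi>))\<^sup>2) \<partial>lborel) \<partial>lborel)
    \<le> (\<integral>\<^sup>+z. ennreal (scale_det f z) * (ennreal ((2 * pi) ^ CARD('n)) * (\<integral>\<^sup>+x. ennreal ((norm (u x))\<^sup>2 * window_sq f z x) \<partial>lborel)) \<partial>lborel)"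
    by (intro nn_integral_mono mult_left_mono b) auto
  also have "\<dots> = ennreal ((2 * pi) ^ CARD('n)) * (\<integral>\<^sup>+z. \<integral>\<^sup>+x. ennreal ((norm (u x))\<^sup>2) * ennreal (scale_det f z * window_sq f z x) \<partial>lborel \<partial>lborel)"
  proof -
    have "ennreal (scale_det f z) * (ennreal ((2 * pi) ^ CARD('n)) * (\<integral>\<^sup>+x. ennreal ((norm (u x))\<^sup>2 * window_sq f z x) \<partial>lborel)) =
       ennreal ((2 * pi) ^ CARD('n)) * (\<integral>\<^sup>+x. ennreal ((norm (u x))\<^sup>2) * ennreal (scale_det f z * window_sq f z x) \<partial>lborel)" for z
    proof -
      have "(\<integral>\<^sup>+x. ennreal ((norm (u x))\<^sup>2) * ennreal (scale_det f z * window_sq f z x) \<partial>lborel) =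
        (\<integral>\<^sup>+x. ennreal (scale_det f z) * ennreal ((norm (u x))\<^sup>2 * window_sq f z x) \<partial>lborel)"
        using scale_det_pos[OF f, where z = z] window_sq_bounds(1)[of f z]
        by (intro nn_integral_cong) (simp add: ennreal_mult[symmetric] less_imp_le mult_ac)
      also have "\<dots> = ennreal (scale_det f z) * (\<integral>\<^sup>+x. ennreal ((norm (u x))\<^sup>2 * window_sq f z x) \<partial>lborel)"
        by (rule nn_integral_cmult) measurable
      finally show ?thesis by (simp only: mult_ac)
    qed
    then show ?thesis by (simp only:) (rule nn_integral_cmult, measurable)
  qed
  also have "(\<integral>\<^sup>+z. \<integral>\<^sup>+x. ennreal ((norm (u x))\<^sup>2) * ennreal (scale_det f z * window_sq f z x) \<partial>lborel \<partial>lborel)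
    = (\<integral>\<^sup>+x. \<integral>\<^sup>+z. ennreal ((norm (u x))\<^sup>2) * ennreal (scale_det f z * window_sq f z x) \<partial>lborel \<partial>lborel)"
    by (rule lborel_pair.Fubini') measurable
  also have "\<dots> = (\<integral>\<^sup>+x. ennreal ((norm (u x))\<^sup>2) * ennreal (pi ^ CARD('n)) \<partial>lborel)"
    by (intro nn_integral_cong, subst nn_integral_cmult, measurable) (simp only: nn_integral_window_sq[OF f_meas f])
  also have "\<dots> = ennreal (\<integral>x. (norm (u x))\<^sup>2 \<partial>lborel) * ennreal (pi ^ CARD('n))"
    using nn_integral_eq_integral[OF u2] by (subst nn_integral_multc) auto
  also have "ennreal ((2 * pi) ^ CARD('n)) * \<dots> = ennreal ((2 * pi) ^ CARD('n) * pi ^ CARD('n) * (\<integral>x. (norm (u x))\<^sup>2 \<partial>lborel))"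
    by (simp add: ennreal_mult[symmetric] mult_ac)
  finally show ?thesis .
qed

section \<open>Integration by parts in the dual variable\<close>

lemma smooth_slice:
  assumes "smooth (a :: 'n::finite phase \<Rightarrow> complex)"
  shows "smooth (\<lambda>p. a (q, p))"
proof -
  have "smooth (\<lambda>p. a ((q, 0) + (0, p)))"
    by (rule smooth_affine[where c = "\<lambda>_. 1" and \<sigma> = "\<lambda>b. (0, b)", OF _ _ _ assms])
      (auto simp: Basis_prod_def intro: bounded_linear_Pair bounded_linear_zero bounded_linear_ident)
  then show ?thesis by simp
qed

lemma partial_slice: "partial b (\<lambda>p. a (q, p)) p = partial (0, b) a (q, p)"
  by (simp add: partial_def)

lemma partials_slice: "partials (map (Pair 0) bs) a (q, p) = partials bs (\<lambda>p. a (q, p)) p"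
proof -
  have "(\<lambda>p. partials (map (Pair 0) bs) a (q, p)) = partials bs (\<lambda>p. a (q, p))"
    by (induction bs) (simp_all add: partial_slice[symmetric] fun_eq_iff[symmetric])
  then show ?thesis by (simp add: fun_eq_iff)
qed

lemma wave_integral_by_parts_list:
  fixes g :: "'a::euclidean_space \<Rightarrow> complex"
  assumes g: "smooth g" and R: "\<And>x. norm x > R \<Longrightarrow> g x = 0" and bs: "set bs \<subseteq> Basis"
  shows "(\<integral>p. exp (\<i> * of_real (p \<bullet> s)) * (\<i> ^ length bs * partials bs g p) \<partial>lborel) =
    of_real (prod_list (map (\<lambda>b. s \<bullet> b) bs)) * (\<integral>p. exp (\<i> * of_real (p \<bullet> s)) * g p \<partial>lborel)"
  using bs
proof (induction bs)
  case (Cons b bs)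
  have B: "b \<in> Basis" "set bs \<subseteq> Basis" using Cons.prems by auto
  define k where "k = partials bs g"
  have k: "smooth k" unfolding k_def by (intro smooth_partials g B)
  have kR: "k p = 0" if "norm p > R" for p
    unfolding k_def by (rule partial_zero_outside[OF R that])
  have "(\<integral>p. exp (\<i> * of_real (p \<bullet> s)) * (\<i> ^ length (b # bs) * partials (b # bs) g p) \<partial>lborel) =
     (\<integral>p. \<i> ^ length bs * (exp (\<i> * of_real (p \<bullet> s)) * (\<i> * partial b k p)) \<partial>lborel)"
    by (intro Bochner_Integration.integral_cong) (auto simp: k_def mult_ac)
  also have "\<dots> = \<i> ^ length bs * (of_real (s \<bullet> b) * (\<integral>p. exp (\<i> * of_real (p \<bullet> s)) * k p \<partial>lborel))"
    by (simp only: integral_mult_right_zero wave_integral_by_parts[OF k kR B(1)])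
  also have "\<dots> = of_real (s \<bullet> b) * (\<integral>p. exp (\<i> * of_real (p \<bullet> s)) * (\<i> ^ length bs * k p) \<partial>lborel)"
    by (subst (2) mult.left_commute, subst integral_mult_right_zero) (simp add: mult_ac)
  also have "\<dots> = of_real (s \<bullet> b) * (of_real (prod_list (map (\<lambda>b. s \<bullet> b) bs)) * (\<integral>p. exp (\<i> * of_real (p \<bullet> s)) * g p \<partial>lborel))"
    unfolding k_def Cons.IH[OF B(2)] ..
  finally show ?case by (simp add: mult.assoc)
qed simp

lemma wave_integral_by_parts_phase:
  fixes a :: "'n::finite phase \<Rightarrow> complex"
  assumes a: "smooth a" and R: "\<And>z. norm z > R \<Longrightarrow> a z = 0"
  shows "(\<integral>p. exp (\<i> * of_real (p \<bullet> s)) * (\<i> ^ length js * partials (map dir_p js) a (z, p)) \<partial>lborel) =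
    of_real (prod_list (map (\<lambda>j. s $ j) js)) * (\<integral>p. exp (\<i> * of_real (p \<bullet> s)) * a (z, p) \<partial>lborel)"
proof -
  let ?bs = "map (\<lambda>j. axis j (1::real)) js"
  have gR: "a (z, p) = 0" if "norm p > R" for p
  proof -
    have "norm (z, p) > R" using that norm_snd_le[of p z] by linarith
    then show ?thesis by (rule R)
  qed
  have "map dir_p js = map (Pair 0) ?bs" by simp
  then have "partials (map dir_p js) a (z, p) = partials ?bs (\<lambda>p. a (z, p)) p" for p
    by (simp only: partials_slice)
  moreover have "map (\<lambda>b. s \<bullet> b) ?bs = map (\<lambda>j. s $ j) js" by (simp add: inner_axis)
  moreover have "(\<integral>p. exp (\<i> * of_real (p \<bullet> s)) * (\<i> ^ length ?bs * partials ?bs (\<lambda>p. a (z, p)) p) \<partial>lborel) =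
    of_real (prod_list (map (\<lambda>b. s \<bullet> b) ?bs)) * (\<integral>p. exp (\<i> * of_real (p \<bullet> s)) * a (z, p) \<partial>lborel)"
    by (rule wave_integral_by_parts_list[where R = R, OF smooth_slice[OF a] gR]) auto
  ultimately show ?thesis by (simp only: length_map)
qed

section \<open>The bilinear estimate for compactly supported symbols\<close>

lemma (in pair_sigma_finite) product_function:
  fixes g :: "'a \<Rightarrow> 'c::{real_normed_field, banach, second_countable_topology}"
  assumes g: "integrable M1 g" and h: "integrable M2 h"
  shows product_function_integrable: "integrable (M1 \<Otimes>\<^sub>M M2) (\<lambda>z. g (fst z) * h (snd z))"
    and product_function_integral: "(\<integral>z. g (fst z) * h (snd z) \<partial>(M1 \<Otimes>\<^sub>M M2)) = (\<integral>x. g x \<partial>M1) * (\<integral>y. h y \<partial>M2)"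
proof -
  have [measurable]: "g \<in> borel_measurable M1" "h \<in> borel_measurable M2" using g h by auto
  show *: "integrable (M1 \<Otimes>\<^sub>M M2) (\<lambda>z. g (fst z) * h (snd z))"
  proof (rule Fubini_integrable)
    show "integrable M1 (\<lambda>x. \<integral>y. norm (g (fst (x, y)) * h (snd (x, y))) \<partial>M2)"
      using g by (simp add: norm_mult)
    show "AE x in M1. integrable M2 (\<lambda>y. g (fst (x, y)) * h (snd (x, y)))"
      using h by (intro AE_I2) simp
  qed measurable
  show "(\<integral>z. g (fst z) * h (snd z) \<partial>(M1 \<Otimes>\<^sub>M M2)) = (\<integral>x. g x \<partial>M1) * (\<integral>y. h y \<partial>M2)"
    using integral_fst'[OF *] by simp
qed

lemma
  fixes h :: "'n::finite \<Rightarrow> real \<Rightarrow> complex"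
  assumes int: "\<And>j. integrable lborel (h j)"
  shows product_vec_integrable: "integrable lborel (\<lambda>x::(real, 'n) vec. \<Prod>j\<in>UNIV. h j (x $ j))"
    and product_vec_integral: "(\<integral>x. (\<Prod>j\<in>UNIV. h j (x $ j)) \<partial>(lborel :: (real, 'n) vec measure)) = (\<Prod>j\<in>UNIV. \<integral>t. h j t \<partial>lborel)"
proof -
  let ?ax = "\<lambda>j::'n. axis j (1::real)"
  have inj: "inj ?ax" by (auto simp: inj_on_def axis_eq_axis)
  have B: "(Basis :: (real, 'n) vec set) = range ?ax" by (auto simp: Basis_vec_def)
  define h' where "h' b = h (inv ?ax b)" for b
  have i: "integrable lborel (h' b)" for b unfolding h'_def by (rule int)
  have eq: "(\<Prod>b\<in>Basis. h' b (x \<bullet> b)) = (\<Prod>j\<in>UNIV. h j (x $ j))" for x :: "(real, 'n) vec"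
    unfolding B by (subst prod.reindex[OF inj]) (simp add: h'_def inv_f_f[OF inj] inner_axis)
  have eq': "(\<Prod>b\<in>(Basis :: (real, 'n) vec set). \<integral>t. h' b t \<partial>lborel) = (\<Prod>j\<in>UNIV. \<integral>t. h j t \<partial>lborel)"
    unfolding B by (subst prod.reindex[OF inj]) (simp add: h'_def inv_f_f[OF inj])
  show "integrable lborel (\<lambda>x::(real, 'n) vec. \<Prod>j\<in>UNIV. h j (x $ j))"
    using integrable_product_function[of h', OF i] unfolding eq .
  show "(\<integral>x. (\<Prod>j\<in>UNIV. h j (x $ j)) \<partial>(lborel :: (real, 'n) vec measure)) = (\<Prod>j\<in>UNIV. \<integral>t. h j t \<partial>lborel)"
    using integral_product_function[of h', OF i] unfolding eq eq' .
qed

lemma nn_integral_reflect: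
  fixes g :: "'a::euclidean_space \<Rightarrow> ennreal"
  assumes [measurable]: "g \<in> borel_measurable borel"
  shows "(\<integral>\<^sup>+x. g (- x) \<partial>lborel) = (\<integral>\<^sup>+x. g x \<partial>lborel)"
proof -
  have "(\<integral>\<^sup>+x. g x \<partial>lborel) = (\<integral>\<^sup>+x. g x \<partial>density (distr lborel borel (\<lambda>x. 0 + (-1) *\<^sub>R x)) (\<lambda>_. ennreal (\<bar>-1\<bar> ^ DIM('a))))"
    by (subst lborel_affine[of "-1" "0::'a"]) auto
  also have "\<dots> = (\<integral>\<^sup>+x. g (- x) \<partial>lborel)"
    by (subst nn_integral_density) (auto simp: nn_integral_distr)
  finally show ?thesis ..
qed

lemma integrable_indicator_cball: "integrable lborel (indicat_real (cball (0::'a::euclidean_space) R))"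
proof (rule integrable_bounded_support)
  show "norm (indicat_real (cball (0::'a) R) x) \<le> 1" for x by (simp add: indicator_def)
  show "indicat_real (cball (0::'a) R) x = 0" if "norm x > R" for x using that by simp
qed (intro borel_measurable_indicator, simp)

text \<open>A fixed choice of densities, so that their masses depend on nothing but the exponents.\<close>

definition wave_density :: "nat \<Rightarrow> real \<Rightarrow> complex"
  where "wave_density = (SOME \<gamma>. (\<forall>k\<le>2. integrable lborel (\<gamma> k)) \<and>
    (\<forall>k\<le>2. \<forall>x. (\<integral>t. \<gamma> k t * exp (\<i> * of_real (t * x)) \<partial>lborel) = (1 + \<i> * of_real x) ^ (2 - k) * of_real (exp (- \<bar>x\<bar>) / 2)))"

lemma wave_density:
  assumes "k \<le> 2"
  shows wave_density_integrable: "integrable lborel (wave_density k)"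
    and wave_density_integral: "(\<integral>t. wave_density k t * exp (\<i> * of_real (t * x)) \<partial>lborel) =
      (1 + \<i> * of_real x) ^ (2 - k) * of_real (exp (- \<bar>x\<bar>) / 2)"
  using someI_ex[OF exp_kernel_waves, folded wave_density_def] assms by blast+

text \<open>The coefficients of the quadratic polynomial in \<open>green_split\<close>; they are bounded by \<open>1\<close> for all
  \<open>t\<close> between \<open>0\<close> and \<open>1\<close>, which makes the final bound uniform in \<open>t\<close>.\<close>

definition split_coeff :: "real \<Rightarrow> nat \<Rightarrow> complex"
  where "split_coeff t k = (if k = 0 then 1 else if k = 1 then \<i> * of_real (1 - 2 * t) else of_real (t * (1 - t)))"

lemma split_coeff_norm: "t \<in> {0..1} \<Longrightarrow> norm (split_coeff t k) \<le> 1"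
proof -
  assume t: "t \<in> {0..1}"
  have "norm (\<i> * complex_of_real (1 - 2 * t)) \<le> 1" using t by (simp only: norm_mult norm_ii norm_of_real) auto
  moreover have "norm (complex_of_real (t * (1 - t))) \<le> 1"
    using t by (simp only: norm_of_real) (auto simp: abs_mult intro!: mult_le_one)
  ultimately show ?thesis by (auto simp: split_coeff_def)
qed

definition multi_exponents :: "('n::finite \<Rightarrow> nat) set"
  where "multi_exponents = PiE UNIV (\<lambda>_. {..2})"

lemma multi_exponents_le: "\<kappa> \<in> multi_exponents \<Longrightarrow> \<kappa> j \<le> 2"
  by (auto simp: multi_exponents_def PiE_def)

text \<open>With \<open>X = l (m - z)\<close> and \<open>S = l (x - y)\<close>, where \<open>m = t x + (1 - t) y\<close>, one has
  \<open>l (x - z) = X + (1 - t) S\<close> and \<open>l (y - z) = X - t S\<close>. Multiplying and dividing by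
  \<open>(1 + \<i> l (x - z)) (1 + \<i> l (y - z))\<close> therefore produces a window in \<open>x\<close>, a window in \<open>y\<close>, and a quadratic
  polynomial in \<open>S\<close> whose powers of \<open>S\<close> turn into derivatives in \<open>p\<close>.\<close>

lemma green_split:
  assumes l: "0 \<le> l" and m: "m = t * x + (1 - t) * y"
  shows "complex_of_real (green l (z - m)) =
    (\<Sum>k\<le>2. of_real l * split_coeff t k * ((1 + \<i> * of_real (l * (m - z))) ^ (2 - k) * of_real (exp (- \<bar>l * (m - z)\<bar>) / 2)) * of_real (l * (x - y)) ^ k)
     * (1 / (1 + \<i> * of_real (l * (x - z))) * (1 / (1 + \<i> * of_real (l * (y - z)))))"
proof -
  define X S where "X = l * (m - z)" and "S = l * (x - y)"
  define E where "E = complex_of_real (exp (- \<bar>X\<bar>) / 2)"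
  have x: "l * (x - z) = X + (1 - t) * S" and y: "l * (y - z) = X - t * S"
    by (simp_all add: X_def S_def m algebra_simps)
  have g: "complex_of_real (green l (z - m)) = of_real l * E"
  proof -
    have "\<bar>X\<bar> = l * \<bar>z - m\<bar>" using l by (simp add: X_def abs_mult abs_minus_commute)
    then show ?thesis by (simp add: green_def E_def)
  qed
  have nz: "1 + \<i> * complex_of_real r \<noteq> 0" for r by (rule one_i_nonzero)
  have "(\<Sum>k\<le>2. of_real l * split_coeff t k * ((1 + \<i> * of_real X) ^ (2 - k) * E) * of_real S ^ k) =
    of_real l * E * ((1 + \<i> * of_real X)\<^sup>2 + \<i> * of_real (1 - 2 * t) * (1 + \<i> * of_real X) * of_real S + of_real (t * (1 - t)) * (of_real S)\<^sup>2)"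
    by (simp add: numeral_2_eq_2 split_coeff_def algebra_simps)
  also have "(1 + \<i> * of_real X)\<^sup>2 + \<i> * of_real (1 - 2 * t) * (1 + \<i> * of_real X) * of_real S + of_real (t * (1 - t)) * (of_real S)\<^sup>2 =
     (1 + \<i> * of_real (X + (1 - t) * S)) * (1 + \<i> * complex_of_real (X - t * S))"
    by (simp add: complex_eq_iff power2_eq_square algebra_simps)
  finally have sum: "(\<Sum>k\<le>2. of_real l * split_coeff t k * ((1 + \<i> * of_real X) ^ (2 - k) * E) * of_real S ^ k) =
    of_real l * E * ((1 + \<i> * of_real (X + (1 - t) * S)) * (1 + \<i> * complex_of_real (X - t * S)))" .
  have cancel: "s * (1 / q * (1 / r)) = L" if "s = L * (q * r)" "q \<noteq> 0" "r \<noteq> 0" for s L q r :: complex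
    using that by simp
  have "(\<Sum>k\<le>2. of_real l * split_coeff t k * ((1 + \<i> * of_real X) ^ (2 - k) * E) * of_real S ^ k)
     * (1 / (1 + \<i> * of_real (X + (1 - t) * S)) * (1 / (1 + \<i> * complex_of_real (X - t * S)))) = of_real l * E"
    by (rule cancel[OF sum nz nz])
  then show ?thesis unfolding g x y X_def[symmetric] S_def[symmetric] E_def[symmetric] by (rule sym)
qed

definition wave_box :: "(real \<Rightarrow> real) \<Rightarrow> ('n::{finite,linorder} \<Rightarrow> nat) \<Rightarrow> (real, 'n) vec \<Rightarrow> (real, 'n) vec \<Rightarrow> complex"
  where "wave_box f \<kappa> m z = (\<Prod>j\<in>UNIV. (1 + \<i> * of_real (scale_vec f (z $ r_idx) j * (m $ j - z $ j))) ^ (2 - \<kappa> j) *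
    of_real (exp (- \<bar>scale_vec f (z $ r_idx) j * (m $ j - z $ j)\<bar>) / 2))"

lemma green_box_split:
  fixes x y z :: "(real, 'n::{finite,linorder}) vec"
  assumes f: "\<And>r. 1 \<le> f r" and js: "set js = UNIV"
  shows "complex_of_real (green_box f js (t *\<^sub>R x + (1 - t) *\<^sub>R y) z) =
    (\<Sum>\<kappa>\<in>multi_exponents. (\<Prod>j\<in>UNIV. split_coeff t (\<kappa> j)) *
       (of_real (scale_det f z) * wave_box f \<kappa> (t *\<^sub>R x + (1 - t) *\<^sub>R y) z * (window f z x * window f z y)) *
       (\<Prod>j\<in>UNIV. of_real (scale_vec f (z $ r_idx) j * (x $ j - y $ j)) ^ \<kappa> j))"
proof -
  let ?m = "t *\<^sub>R x + (1 - t) *\<^sub>R y" and ?l = "\<lambda>j. scale_vec f (z $ r_idx) j"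
  let ?A = "\<lambda>j k. of_real (?l j) * split_coeff t k * ((1 + \<i> * of_real (?l j * (?m $ j - z $ j))) ^ (2 - k) * of_real (exp (- \<bar>?l j * (?m $ j - z $ j)\<bar>) / 2)) * of_real (?l j * (x $ j - y $ j)) ^ k"
  let ?B = "\<lambda>j. 1 / (1 + \<i> * complex_of_real (?l j * (x $ j - z $ j))) * (1 / (1 + \<i> * of_real (?l j * (y $ j - z $ j))))"
  have "complex_of_real (green_box f js ?m z) = (\<Prod>j\<in>UNIV. complex_of_real (green (?l j) (z $ j - ?m $ j)))"
    by (simp add: green_box_def js)
  also have "\<dots> = (\<Prod>j\<in>UNIV. (\<Sum>k\<le>2. ?A j k) * ?B j)"
    by (intro prod.cong refl green_split order_trans[OF zero_le_one scale_vec_pos[OF f]]) simp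
  also have "\<dots> = (\<Prod>j\<in>UNIV. \<Sum>k\<in>{..2}. ?A j k) * (\<Prod>j\<in>UNIV. ?B j)"
    by (simp only: prod.distrib)
  also have "(\<Prod>j\<in>UNIV. \<Sum>k\<in>{..2}. ?A j k) = (\<Sum>\<kappa>\<in>multi_exponents. \<Prod>j\<in>UNIV. ?A j (\<kappa> j))"
    unfolding multi_exponents_def by (rule prod_sum_PiE) auto
  also have "\<dots> * (\<Prod>j\<in>UNIV. ?B j) = (\<Sum>\<kappa>\<in>multi_exponents. (\<Prod>j\<in>UNIV. ?A j (\<kappa> j)) * (\<Prod>j\<in>UNIV. ?B j))"
    by (rule sum_distrib_right)
  also have "\<dots> = (\<Sum>\<kappa>\<in>multi_exponents. (\<Prod>j\<in>UNIV. split_coeff t (\<kappa> j)) *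
       (of_real (scale_det f z) * wave_box f \<kappa> ?m z * (window f z x * window f z y)) *
       (\<Prod>j\<in>UNIV. of_real (?l j * (x $ j - y $ j)) ^ \<kappa> j))"
    by (intro sum.cong refl) (simp only: scale_det_def wave_box_def window_def prod.distrib of_real_prod mult_ac)
  finally show ?thesis .
qed

text \<open>A monomial in commuting variables spelled as a word, to match lists of derivatives.\<close>

definition exponent_word :: "'n list \<Rightarrow> ('n \<Rightarrow> nat) \<Rightarrow> 'n list"
  where "exponent_word js \<kappa> = concat (map (\<lambda>j. replicate (\<kappa> j) j) js)"

lemma prod_list_exponent_word:
  fixes g :: "'n::finite \<Rightarrow> 'a::comm_monoid_mult"
  assumes "distinct js" "set js = UNIV"
  shows "prod_list (map g (exponent_word js \<kappa>)) = (\<Prod>j\<in>UNIV. g j ^ \<kappa> j)"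
proof -
  have "prod_list (map g (exponent_word js \<kappa>)) = prod_list (map (\<lambda>j. g j ^ \<kappa> j) js)"
    unfolding exponent_word_def by (induction js) (auto simp: prod_list_replicate)
  also have "\<dots> = (\<Prod>j\<in>UNIV. g j ^ \<kappa> j)"
    using prod.distinct_set_conv_list[OF assms(1), of "\<lambda>j. g j ^ \<kappa> j"] assms(2) by simp
  finally show ?thesis .
qed

lemma length_exponent_word:
  assumes "distinct js" "set js = UNIV" "\<kappa> \<in> multi_exponents"
  shows "length (exponent_word js \<kappa>) \<le> 2 * CARD('n::finite)" and "length (js :: 'n list) = CARD('n)"
proof -
  show l: "length js = CARD('n)" using distinct_card[OF assms(1)] assms(2) by simp
  have "length (exponent_word js \<kappa>) \<le> 2 * length js"
    unfolding exponent_word_def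
  proof (induction js)
    case (Cons j js)
    then show ?case using multi_exponents_le[OF assms(3), of j] by simp
  qed simp
  then show "length (exponent_word js \<kappa>) \<le> 2 * CARD('n)" by (simp add: l)
qed

text \<open>The symbol that remains after the factors \<open>(l (x - y))^\<kappa>\<close> have been integrated by parts: the derivatives
  in \<open>p\<close> together with the scales \<open>l^\<kappa>\<close> that they compensate.\<close>

definition dual_symbol :: "(real \<Rightarrow> real) \<Rightarrow> 'n::{finite,linorder} list \<Rightarrow> ('n phase \<Rightarrow> complex) \<Rightarrow> ('n \<Rightarrow> nat) \<Rightarrow> (real, 'n) vec \<Rightarrow> (real, 'n) vec \<Rightarrow> complex"
  where "dual_symbol f js a \<kappa> z p = of_real (\<Prod>j\<in>UNIV. scale_vec f (z $ r_idx) j ^ \<kappa> j) *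
    (\<i> ^ length (exponent_word js \<kappa>) * partials (map dir_p (exponent_word js \<kappa>)) (green_op (scale_vec f (z $ r_idx)) js a) (z, p))"

definition density_prod :: "('n::finite \<Rightarrow> nat) \<Rightarrow> (real, 'n) vec \<Rightarrow> complex"
  where "density_prod \<kappa> \<tau> = (\<Prod>j\<in>UNIV. wave_density (\<kappa> j) (\<tau> $ j))"

definition term_mass :: "('n::finite \<Rightarrow> nat) \<Rightarrow> real"
  where "term_mass \<kappa> = (\<integral>\<tau>. norm (density_prod \<kappa> \<tau>) \<partial>lborel)"

lemma density_prod_integrable:
  assumes "\<kappa> \<in> multi_exponents"
  shows "integrable lborel (density_prod \<kappa>)"
  unfolding density_prod_def[abs_def]
  by (rule product_vec_integrable) (rule wave_density_integrable[OF multi_exponents_le[OF assms]])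

lemma term_mass_nonneg: "0 \<le> term_mass \<kappa>"
  by (simp add: term_mass_def)

context
  fixes f :: "real \<Rightarrow> real" and js :: "'n::{finite,linorder} list" and a :: "'n phase \<Rightarrow> complex" and R B :: real
  assumes f_meas [measurable]: "f \<in> borel_measurable borel" and f: "\<And>r. 1 \<le> f r"
    and js: "admissible_order js" "set js = UNIV"
    and a: "smooth a" and R: "\<And>z. norm z > R \<Longrightarrow> a z = 0"
    and B: "\<And>z. jet_bound (4 * CARD('n)) (phase_weight (scale_vec f (fst z $ r_idx))) z B a"
begin

lemma distinct_js: "distinct js" using js by (simp add: admissible_order_def)

lemma dual_symbol_support: "norm p > R \<Longrightarrow> dual_symbol f js a \<kappa> z p = 0"
proof -
  assume "norm p > R"
  then have n: "norm (z, p) > R" using norm_snd_le[of p z] by linarith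
  have "green_op (scale_vec f (z $ r_idx)) js a w = 0" if "norm w > R" for w
    by (rule green_op_support[OF R that])
  from partial_zero_outside[OF this n] show ?thesis by (simp add: dual_symbol_def)
qed

lemma dual_symbol_measurable [measurable]:
  assumes [measurable]: "g \<in> M \<rightarrow>\<^sub>M borel" "h \<in> M \<rightarrow>\<^sub>M borel"
  shows "(\<lambda>x. dual_symbol f js a \<kappa> (g x) (h x)) \<in> borel_measurable M"
proof -
  have 1 [measurable]: "(\<lambda>x. partials (map dir_p (exponent_word js \<kappa>)) (green_op (scale_vec f (g x $ r_idx)) js a) (g x, h x)) \<in> borel_measurable M"
    by (rule measurable_green_op[OF a]) (auto simp: borel_prod[symmetric] scale_vec_def)
  show ?thesis unfolding dual_symbol_def scale_vec_def
    by (intro borel_measurable_times borel_measurable_of_real borel_measurable_prod borel_measurable_power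
       1[unfolded scale_vec_def] borel_measurable_const) measurable
qed

text \<open>This is where the number \<open>4 * CARD('n)\<close> of derivatives is spent: two in each \<open>q $ j\<close> for the Green
  operator and at most two in each \<open>p $ j\<close>, the latter with weights that cancel the scales in front.\<close>

lemma dual_symbol_bound:
  assumes \<kappa>: "\<kappa> \<in> multi_exponents"
  shows "norm (dual_symbol f js a \<kappa> z p) \<le> 2 ^ CARD('n) * B"
proof -
  let ?l = "scale_vec f (z $ r_idx)"
  let ?W = "phase_weight ?l"
  have lpos: "0 < ?l j" for j by (rule less_le_trans[OF zero_less_one scale_vec_pos[OF f]])
  have W: "0 \<le> ?W b" if "b \<in> Basis" for b
    using that lpos by (cases rule: Basis_phase_cases) (auto simp: phase_weight_q phase_weight_p less_imp_le[OF lpos])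
  have len: "length js = CARD('n)" "length (exponent_word js \<kappa>) \<le> 2 * CARD('n)"
    using length_exponent_word[OF distinct_js js(2) \<kappa>] by auto
  have B': "jet_bound (2 * CARD('n) + 2 * length js) ?W (z, p) B a"
    using B[of "(z, p)"] by (simp add: len)
  have "jet_bound (2 * CARD('n)) ?W (z, p) (2 ^ length js * B) (green_op ?l js a)"
    by (rule jet_bound_green_op[OF a B' W]) (auto simp: lpos phase_weight_q)
  from jet_boundD[OF this, of "map dir_p (exponent_word js \<kappa>)"]
  have "norm (partials (map dir_p (exponent_word js \<kappa>)) (green_op ?l js a) (z, p)) \<le>
      2 ^ CARD('n) * B * prod_list (map ?W (map dir_p (exponent_word js \<kappa>)))"
    using len by (auto simp: image_subset_iff)
  also have "prod_list (map ?W (map dir_p (exponent_word js \<kappa>))) = (\<Prod>j\<in>UNIV. inverse (?l j) ^ \<kappa> j)"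
    using prod_list_exponent_word[OF distinct_js js(2), of "\<lambda>j. inverse (?l j)" \<kappa>]
    by (simp add: comp_def phase_weight_p)
  finally have le: "norm (partials (map dir_p (exponent_word js \<kappa>)) (green_op ?l js a) (z, p)) \<le>
      2 ^ CARD('n) * B * (\<Prod>j\<in>UNIV. inverse (?l j) ^ \<kappa> j)" .
  have pos: "0 \<le> (\<Prod>j\<in>UNIV. ?l j ^ \<kappa> j)" by (intro prod_nonneg) (simp add: lpos less_imp_le)
  have "norm (dual_symbol f js a \<kappa> z p) = (\<Prod>j\<in>UNIV. ?l j ^ \<kappa> j) * norm (partials (map dir_p (exponent_word js \<kappa>)) (green_op ?l js a) (z, p))"
    unfolding dual_symbol_def norm_mult norm_power norm_ii norm_of_real abs_of_nonneg[OF pos] by simp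
  also have "\<dots> \<le> (\<Prod>j\<in>UNIV. ?l j ^ \<kappa> j) * (2 ^ CARD('n) * B * (\<Prod>j\<in>UNIV. inverse (?l j) ^ \<kappa> j))"
    by (rule mult_left_mono[OF le pos])
  also have "\<dots> = 2 ^ CARD('n) * B * (\<Prod>j\<in>UNIV. ?l j ^ \<kappa> j * inverse (?l j) ^ \<kappa> j)"
    by (simp only: prod.distrib mult_ac)
  also have "(\<Prod>j\<in>UNIV. ?l j ^ \<kappa> j * inverse (?l j) ^ \<kappa> j) = 1"
  proof (rule prod.neutral, rule ballI)
    fix j :: 'n
    have "?l j \<noteq> 0" using lpos[of j] by linarith
    then show "?l j ^ \<kappa> j * inverse (?l j) ^ \<kappa> j = 1" by (simp add: power_mult_distrib[symmetric])
  qed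
  finally show ?thesis by simp
qed

lemma dual_symbol_by_parts:
  "(\<Prod>j\<in>UNIV. of_real (scale_vec f (z $ r_idx) j * s $ j) ^ \<kappa> j) *
     (\<integral>p. exp (\<i> * of_real (p \<bullet> s)) * green_op (scale_vec f (z $ r_idx)) js a (z, p) \<partial>lborel) =
   (\<integral>p. exp (\<i> * of_real (p \<bullet> s)) * dual_symbol f js a \<kappa> z p \<partial>lborel)"
proof -
  let ?l = "scale_vec f (z $ r_idx)" and ?e = "\<lambda>p. exp (\<i> * complex_of_real (p \<bullet> s))" and ?w = "exponent_word js \<kappa>"
  have g: "smooth (green_op ?l js a)" by (rule smooth_green_op[OF a])
  have gR: "green_op ?l js a w = 0" if "norm w > R" for w by (rule green_op_support[OF R that])
  have "(\<integral>p. ?e p * dual_symbol f js a \<kappa> z p \<partial>lborel) = of_real (\<Prod>j\<in>UNIV. ?l j ^ \<kappa> j) *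
     (\<integral>p. ?e p * (\<i> ^ length ?w * partials (map dir_p ?w) (green_op ?l js a) (z, p)) \<partial>lborel)"
    unfolding dual_symbol_def by (subst integral_mult_right_zero[symmetric]) (simp only: mult_ac)
  also have "\<dots> = of_real (\<Prod>j\<in>UNIV. ?l j ^ \<kappa> j) * (of_real (prod_list (map (\<lambda>j. s $ j) ?w)) * (\<integral>p. ?e p * green_op ?l js a (z, p) \<partial>lborel))"
    by (simp only: wave_integral_by_parts_phase[OF g gR])
  also have "prod_list (map (\<lambda>j. s $ j) ?w) = (\<Prod>j\<in>UNIV. (s $ j) ^ \<kappa> j)"
    by (rule prod_list_exponent_word[OF distinct_js js(2)])
  finally show ?thesis
    by (simp add: prod.distrib power_mult_distrib mult.assoc)
qed

text \<open>The symbol representation is inserted, the integrals over \<open>z\<close> and \<open>p\<close> are exchanged, the kernel is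
  split, and the powers of \<open>x - y\<close> are integrated by parts in \<open>p\<close>.\<close>

lemma oscillatory_kernel:
  fixes x y :: "(real, 'n) vec" and t :: real
  defines "m \<equiv> t *\<^sub>R x + (1 - t) *\<^sub>R y"
  shows "(\<integral>p. exp (\<i> * of_real (p \<bullet> (x - y))) * a (m, p) \<partial>lborel) =
    (\<integral>z. (\<Sum>\<kappa>\<in>multi_exponents. (\<Prod>j\<in>UNIV. split_coeff t (\<kappa> j)) *
       ((of_real (scale_det f z) * wave_box f \<kappa> m z * (window f z x * window f z y)) *
        (\<integral>p. exp (\<i> * of_real (p \<bullet> (x - y))) * dual_symbol f js a \<kappa> z p \<partial>lborel))) \<partial>lborel)"
proof -
  let ?e = "\<lambda>p. exp (\<i> * complex_of_real (p \<bullet> (x - y)))"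
  let ?d = "\<lambda>z p. green_op (scale_vec f (z $ r_idx)) js a (z, p)"
  have mix: "mix js z m = z" for z by (simp add: mix_def js vec_eq_iff)
  have [measurable]: "(\<lambda>x. ?d (g x) (h x)) \<in> borel_measurable M"
    if [measurable]: "g \<in> M \<rightarrow>\<^sub>M borel" "h \<in> M \<rightarrow>\<^sub>M borel" for g h :: "'x \<Rightarrow> _" and M
    using measurable_green_op[OF a, of "\<lambda>x. (g x, h x)" M "\<lambda>x. scale_vec f (g x $ r_idx)" "[]" js]
    by (simp add: borel_prod[symmetric] scale_vec_def)
  obtain A where A: "A \<ge> 0" "\<And>z. jet_bound (0 + 2 * length js) (\<lambda>_. 1) z A a"
    using compact_support_jet_bound[OF a R, where L = "0 + 2 * length js"] by blast
  have G: "norm (green_op (scale_vec f r) js a z) \<le> 2 ^ length js * A" for r z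
    by (rule jet_bound_norm[OF jet_bound_green_op[OF a A(2)]])
      (auto intro: scale_vec_pos f less_le_trans[OF zero_less_one scale_vec_pos])
  have dR: "?d z p = 0" if "norm p > R" for z p
  proof -
    have "norm (z, p) > R" using that norm_snd_le[of p z] by linarith
    from green_op_support[OF R this] show ?thesis .
  qed
  have int: "integrable (lborel \<Otimes>\<^sub>M lborel) (\<lambda>(p, z). ?e p * (green_box f js m z *\<^sub>R ?d z p))"
  proof (rule Bochner_Integration.integrable_bound)
    show "integrable (lborel \<Otimes>\<^sub>M lborel) (\<lambda>w. (indicat_real (cball 0 R) (fst w) * (2 ^ length js * A)) * green_box f js m (snd w))"
      by (intro lborel_pair.product_function_integrable integrable_mult_left green_box_integrable f_meas f js integrable_indicator_cball)
    show "AE w in lborel \<Otimes>\<^sub>M lborel. norm (case w of (p, z) \<Rightarrow> ?e p * (green_box f js m z *\<^sub>R ?d z p)) \<le>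
       norm ((indicat_real (cball 0 R) (fst w) * (2 ^ length js * A)) * green_box f js m (snd w))"
    proof (rule AE_I2, clarify)
      fix p z :: "(real, 'n) vec"
      have gb: "0 \<le> green_box f js m z" by (rule green_box_nonneg[OF f])
      show "norm (?e p * (green_box f js m z *\<^sub>R ?d z p)) \<le> norm ((indicat_real (cball 0 R) (fst (p, z)) * (2 ^ length js * A)) * green_box f js m (snd (p, z)))"
      proof (cases "norm p > R")
        case True
        then show ?thesis by (simp add: dR)
      next
        case False
        then show ?thesis using gb A(1) mult_left_mono[OF G gb, of "z $ r_idx" "(z, p)"]
          by (simp add: norm_mult abs_mult mult_ac)
      qed
    qed
  qed measurable
  have "(\<integral>p. ?e p * a (m, p) \<partial>lborel) = (\<integral>p. \<integral>z. ?e p * (green_box f js m z *\<^sub>R ?d z p) \<partial>lborel \<partial>lborel)"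
    using symbol_representation(2)[OF a R f_meas f js(1), where m = m] unfolding mix
    by (simp only: integral_mult_right_zero)
  also have "\<dots> = (\<integral>z. \<integral>p. ?e p * (green_box f js m z *\<^sub>R ?d z p) \<partial>lborel \<partial>lborel)"
    by (rule lborel_pair.Fubini_integral[symmetric, OF int])
  also have "\<dots> = (\<integral>z. of_real (green_box f js m z) * (\<integral>p. ?e p * ?d z p \<partial>lborel) \<partial>lborel)"
    by (subst integral_mult_right_zero[symmetric]) (simp add: scaleR_conv_of_real mult_ac)
  also have "\<dots> = (\<integral>z. (\<Sum>\<kappa>\<in>multi_exponents. (\<Prod>j\<in>UNIV. split_coeff t (\<kappa> j)) *
       ((of_real (scale_det f z) * wave_box f \<kappa> m z * (window f z x * window f z y)) *
        (\<integral>p. ?e p * dual_symbol f js a \<kappa> z p \<partial>lborel))) \<partial>lborel)"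
  proof (rule Bochner_Integration.integral_cong[OF refl])
    fix z :: "(real, 'n) vec"
    show "of_real (green_box f js m z) * (\<integral>p. ?e p * ?d z p \<partial>lborel) = (\<Sum>\<kappa>\<in>multi_exponents. (\<Prod>j\<in>UNIV. split_coeff t (\<kappa> j)) *
       ((of_real (scale_det f z) * wave_box f \<kappa> m z * (window f z x * window f z y)) *
        (\<integral>p. ?e p * dual_symbol f js a \<kappa> z p \<partial>lborel)))"
      unfolding m_def green_box_split[where js = js, OF f js(2)] dual_symbol_by_parts[symmetric] sum_distrib_right
      by (simp only: vector_minus_component mult.assoc)
  qed
  finally show ?thesis .
qed

text \<open>Frequencies measured in units of the scales at \<open>z\<close>.\<close>

definition scale_by :: "(real, 'n) vec \<Rightarrow> (real, 'n) vec \<Rightarrow> (real, 'n) vec"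
  where "scale_by z \<tau> = (\<chi> j. \<tau> $ j * scale_vec f (z $ r_idx) j)"

text \<open>The integrand of one term of the kernel, with \<open>wave_box\<close> written out as a superposition of plane
  waves of frequency \<open>\<tau>\<close>. Every factor now depends on \<open>x\<close> and on \<open>y\<close> in a separated way.\<close>

definition term_kernel :: "real \<Rightarrow> ('n \<Rightarrow> nat) \<Rightarrow> (real, 'n) vec \<Rightarrow> (real, 'n) vec \<Rightarrow> (real, 'n) vec \<Rightarrow> (real, 'n) vec \<Rightarrow> (real, 'n) vec \<Rightarrow> complex"
  where "term_kernel t \<kappa> x y z \<tau> p =
    (density_prod \<kappa> \<tau> * exp (\<i> * of_real (scale_by z \<tau> \<bullet> (t *\<^sub>R x + (1 - t) *\<^sub>R y - z)))) *
    (of_real (scale_det f z) * (window f z x * window f z y)) *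
    (exp (\<i> * of_real (p \<bullet> (x - y))) * dual_symbol f js a \<kappa> z p)"

lemma scale_by_measurable [measurable]:
  assumes [measurable]: "g \<in> M \<rightarrow>\<^sub>M borel" "h \<in> M \<rightarrow>\<^sub>M borel"
  shows "(\<lambda>x. scale_by (g x) (h x)) \<in> M \<rightarrow>\<^sub>M borel"
proof -
  have "(\<lambda>x. scale_by (g x) (h x)) = (\<lambda>x. \<Sum>j\<in>UNIV. (h x $ j * scale_vec f (g x $ r_idx) j) *\<^sub>R axis j 1)"
    by (auto simp: fun_eq_iff scale_by_def vec_eq_iff axis_def if_distrib[of "\<lambda>x. _ * x"] cong: if_cong)
  also have "\<dots> \<in> M \<rightarrow>\<^sub>M borel" unfolding scale_vec_def by measurable
  finally show ?thesis .
qed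

lemma wave_box_waves:
  assumes "\<kappa> \<in> multi_exponents"
  shows "integrable lborel (\<lambda>\<tau>. density_prod \<kappa> \<tau> * exp (\<i> * of_real (scale_by z \<tau> \<bullet> (m - z))))"
    and "(\<integral>\<tau>. density_prod \<kappa> \<tau> * exp (\<i> * of_real (scale_by z \<tau> \<bullet> (m - z))) \<partial>lborel) = wave_box f \<kappa> m z"
proof -
  let ?c = "\<lambda>j. scale_vec f (z $ r_idx) j * (m $ j - z $ j)"
  let ?h = "\<lambda>j t. wave_density (\<kappa> j) t * exp (\<i> * of_real (t * ?c j))"
  have eq: "density_prod \<kappa> \<tau> * exp (\<i> * of_real (scale_by z \<tau> \<bullet> (m - z))) = (\<Prod>j\<in>UNIV. ?h j (\<tau> $ j))" for \<tau>
  proof -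
    have "exp (\<i> * of_real (scale_by z \<tau> \<bullet> (m - z))) = (\<Prod>j\<in>UNIV. exp (\<i> * complex_of_real (\<tau> $ j * ?c j)))"
      by (simp add: inner_vec_def scale_by_def exp_sum[symmetric] sum_distrib_left mult_ac)
    then show ?thesis by (simp add: density_prod_def prod.distrib)
  qed
  have int: "integrable lborel (?h j)" for j
  proof (rule Bochner_Integration.integrable_bound[OF wave_density_integrable[OF multi_exponents_le[OF assms, of j]]])
    have [measurable]: "wave_density (\<kappa> j) \<in> borel_measurable borel"
      using wave_density_integrable[OF multi_exponents_le[OF assms, of j]] by auto
    show "?h j \<in> borel_measurable lborel" by measurable
    show "AE t in lborel. norm (?h j t) \<le> norm (wave_density (\<kappa> j) t)"
      by (intro AE_I2) (simp only: norm_mult norm_exp_i_times mult_1_right order_refl)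
  qed
  show "integrable lborel (\<lambda>\<tau>. density_prod \<kappa> \<tau> * exp (\<i> * of_real (scale_by z \<tau> \<bullet> (m - z))))"
    unfolding eq by (rule product_vec_integrable[OF int])
  show "(\<integral>\<tau>. density_prod \<kappa> \<tau> * exp (\<i> * of_real (scale_by z \<tau> \<bullet> (m - z))) \<partial>lborel) = wave_box f \<kappa> m z"
    unfolding eq product_vec_integral[OF int] wave_box_def
    by (intro prod.cong refl wave_density_integral[OF multi_exponents_le[OF assms]])
qed

lemma dual_symbol_wave_integrable:
  assumes "\<kappa> \<in> multi_exponents"
  shows "integrable lborel (\<lambda>p. exp (\<i> * of_real (p \<bullet> s)) * dual_symbol f js a \<kappa> z p)"
  by (rule integrable_bounded_support[where R = R and B = "2 ^ CARD('n) * B"])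
    (auto simp: norm_mult dual_symbol_bound[OF assms] dual_symbol_support)

lemma window_product_bound:
  "norm (window f z x * window f z y) \<le> (window_sq f z x + window_sq f z y) / 2"
proof -
  have "2 * norm (window f z x) * norm (window f z y) \<le> (norm (window f z x))\<^sup>2 + (norm (window f z y))\<^sup>2"
    by (rule sum_squares_bound)
  then show ?thesis by (simp add: norm_mult window_norm_sq)
qed

lemma scale_det_window_integrable:
  fixes x :: "(real, 'n) vec"
  shows
  "integrable lborel (\<lambda>z. scale_det f z * window_sq f z x)" "(\<integral>z. scale_det f z * window_sq f z x \<partial>lborel) = pi ^ CARD('n)"
proof -
  have nn: "(\<integral>\<^sup>+z. ennreal (scale_det f z * window_sq f z x) \<partial>lborel) = ennreal (pi ^ CARD('n))"
    by (rule nn_integral_window_sq[OF f_meas f])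
  have pos: "0 \<le> scale_det f z * window_sq f z x" for z
    using scale_det_pos[where f = f and z = z, OF f] window_sq_bounds(1)[of f z x] by simp
  show "integrable lborel (\<lambda>z. scale_det f z * window_sq f z x)"
    by (rule integrableI_nonneg) (auto simp: nn pos)
  have "(\<integral>z. scale_det f z * window_sq f z x \<partial>lborel) = enn2real (\<integral>\<^sup>+z. ennreal (scale_det f z * window_sq f z x) \<partial>lborel)"
    by (rule integral_eq_nn_integral) (auto simp: pos)
  then show "(\<integral>z. scale_det f z * window_sq f z x \<partial>lborel) = pi ^ CARD('n)"
    unfolding nn by simp
qed

lemma B_nonneg: "0 \<le> B"
  using jet_bound_norm[OF B] norm_ge_zero order_trans by blast

lemma term_kernel_measurable [measurable]:
  assumes \<kappa>: "\<kappa> \<in> multi_exponents"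
    and [measurable]: "g1 \<in> M \<rightarrow>\<^sub>M borel" "g2 \<in> M \<rightarrow>\<^sub>M borel" "g3 \<in> M \<rightarrow>\<^sub>M borel" "g4 \<in> M \<rightarrow>\<^sub>M borel" "g5 \<in> M \<rightarrow>\<^sub>M borel"
  shows "(\<lambda>x. term_kernel t \<kappa> (g1 x) (g2 x) (g3 x) (g4 x) (g5 x)) \<in> borel_measurable M"
proof -
  have [measurable]: "density_prod \<kappa> \<in> borel_measurable borel"
    using density_prod_integrable[OF \<kappa>] by auto
  show ?thesis unfolding term_kernel_def by measurable
qed

abbreviation (input) "zpt \<equiv> lborel \<Otimes>\<^sub>M (lborel \<Otimes>\<^sub>M lborel) :: ((real, 'n) vec \<times> ((real, 'n) vec \<times> (real, 'n) vec)) measure"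

text \<open>Absolute convergence in all three variables: the density is integrable in \<open>\<tau>\<close>, the product of
  two windows in \<open>z\<close>, and the symbol has compact support in \<open>p\<close>. The bound is uniform in \<open>x\<close> and \<open>y\<close>.\<close>

lemma term_kernel_integrable:
  assumes \<kappa>: "\<kappa> \<in> multi_exponents"
  shows "integrable zpt (\<lambda>(z, \<tau>, p). term_kernel t \<kappa> x y z \<tau> p)"
    and "(\<integral>w. norm (case w of (z, \<tau>, p) \<Rightarrow> term_kernel t \<kappa> x y z \<tau> p) \<partial>zpt) \<le>
      pi ^ CARD('n) * (term_mass \<kappa> * (2 ^ CARD('n) * B * measure lborel (cball (0 :: (real, 'n) vec) R)))" (is "_ \<le> ?C")
proof -
  interpret P: pair_sigma_finite "lborel :: (real, 'n) vec measure" "lborel \<Otimes>\<^sub>M lborel :: ((real, 'n) vec \<times> (real, 'n) vec) measure"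
    by (intro pair_sigma_finite.intro lborel.sigma_finite_measure_axioms lborel_pair.sigma_finite_measure_axioms)
  let ?gz = "\<lambda>z. scale_det f z * ((window_sq f z x + window_sq f z y) / 2)"
  let ?gp = "\<lambda>p :: (real, 'n) vec. 2 ^ CARD('n) * B * indicat_real (cball 0 R) p"
  let ?D = "\<lambda>w. ?gz (fst w) * (norm (density_prod \<kappa> (fst (snd w))) * ?gp (snd (snd w)))"
  have ip: "integrable lborel ?gp" by (intro integrable_mult_right integrable_indicator_cball)
  have it: "integrable lborel (\<lambda>\<tau>. norm (density_prod \<kappa> \<tau>))" by (intro integrable_norm density_prod_integrable \<kappa>)
  have gz: "?gz = (\<lambda>z. (scale_det f z * window_sq f z x) / 2 + (scale_det f z * window_sq f z y) / 2)"
    by (simp add: fun_eq_iff algebra_simps add_divide_distrib)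
  have iz: "integrable lborel ?gz" unfolding gz
    by (intro Bochner_Integration.integrable_add integrable_divide scale_det_window_integrable)
  have vz: "(\<integral>z. ?gz z \<partial>lborel) = pi ^ CARD('n)" unfolding gz
    by (subst Bochner_Integration.integral_add)
      (simp_all add: scale_det_window_integrable)
  have itp: "integrable (lborel \<Otimes>\<^sub>M lborel) (\<lambda>w. norm (density_prod \<kappa> (fst w)) * ?gp (snd w))"
    by (rule lborel_pair.product_function_integrable[OF it ip])
  have vtp: "(\<integral>w. norm (density_prod \<kappa> (fst w)) * ?gp (snd w) \<partial>(lborel \<Otimes>\<^sub>M lborel)) = term_mass \<kappa> * (2 ^ CARD('n) * B * measure lborel (cball (0 :: (real, 'n) vec) R))"
    unfolding lborel_pair.product_function_integral[OF it ip] term_mass_def by simp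
  have iD: "integrable zpt ?D"
    using P.product_function_integrable[OF iz itp] by simp
  have vD: "(\<integral>w. ?D w \<partial>zpt) = ?C"
    using P.product_function_integral[OF iz itp] unfolding vz vtp by simp
  have le: "norm (case w of (z, \<tau>, p) \<Rightarrow> term_kernel t \<kappa> x y z \<tau> p) \<le> ?D w" for w
  proof -
    obtain z \<tau> p where w: "w = (z, \<tau>, p)" by (cases w) auto
    have j: "0 < scale_det f z" by (rule scale_det_pos[OF f])
    have "norm (dual_symbol f js a \<kappa> z p) \<le> ?gp p"
      using dual_symbol_bound[OF \<kappa>, of z p] dual_symbol_support[of p \<kappa> z] by (cases "norm p \<le> R") auto
    then have "norm (density_prod \<kappa> \<tau>) * (scale_det f z * norm (window f z x * window f z y)) * norm (dual_symbol f js a \<kappa> z p) \<le>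
      norm (density_prod \<kappa> \<tau>) * ?gz z * ?gp p"
      using window_product_bound[of z x y] j
      by (intro mult_mono mult_nonneg_nonneg mult_left_mono) (auto intro: add_nonneg_nonneg less_imp_le[OF window_sq_bounds(1)])
    moreover have "norm (term_kernel t \<kappa> x y z \<tau> p) = norm (density_prod \<kappa> \<tau>) * (scale_det f z * norm (window f z x * window f z y)) * norm (dual_symbol f js a \<kappa> z p)"
      using j unfolding term_kernel_def by (simp only: norm_mult norm_exp_i_times norm_of_real abs_of_pos mult_1_right mult_1_left)
    ultimately show ?thesis by (simp add: w mult_ac)
  qed
  have m: "(\<lambda>(z, \<tau>, p). term_kernel t \<kappa> x y z \<tau> p) \<in> borel_measurable zpt"
    unfolding case_prod_beta' using \<kappa> by measurable
  show int: "integrable zpt (\<lambda>(z, \<tau>, p). term_kernel t \<kappa> x y z \<tau> p)"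
    by (rule Bochner_Integration.integrable_bound[OF iD m]) (intro AE_I2 order_trans[OF le], simp only: real_norm_def abs_ge_self)
  have "(\<integral>w. norm (case w of (z, \<tau>, p) \<Rightarrow> term_kernel t \<kappa> x y z \<tau> p) \<partial>zpt) \<le> (\<integral>w. ?D w \<partial>zpt)"
    by (intro integral_mono integrable_norm int iD le)
  then show "(\<integral>w. norm (case w of (z, \<tau>, p) \<Rightarrow> term_kernel t \<kappa> x y z \<tau> p) \<partial>zpt) \<le> ?C"
    unfolding vD .
qed

lemma term_kernel_integral:
  fixes x y :: "(real, 'n) vec" and t :: real
  assumes \<kappa>: "\<kappa> \<in> multi_exponents"
  defines "F \<equiv> \<lambda>z. (of_real (scale_det f z) * wave_box f \<kappa> (t *\<^sub>R x + (1 - t) *\<^sub>R y) z * (window f z x * window f z y)) *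
        (\<integral>p. exp (\<i> * of_real (p \<bullet> (x - y))) * dual_symbol f js a \<kappa> z p \<partial>lborel)"
  shows "integrable lborel F"
    and "(\<integral>w. (case w of (z, \<tau>, p) \<Rightarrow> term_kernel t \<kappa> x y z \<tau> p) \<partial>zpt) = (\<integral>z. F z \<partial>lborel)"
proof -
  interpret P: pair_sigma_finite "lborel :: (real, 'n) vec measure" "lborel \<Otimes>\<^sub>M lborel :: ((real, 'n) vec \<times> (real, 'n) vec) measure"
    by (intro pair_sigma_finite.intro lborel.sigma_finite_measure_axioms lborel_pair.sigma_finite_measure_axioms)
  have inner: "(\<integral>w. (case (z, w) of (z, \<tau>, p) \<Rightarrow> term_kernel t \<kappa> x y z \<tau> p) \<partial>(lborel \<Otimes>\<^sub>M lborel)) = F z" for z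
  proof -
    let ?m = "t *\<^sub>R x + (1 - t) *\<^sub>R y"
    let ?g = "\<lambda>\<tau>. density_prod \<kappa> \<tau> * exp (\<i> * of_real (scale_by z \<tau> \<bullet> (?m - z)))"
    let ?h = "\<lambda>p. exp (\<i> * of_real (p \<bullet> (x - y))) * dual_symbol f js a \<kappa> z p"
    let ?J = "complex_of_real (scale_det f z) * (window f z x * window f z y)"
    have "(\<integral>w. (case (z, w) of (z, \<tau>, p) \<Rightarrow> term_kernel t \<kappa> x y z \<tau> p) \<partial>(lborel \<Otimes>\<^sub>M lborel)) =
      (\<integral>w. ?J * (?g (fst w) * ?h (snd w)) \<partial>(lborel \<Otimes>\<^sub>M lborel))"
      by (intro Bochner_Integration.integral_cong refl) (simp only: prod.case case_prod_beta term_kernel_def mult_ac fst_conv snd_conv)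
    also have "\<dots> = ?J * (wave_box f \<kappa> ?m z * (\<integral>p. ?h p \<partial>lborel))"
      by (simp only: integral_mult_right_zero
        lborel_pair.product_function_integral[OF wave_box_waves(1)[OF \<kappa>] dual_symbol_wave_integrable[OF \<kappa>]] wave_box_waves(2)[OF \<kappa>])
    finally show ?thesis by (simp only: F_def mult_ac)
  qed
  show "integrable lborel F"
    using P.integrable_fst'[OF term_kernel_integrable(1)[OF \<kappa>, of t x y]] unfolding inner .
  show "(\<integral>w. (case w of (z, \<tau>, p) \<Rightarrow> term_kernel t \<kappa> x y z \<tau> p) \<partial>zpt) = (\<integral>z. F z \<partial>lborel)"
    using P.integral_fst'[OF term_kernel_integrable(1)[OF \<kappa>, of t x y]] unfolding inner by (rule sym)
qed

definition term_operator :: "real \<Rightarrow> ('n \<Rightarrow> nat) \<Rightarrow> (real, 'n) vec \<Rightarrow> (real, 'n) vec \<Rightarrow> complex"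
  where "term_operator t \<kappa> x y = (\<integral>w. (case w of (z, \<tau>, p) \<Rightarrow> term_kernel t \<kappa> x y z \<tau> p) \<partial>zpt)"

text \<open>For fixed \<open>z\<close>, \<open>\<tau>\<close> and \<open>p\<close> the integral over \<open>(x, y)\<close> factors into the windowed Fourier transforms of
  \<open>v\<close> and of \<open>u\<close>. Their frequencies are shifted by multiples of \<open>\<tau>\<close>, which is harmless under an
  integral over \<open>p\<close>.\<close>

lemma term_pairing:
  fixes u v :: "(real, 'n) vec \<Rightarrow> complex"
  assumes \<kappa>: "\<kappa> \<in> multi_exponents" and u: "integrable lborel u" and v: "integrable lborel v"
  shows "integrable (lborel \<Otimes>\<^sub>M lborel) (\<lambda>s. v (fst s) * u (snd s) * term_operator t \<kappa> (fst s) (snd s))"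
    and "(\<integral>s. v (fst s) * u (snd s) * term_operator t \<kappa> (fst s) (snd s) \<partial>(lborel \<Otimes>\<^sub>M lborel)) =
      (\<integral>w. (case w of (z, \<tau>, p) \<Rightarrow>
         density_prod \<kappa> \<tau> * exp (- (\<i> * of_real (scale_by z \<tau> \<bullet> z))) * of_real (scale_det f z) * dual_symbol f js a \<kappa> z p *
         (window_transform f v z (p + t *\<^sub>R scale_by z \<tau>) * window_transform f u z (- p + (1 - t) *\<^sub>R scale_by z \<tau>))) \<partial>zpt)"
proof -
  have [measurable]: "u \<in> borel_measurable borel" "v \<in> borel_measurable borel" using u v by auto
  let ?S = "lborel \<Otimes>\<^sub>M lborel :: ((real, 'n) vec \<times> (real, 'n) vec) measure"
  have sf2: "sigma_finite_measure ?S" by (rule lborel_pair.sigma_finite_measure_axioms)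
  interpret P: pair_sigma_finite "lborel :: (real, 'n) vec measure" ?S
    by (intro pair_sigma_finite.intro lborel.sigma_finite_measure_axioms sf2)
  have sf3: "sigma_finite_measure zpt" by (rule P.sigma_finite_measure_axioms)
  interpret Q: pair_sigma_finite ?S zpt
    by (intro pair_sigma_finite.intro sf2 sf3)
  let ?\<Phi> = "\<lambda>s w. v (fst s) * u (snd s) * term_kernel t \<kappa> (fst s) (snd s) (fst w) (fst (snd w)) (snd (snd w))"
  let ?C = "pi ^ CARD('n) * (term_mass \<kappa> * (2 ^ CARD('n) * B * measure lborel (cball (0 :: (real, 'n) vec) R)))"
  have m: "(\<lambda>(s, w). ?\<Phi> s w) \<in> borel_measurable (?S \<Otimes>\<^sub>M zpt)"
    unfolding case_prod_beta' using \<kappa> by measurable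
  have k1: "integrable zpt (\<lambda>w. term_kernel t \<kappa> x y (fst w) (fst (snd w)) (snd (snd w)))" for x y
    using term_kernel_integrable(1)[OF \<kappa>, of t x y] by (simp add: case_prod_beta')
  have k2: "(\<integral>w. norm (term_kernel t \<kappa> x y (fst w) (fst (snd w)) (snd (snd w))) \<partial>zpt) \<le> ?C" for x y
    using term_kernel_integrable(2)[OF \<kappa>, of t x y] by (simp add: case_prod_beta')
  have vu: "integrable ?S (\<lambda>s. v (fst s) * u (snd s))"
    by (rule lborel_pair.product_function_integrable[OF v u])
  have int: "integrable (?S \<Otimes>\<^sub>M zpt) (\<lambda>(s, w). ?\<Phi> s w)"
  proof (rule Q.Fubini_integrable[OF m])
    show "AE s in ?S. integrable zpt (\<lambda>w. (\<lambda>(s, w). ?\<Phi> s w) (s, w))"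
      using k1 by (intro AE_I2) simp
    show "integrable ?S (\<lambda>s. \<integral>w. norm ((\<lambda>(s, w). ?\<Phi> s w) (s, w)) \<partial>zpt)"
    proof (rule Bochner_Integration.integrable_bound)
      show "integrable ?S (\<lambda>s. norm (v (fst s) * u (snd s)) * ?C)"
        by (intro integrable_mult_left integrable_norm vu)
      show "(\<lambda>s. \<integral>w. norm ((\<lambda>(s, w). ?\<Phi> s w) (s, w)) \<partial>zpt) \<in> borel_measurable ?S"
        using m by (intro sigma_finite_measure.borel_measurable_lebesgue_integral[OF sf3]) (simp add: case_prod_beta')
      show "AE s in ?S. norm (\<integral>w. norm ((\<lambda>(s, w). ?\<Phi> s w) (s, w)) \<partial>zpt) \<le> norm (norm (v (fst s) * u (snd s)) * ?C)"
      proof (rule AE_I2)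
        fix s :: "(real, 'n) vec \<times> (real, 'n) vec"
        have "(\<integral>w. norm ((\<lambda>(s, w). ?\<Phi> s w) (s, w)) \<partial>zpt) = norm (v (fst s) * u (snd s)) * (\<integral>w. norm (term_kernel t \<kappa> (fst s) (snd s) (fst w) (fst (snd w)) (snd (snd w))) \<partial>zpt)"
          by (simp only: prod.case norm_mult[of "v (fst s) * u (snd s)"] integral_mult_right_zero)
        also have "\<dots> \<le> norm (v (fst s) * u (snd s)) * ?C"
          by (intro mult_left_mono k2) simp
        finally show "norm (\<integral>w. norm ((\<lambda>(s, w). ?\<Phi> s w) (s, w)) \<partial>zpt) \<le> norm (norm (v (fst s) * u (snd s)) * ?C)"
          by (subst real_norm_def, subst abs_of_nonneg) (auto intro: order_trans[OF _ abs_ge_self])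
      qed
    qed
  qed
  have inner: "(\<integral>w. ?\<Phi> s w \<partial>zpt) = v (fst s) * u (snd s) * term_operator t \<kappa> (fst s) (snd s)" for s
    unfolding term_operator_def case_prod_beta' by (rule integral_mult_right_zero)
  show "integrable ?S (\<lambda>s. v (fst s) * u (snd s) * term_operator t \<kappa> (fst s) (snd s))"
    using Q.integrable_fst'[OF int] by (simp only: prod.case inner)
  have "(\<integral>s. v (fst s) * u (snd s) * term_operator t \<kappa> (fst s) (snd s) \<partial>?S) = (\<integral>s. \<integral>w. ?\<Phi> s w \<partial>zpt \<partial>?S)"
    by (simp only: inner)
  also have "\<dots> = (\<integral>w. \<integral>s. ?\<Phi> s w \<partial>?S \<partial>zpt)"
    by (rule Q.Fubini_integral[OF int, symmetric])
  also have "\<dots> = (\<integral>w. (case w of (z, \<tau>, p) \<Rightarrow>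
         density_prod \<kappa> \<tau> * exp (- (\<i> * of_real (scale_by z \<tau> \<bullet> z))) * of_real (scale_det f z) * dual_symbol f js a \<kappa> z p *
         (window_transform f v z (p + t *\<^sub>R scale_by z \<tau>) * window_transform f u z (- p + (1 - t) *\<^sub>R scale_by z \<tau>))) \<partial>zpt)"
  proof (rule Bochner_Integration.integral_cong[OF refl])
    fix w :: "(real, 'n) vec \<times> (real, 'n) vec \<times> (real, 'n) vec"
    obtain z \<tau> p where w: "w = (z, \<tau>, p)" by (cases w) auto
    let ?\<theta> = "scale_by z \<tau>"
    let ?V = "\<lambda>x. exp (\<i> * of_real (x \<bullet> (p + t *\<^sub>R ?\<theta>))) * (v x * window f z x)"
    let ?U = "\<lambda>y. exp (\<i> * of_real (y \<bullet> (- p + (1 - t) *\<^sub>R ?\<theta>))) * (u y * window f z y)"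
    let ?c = "density_prod \<kappa> \<tau> * exp (- (\<i> * of_real (?\<theta> \<bullet> z))) * of_real (scale_det f z) * dual_symbol f js a \<kappa> z p"
    have iV: "integrable lborel ?V"
      by (rule Bochner_Integration.integrable_bound[OF v])
        (auto simp: norm_mult intro!: AE_I2 mult_right_le_one_le window_norm_le)
    have iU: "integrable lborel ?U"
      by (rule Bochner_Integration.integrable_bound[OF u])
        (auto simp: norm_mult intro!: AE_I2 mult_right_le_one_le window_norm_le)
    have "?\<Phi> s w = ?c * (?V (fst s) * ?U (snd s))" for s
    proof -
      have "\<i> * of_real (?\<theta> \<bullet> (t *\<^sub>R fst s + (1 - t) *\<^sub>R snd s - z)) + \<i> * of_real (p \<bullet> (fst s - snd s)) =
        - (\<i> * of_real (?\<theta> \<bullet> z)) + (\<i> * of_real (fst s \<bullet> (p + t *\<^sub>R ?\<theta>)) + \<i> * complex_of_real (snd s \<bullet> (- p + (1 - t) *\<^sub>R ?\<theta>)))"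
        by (simp add: inner_diff_right inner_add_right inner_commute[of "fst s"] inner_commute[of "snd s"] algebra_simps)
      then have "exp (\<i> * of_real (?\<theta> \<bullet> (t *\<^sub>R fst s + (1 - t) *\<^sub>R snd s - z))) * exp (\<i> * of_real (p \<bullet> (fst s - snd s))) =
        exp (- (\<i> * of_real (?\<theta> \<bullet> z))) * (exp (\<i> * of_real (fst s \<bullet> (p + t *\<^sub>R ?\<theta>))) * exp (\<i> * complex_of_real (snd s \<bullet> (- p + (1 - t) *\<^sub>R ?\<theta>))))"
        by (simp only: exp_add[symmetric])
      then show ?thesis
        unfolding w term_kernel_def fst_conv snd_conv by algebra
    qed
    then have "(\<integral>s. ?\<Phi> s w \<partial>?S) = ?c * ((\<integral>x. ?V x \<partial>lborel) * (\<integral>y. ?U y \<partial>lborel))"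
      by (simp only: integral_mult_right_zero lborel_pair.product_function_integral[OF iV iU])
    then show "(\<integral>s. ?\<Phi> s w \<partial>?S) = (case w of (z, \<tau>, p) \<Rightarrow>
         density_prod \<kappa> \<tau> * exp (- (\<i> * of_real (scale_by z \<tau> \<bullet> z))) * of_real (scale_det f z) * dual_symbol f js a \<kappa> z p *
         (window_transform f v z (p + t *\<^sub>R scale_by z \<tau>) * window_transform f u z (- p + (1 - t) *\<^sub>R scale_by z \<tau>)))"
      unfolding w by (simp only: prod.case window_transform_def)
  qed
  finally show "(\<integral>s. v (fst s) * u (snd s) * term_operator t \<kappa> (fst s) (snd s) \<partial>?S) = \<dots>" .
qed

text \<open>The inequality \<open>2 \<bar>a b\<bar> \<le> c a\<^sup>2 + b\<^sup>2 / c\<close> separates \<open>u\<close> from \<open>v\<close>. The integral over \<open>p\<close> does not see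
  the shift of the frequencies, the integral over \<open>\<tau>\<close> gives the mass of the density, and the integral
  over \<open>z\<close> is controlled by the orthogonality relation of the windowed transform.\<close>

lemma term_pairing_bound:
  fixes u v :: "(real, 'n) vec \<Rightarrow> complex"
  assumes \<kappa>: "\<kappa> \<in> multi_exponents" and u: "integrable lborel u" and v: "integrable lborel v"
    and u2: "integrable lborel (\<lambda>x. (norm (u x))\<^sup>2)" and v2: "integrable lborel (\<lambda>x. (norm (v x))\<^sup>2)" and c: "c > 0"
  shows "norm (\<integral>s. v (fst s) * u (snd s) * term_operator t \<kappa> (fst s) (snd s) \<partial>(lborel \<Otimes>\<^sub>M lborel)) \<le>
    term_mass \<kappa> * (2 ^ CARD('n) * B / 2 * ((2 * pi) ^ CARD('n) * pi ^ CARD('n))) *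
      (c * (\<integral>x. (norm (u x))\<^sup>2 \<partial>lborel) + (\<integral>x. (norm (v x))\<^sup>2 \<partial>lborel) / c)"
proof -
  have [measurable]: "u \<in> borel_measurable borel" "v \<in> borel_measurable borel" using u v by auto
  have [measurable]: "density_prod \<kappa> \<in> borel_measurable borel" using density_prod_integrable[OF \<kappa>] by auto
  let ?K = "2 ^ CARD('n) * B / 2" and ?M = "(2 * pi) ^ CARD('n) * pi ^ CARD('n)"
  let ?U = "\<lambda>z \<xi>. window_transform f u z \<xi>" and ?V = "\<lambda>z \<xi>. window_transform f v z \<xi>"
  let ?IU = "\<lambda>z. \<integral>\<^sup>+\<xi>. ennreal ((norm (?U z \<xi>))\<^sup>2) \<partial>lborel"
  let ?IV = "\<lambda>z. \<integral>\<^sup>+\<xi>. ennreal ((norm (?V z \<xi>))\<^sup>2) \<partial>lborel"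
  let ?nu = "\<integral>x. (norm (u x))\<^sup>2 \<partial>lborel" and ?nv = "\<integral>x. (norm (v x))\<^sup>2 \<partial>lborel"
  have K: "0 \<le> ?K" using B_nonneg by simp
  have mass: "(\<integral>\<^sup>+\<tau>. ennreal (norm (density_prod \<kappa> \<tau>)) \<partial>lborel) = ennreal (term_mass \<kappa>)"
    unfolding term_mass_def by (intro nn_integral_eq_integral integrable_norm density_prod_integrable \<kappa>) auto
  let ?G = "\<lambda>z \<tau> p. density_prod \<kappa> \<tau> * exp (- (\<i> * of_real (scale_by z \<tau> \<bullet> z))) * of_real (scale_det f z) * dual_symbol f js a \<kappa> z p *
         (?V z (p + t *\<^sub>R scale_by z \<tau>) * ?U z (- p + (1 - t) *\<^sub>R scale_by z \<tau>))"
  define F where "F z \<tau> p = ennreal (norm (density_prod \<kappa> \<tau>)) * (ennreal (?K * scale_det f z) *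
      (ennreal c * ennreal ((norm (?U z (- p + (1 - t) *\<^sub>R scale_by z \<tau>)))\<^sup>2) + ennreal (1 / c) * ennreal ((norm (?V z (p + t *\<^sub>R scale_by z \<tau>)))\<^sup>2)))" for z \<tau> p
  have pt: "ennreal (norm (?G z \<tau> p)) \<le> F z \<tau> p" for z \<tau> p
  proof -
    let ?a = "norm (?U z (- p + (1 - t) *\<^sub>R scale_by z \<tau>))" and ?b = "norm (?V z (p + t *\<^sub>R scale_by z \<tau>))"
    have j: "0 < scale_det f z" by (rule scale_det_pos[where f = f, OF f])
    have "0 \<le> (c * ?a - ?b)\<^sup>2 / c" using c by simp
    also have "(c * ?a - ?b)\<^sup>2 / c = c * ?a\<^sup>2 + 1 / c * ?b\<^sup>2 - 2 * (?b * ?a)"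
      using c by (simp add: power2_eq_square field_simps)
    finally have ab: "?b * ?a \<le> (c * ?a\<^sup>2 + 1 / c * ?b\<^sup>2) / 2" by simp
    have e: "norm (exp (- (\<i> * complex_of_real (scale_by z \<tau> \<bullet> z)))) = 1" by simp
    have "norm (?G z \<tau> p) = norm (density_prod \<kappa> \<tau>) * (scale_det f z * (norm (dual_symbol f js a \<kappa> z p) * (?b * ?a)))"
      using j by (simp only: norm_mult e norm_of_real abs_of_pos mult_1_right mult.assoc)
    also have "\<dots> \<le> norm (density_prod \<kappa> \<tau>) * (scale_det f z * ((2 ^ CARD('n) * B) * ((c * ?a\<^sup>2 + 1 / c * ?b\<^sup>2) / 2)))"
      using j dual_symbol_bound[OF \<kappa>, of z p] ab B_nonneg by (intro mult_left_mono mult_mono) auto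
    also have "\<dots> = norm (density_prod \<kappa> \<tau>) * ((?K * scale_det f z) * (c * ?a\<^sup>2 + 1 / c * ?b\<^sup>2))"
      by simp
    finally have "ennreal (norm (?G z \<tau> p)) \<le> ennreal (norm (density_prod \<kappa> \<tau>) * ((?K * scale_det f z) * (c * ?a\<^sup>2 + 1 / c * ?b\<^sup>2)))"
      by (rule ennreal_leI)
    also have "\<dots> = F z \<tau> p"
    proof -
      have Kj: "0 \<le> ?K * scale_det f z" using K j by simp
      have "0 \<le> c * ?a\<^sup>2" "0 \<le> 1 / c * ?b\<^sup>2" using c by auto
      then have "ennreal (c * ?a\<^sup>2 + 1 / c * ?b\<^sup>2) = ennreal c * ennreal (?a\<^sup>2) + ennreal (1 / c) * ennreal (?b\<^sup>2)"
        using c by (simp only: ennreal_plus) (intro arg_cong2[where f = "(+)"] ennreal_mult, auto)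
      moreover have "0 \<le> c * ?a\<^sup>2 + 1 / c * ?b\<^sup>2" using c by auto
      ultimately show ?thesis
        unfolding F_def using Kj by (subst ennreal_mult, simp, simp, subst ennreal_mult) simp_all
    qed
    finally show ?thesis .
  qed
  have Ip: "(\<integral>\<^sup>+p. F z \<tau> p \<partial>lborel) = ennreal (norm (density_prod \<kappa> \<tau>)) * (ennreal (?K * scale_det f z) * (ennreal c * ?IU z + ennreal (1 / c) * ?IV z))" for z \<tau>
  proof -
    have 1: "(\<integral>\<^sup>+p. ennreal ((norm (?V z (p + t *\<^sub>R scale_by z \<tau>)))\<^sup>2) \<partial>lborel) = ?IV z"
      by (rule nn_integral_translate) measurable
    have "(\<integral>\<^sup>+p. ennreal ((norm (?U z (- p + (1 - t) *\<^sub>R scale_by z \<tau>)))\<^sup>2) \<partial>lborel) = (\<integral>\<^sup>+p. ennreal ((norm (?U z (p + (1 - t) *\<^sub>R scale_by z \<tau>)))\<^sup>2) \<partial>lborel)"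
      by (rule nn_integral_reflect) measurable
    also have "\<dots> = ?IU z" by (rule nn_integral_translate) measurable
    finally have 2: "(\<integral>\<^sup>+p. ennreal ((norm (?U z (- p + (1 - t) *\<^sub>R scale_by z \<tau>)))\<^sup>2) \<partial>lborel) = ?IU z" .
    have split: "(\<integral>\<^sup>+p. \<alpha> * (\<beta> * (\<gamma> * X p + \<delta> * Y p)) \<partial>lborel) = \<alpha> * (\<beta> * (\<gamma> * (\<integral>\<^sup>+p. X p \<partial>lborel) + \<delta> * (\<integral>\<^sup>+p. Y p \<partial>lborel)))"
      if [measurable]: "X \<in> borel_measurable borel" "Y \<in> borel_measurable borel"
      for \<alpha> \<beta> \<gamma> \<delta> and X Y :: "(real, 'n) vec \<Rightarrow> ennreal"
      by (simp add: nn_integral_cmult nn_integral_add)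
    show ?thesis
      unfolding F_def by (subst split, measurable) (simp only: 1 2)
  qed
  have "ennreal (norm (\<integral>s. v (fst s) * u (snd s) * term_operator t \<kappa> (fst s) (snd s) \<partial>(lborel \<Otimes>\<^sub>M lborel))) \<le>
     (\<integral>\<^sup>+w. ennreal (norm (case w of (z, \<tau>, p) \<Rightarrow> ?G z \<tau> p)) \<partial>zpt)"
    unfolding term_pairing(2)[OF \<kappa> u v] by (rule norm_integral_le_nn_integral)
  also have "\<dots> \<le> (\<integral>\<^sup>+w. F (fst w) (fst (snd w)) (snd (snd w)) \<partial>zpt)"
    by (intro nn_integral_mono) (simp only: case_prod_beta pt)
  also have "\<dots> = (\<integral>\<^sup>+z. \<integral>\<^sup>+w. F z (fst w) (snd w) \<partial>(lborel \<Otimes>\<^sub>M lborel) \<partial>lborel)"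
  proof -
    have "(\<lambda>w. F (fst w) (fst (snd w)) (snd (snd w))) \<in> borel_measurable zpt"
      unfolding F_def by measurable
    from sigma_finite_measure.nn_integral_fst[OF lborel_pair.sigma_finite_measure_axioms this]
    show ?thesis by (simp only: fst_conv snd_conv)
  qed
  also have "\<dots> = (\<integral>\<^sup>+z. \<integral>\<^sup>+\<tau>. \<integral>\<^sup>+p. F z \<tau> p \<partial>lborel \<partial>lborel \<partial>lborel)"
  proof (rule nn_integral_cong)
    fix z :: "(real, 'n) vec"
    have "(\<lambda>w. F z (fst w) (snd w)) \<in> borel_measurable (lborel \<Otimes>\<^sub>M lborel)"
      unfolding F_def by measurable
    from lborel.nn_integral_fst[OF this]
    show "(\<integral>\<^sup>+w. F z (fst w) (snd w) \<partial>(lborel \<Otimes>\<^sub>M lborel)) = (\<integral>\<^sup>+\<tau>. \<integral>\<^sup>+p. F z \<tau> p \<partial>lborel \<partial>lborel)"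
      by (simp only: fst_conv snd_conv)
  qed
  also have "\<dots> = (\<integral>\<^sup>+z. ennreal (term_mass \<kappa>) * (ennreal (?K * scale_det f z) * (ennreal c * ?IU z + ennreal (1 / c) * ?IV z)) \<partial>lborel)"
    unfolding Ip by (subst nn_integral_multc) (auto simp: mass)
  also have "\<dots> = (\<integral>\<^sup>+z. (ennreal (term_mass \<kappa>) * ennreal ?K) * (ennreal c * (ennreal (scale_det f z) * ?IU z) + ennreal (1 / c) * (ennreal (scale_det f z) * ?IV z)) \<partial>lborel)"
  proof (rule nn_integral_cong)
    fix z :: "(real, 'n) vec"
    have "ennreal (?K * scale_det f z) = ennreal ?K * ennreal (scale_det f z)"
      using K scale_det_pos[where f = f and z = z, OF f] by (intro ennreal_mult) auto
    then show "ennreal (term_mass \<kappa>) * (ennreal (?K * scale_det f z) * (ennreal c * ?IU z + ennreal (1 / c) * ?IV z)) =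
      (ennreal (term_mass \<kappa>) * ennreal ?K) * (ennreal c * (ennreal (scale_det f z) * ?IU z) + ennreal (1 / c) * (ennreal (scale_det f z) * ?IV z))"
      by (simp only: distrib_left mult_ac)
  qed
  also have "\<dots> = (ennreal (term_mass \<kappa>) * ennreal ?K) * (ennreal c * (\<integral>\<^sup>+z. ennreal (scale_det f z) * ?IU z \<partial>lborel) + ennreal (1 / c) * (\<integral>\<^sup>+z. ennreal (scale_det f z) * ?IV z \<partial>lborel))"
    by (simp add: nn_integral_cmult nn_integral_add)
  also have "\<dots> \<le> (ennreal (term_mass \<kappa>) * ennreal ?K) * (ennreal c * ennreal (?M * ?nu) + ennreal (1 / c) * ennreal (?M * ?nv))"
    by (intro mult_left_mono add_mono window_transform_L2 f_meas f u u2 v v2) auto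
  also have "\<dots> = ennreal (term_mass \<kappa> * (?K * ?M) * (c * ?nu + ?nv / c))"
  proof -
    have nn: "0 \<le> ?M * ?nu" "0 \<le> ?M * ?nv" by auto
    have "ennreal c * ennreal (?M * ?nu) + ennreal (1 / c) * ennreal (?M * ?nv) = ennreal (c * (?M * ?nu) + 1 / c * (?M * ?nv))"
      using c nn by (subst ennreal_plus) (auto simp: ennreal_mult[symmetric])
    moreover have "ennreal (term_mass \<kappa>) * ennreal ?K = ennreal (term_mass \<kappa> * ?K)"
      using K term_mass_nonneg[of \<kappa>] by (intro ennreal_mult[symmetric]) auto
    moreover have "term_mass \<kappa> * (?K * ?M) * (c * ?nu + ?nv / c) = (term_mass \<kappa> * ?K) * (c * (?M * ?nu) + 1 / c * (?M * ?nv))"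
      by (simp add: algebra_simps)
    moreover have "0 \<le> c * (?M * ?nu) + 1 / c * (?M * ?nv)" using c nn by (intro add_nonneg_nonneg mult_nonneg_nonneg) auto
    ultimately show ?thesis
      using K term_mass_nonneg[of \<kappa>] by (simp only:) (intro ennreal_mult[symmetric] mult_nonneg_nonneg, auto)
  qed
  finally have "ennreal (norm (\<integral>s. v (fst s) * u (snd s) * term_operator t \<kappa> (fst s) (snd s) \<partial>(lborel \<Otimes>\<^sub>M lborel))) \<le> ennreal (term_mass \<kappa> * (?K * ?M) * (c * ?nu + ?nv / c))" .
  moreover have "0 \<le> term_mass \<kappa> * (?K * ?M) * (c * ?nu + ?nv / c)"
    using K B_nonneg term_mass_nonneg[of \<kappa>] c by (intro mult_nonneg_nonneg add_nonneg_nonneg divide_nonneg_nonneg) auto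
  ultimately show ?thesis by (simp only: ennreal_le_iff)
qed

text \<open>The finitely many terms are added up; their coefficients are at most \<open>1\<close> in absolute value.\<close>

lemma pairing_bound:
  fixes u v :: "(real, 'n) vec \<Rightarrow> complex"
  assumes u: "integrable lborel u" and v: "integrable lborel v"
    and u2: "integrable lborel (\<lambda>x. (norm (u x))\<^sup>2)" and v2: "integrable lborel (\<lambda>x. (norm (v x))\<^sup>2)" and c: "c > 0"
    and t: "t \<in> {0..1}"
  shows "norm (\<integral>s. v (fst s) * u (snd s) * (\<integral>p. exp (\<i> * of_real (p \<bullet> (fst s - snd s))) * a (t *\<^sub>R fst s + (1 - t) *\<^sub>R snd s, p) \<partial>lborel) \<partial>(lborel \<Otimes>\<^sub>M lborel)) \<le>
    (\<Sum>\<kappa>\<in>(multi_exponents :: ('n \<Rightarrow> nat) set). term_mass \<kappa>) * (2 ^ CARD('n) * B / 2 * ((2 * pi) ^ CARD('n) * pi ^ CARD('n))) *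
      (c * (\<integral>x. (norm (u x))\<^sup>2 \<partial>lborel) + (\<integral>x. (norm (v x))\<^sup>2 \<partial>lborel) / c)"
proof -
  let ?c = "\<lambda>\<kappa>::'n \<Rightarrow> nat. \<Prod>j\<in>UNIV. split_coeff t (\<kappa> j)"
  let ?T = "\<lambda>\<kappa>. \<integral>s. v (fst s) * u (snd s) * term_operator t \<kappa> (fst s) (snd s) \<partial>(lborel \<Otimes>\<^sub>M lborel)"
  let ?R = "2 ^ CARD('n) * B / 2 * ((2 * pi) ^ CARD('n) * pi ^ CARD('n))"
  let ?N = "c * (\<integral>x. (norm (u x))\<^sup>2 \<partial>lborel) + (\<integral>x. (norm (v x))\<^sup>2 \<partial>lborel) / c"
  have kernel: "(\<integral>p. exp (\<i> * of_real (p \<bullet> (x - y))) * a (t *\<^sub>R x + (1 - t) *\<^sub>R y, p) \<partial>lborel) = (\<Sum>\<kappa>\<in>multi_exponents. ?c \<kappa> * term_operator t \<kappa> x y)" for x y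
  proof -
    let ?F = "\<lambda>\<kappa> z. (of_real (scale_det f z) * wave_box f \<kappa> (t *\<^sub>R x + (1 - t) *\<^sub>R y) z * (window f z x * window f z y)) *
        (\<integral>p. exp (\<i> * of_real (p \<bullet> (x - y))) * dual_symbol f js a \<kappa> z p \<partial>lborel)"
    have "(\<integral>p. exp (\<i> * of_real (p \<bullet> (x - y))) * a (t *\<^sub>R x + (1 - t) *\<^sub>R y, p) \<partial>lborel) = (\<integral>z. (\<Sum>\<kappa>\<in>multi_exponents. ?c \<kappa> * ?F \<kappa> z) \<partial>lborel)"
      by (rule oscillatory_kernel)
    also have "\<dots> = (\<Sum>\<kappa>\<in>multi_exponents. \<integral>z. ?c \<kappa> * ?F \<kappa> z \<partial>lborel)"
      by (rule Bochner_Integration.integral_sum) (intro integrable_mult_right term_kernel_integral(1))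
    also have "\<dots> = (\<Sum>\<kappa>\<in>multi_exponents. ?c \<kappa> * term_operator t \<kappa> x y)"
      by (intro sum.cong refl) (simp only: term_operator_def term_kernel_integral(2) integral_mult_right_zero)
    finally show ?thesis .
  qed
  have "(\<integral>s. v (fst s) * u (snd s) * (\<integral>p. exp (\<i> * of_real (p \<bullet> (fst s - snd s))) * a (t *\<^sub>R fst s + (1 - t) *\<^sub>R snd s, p) \<partial>lborel) \<partial>(lborel \<Otimes>\<^sub>M lborel))
     = (\<integral>s. (\<Sum>\<kappa>\<in>multi_exponents. ?c \<kappa> * (v (fst s) * u (snd s) * term_operator t \<kappa> (fst s) (snd s))) \<partial>(lborel \<Otimes>\<^sub>M lborel))"
    unfolding kernel sum_distrib_left by (intro Bochner_Integration.integral_cong sum.cong refl) (simp only: mult_ac)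
  also have "\<dots> = (\<Sum>\<kappa>\<in>multi_exponents. \<integral>s. ?c \<kappa> * (v (fst s) * u (snd s) * term_operator t \<kappa> (fst s) (snd s)) \<partial>(lborel \<Otimes>\<^sub>M lborel))"
    by (rule Bochner_Integration.integral_sum) (intro integrable_mult_right term_pairing(1) u v)
  also have "\<dots> = (\<Sum>\<kappa>\<in>multi_exponents. ?c \<kappa> * ?T \<kappa>)" by (simp only: integral_mult_right_zero)
  also have "norm \<dots> \<le> (\<Sum>\<kappa>\<in>(multi_exponents :: ('n \<Rightarrow> nat) set). term_mass \<kappa> * ?R * ?N)"
  proof (rule sum_norm_le)
    fix \<kappa> :: "'n \<Rightarrow> nat" assume \<kappa>: "\<kappa> \<in> multi_exponents"
    have "norm (?c \<kappa>) \<le> 1"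
      unfolding prod_norm[symmetric] by (intro prod_le_1) (auto simp: split_coeff_norm[OF t])
    then have "norm (?c \<kappa> * ?T \<kappa>) \<le> 1 * norm (?T \<kappa>)" unfolding norm_mult by (intro mult_right_mono) auto
    also have "\<dots> \<le> term_mass \<kappa> * ?R * ?N"
      using term_pairing_bound[OF \<kappa> u v u2 v2 c] by simp
    finally show "norm (?c \<kappa> * ?T \<kappa>) \<le> term_mass \<kappa> * ?R * ?N" .
  qed
  also have "\<dots> = (\<Sum>\<kappa>\<in>(multi_exponents :: ('n \<Rightarrow> nat) set). term_mass \<kappa>) * ?R * ?N" by (simp only: sum_distrib_right)
  finally show ?thesis .
qed

end

section \<open>Regularization of the symbol\<close>

lemma jet_bound_mono_weight:
  assumes "jet_bound L W z A g" "\<And>b. b \<in> Basis \<Longrightarrow> 0 \<le> W b \<and> W b \<le> W' b"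
  shows "jet_bound L W' z A g"
  unfolding jet_bound_def
proof (intro allI impI)
  fix bs :: "'a list" assume bs: "set bs \<subseteq> Basis" "length bs \<le> L"
  have A: "0 \<le> A" using jet_bound_norm[OF assms(1)] norm_ge_zero order_trans by blast
  have "0 \<le> prod_list (map W bs) \<and> prod_list (map W bs) \<le> prod_list (map W' bs)"
    using bs(1)
  proof (induction bs)
    case (Cons b bs)
    then show ?case using assms(2)[of b] by (auto intro!: mult_mono)
  qed simp
  then have "A * prod_list (map W bs) \<le> A * prod_list (map W' bs)"
    using A by (intro mult_left_mono) auto
  with jet_boundD[OF assms(1) bs] show "norm (partials bs g z) \<le> A * prod_list (map W' bs)" by linarith
qed

lemma smooth_rescale_p:
  fixes a :: "'n::finite phase \<Rightarrow> complex"
  assumes a: "smooth a"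
  shows "smooth (\<lambda>z. a (fst z, h *\<^sub>R snd z))"
    and "set bs \<subseteq> Basis \<Longrightarrow> partials bs (\<lambda>z. a (fst z, h *\<^sub>R snd z)) z =
      prod_list (map (\<lambda>b. if fst b = 0 then h else 1) bs) *\<^sub>R partials bs a (fst z, h *\<^sub>R snd z)"
proof -
  let ?T = "\<lambda>z :: 'n phase. (fst z, h *\<^sub>R snd z)"
  have T: "bounded_linear ?T"
    by (intro bounded_linear_Pair bounded_linear_fst bounded_linear_const_scaleR bounded_linear_snd)
  have c: "?T b = (if fst b = 0 then h else 1) *\<^sub>R b" if "b \<in> Basis" for b :: "'n phase"
    using that by (cases rule: Basis_phase_cases) (auto simp: axis_eq_0_iff)
  show "smooth (\<lambda>z. a (fst z, h *\<^sub>R snd z))"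
    using smooth_affine[OF T c _ a, of "0"] by (simp add: zero_prod_def)
  show "set bs \<subseteq> Basis \<Longrightarrow> partials bs (\<lambda>z. a (fst z, h *\<^sub>R snd z)) z =
      prod_list (map (\<lambda>b. if fst b = 0 then h else 1) bs) *\<^sub>R partials bs a (fst z, h *\<^sub>R snd z)"
    using partials_affine[OF T c _ a, of bs "0" z] by (simp add: zero_prod_def)
qed

text \<open>As \<open>h \<le> 1\<close>, the dilation in \<open>p\<close> only decreases derivatives; those in \<open>q\<close> are unchanged.\<close>

lemma jet_bound_rescale_p:
  fixes a :: "'n::finite phase \<Rightarrow> complex"
  assumes a: "smooth a" and h: "h \<in> {0..1}" and W: "\<And>b. b \<in> Basis \<Longrightarrow> 0 \<le> W b"
    and j: "jet_bound L W (fst z, h *\<^sub>R snd z) A a"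
  shows "jet_bound L W z A (\<lambda>z. a (fst z, h *\<^sub>R snd z))"
  unfolding jet_bound_def
proof (intro allI impI)
  fix bs :: "'n phase list" assume bs: "set bs \<subseteq> Basis" "length bs \<le> L"
  let ?c = "prod_list (map (\<lambda>b::'n phase. if fst b = 0 then h else 1) bs)"
  have c: "0 \<le> ?c \<and> ?c \<le> 1"
    using h by (induction bs) (auto intro!: mult_le_one)
  have "norm (partials bs (\<lambda>z. a (fst z, h *\<^sub>R snd z)) z) = ?c * norm (partials bs a (fst z, h *\<^sub>R snd z))"
    using c by (simp add: smooth_rescale_p(2)[OF a bs(1)])
  also have "\<dots> \<le> norm (partials bs a (fst z, h *\<^sub>R snd z))"
    using c by (intro mult_left_le_one_le) auto
  also have "\<dots> \<le> A * prod_list (map W bs)" by (rule jet_boundD[OF j bs])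
  finally show "norm (partials bs (\<lambda>z. a (fst z, h *\<^sub>R snd z)) z) \<le> A * prod_list (map W bs)" .
qed

lemma cutoff_support:
  fixes \<epsilon> :: "'a::euclidean_space \<Rightarrow> real"
  assumes "\<And>b. b \<in> Basis \<Longrightarrow> 0 < \<epsilon> b"
  shows "\<exists>R. \<forall>z. norm z > R \<longrightarrow> cutoff \<epsilon> z = 0"
proof (intro exI allI impI)
  fix z :: 'a assume z: "norm z > (\<Sum>b\<in>Basis. 1 / \<epsilon> b)"
  have "\<exists>b\<in>Basis. \<bar>z \<bullet> b\<bar> > 1 / \<epsilon> b"
  proof (rule ccontr)
    assume "\<not> (\<exists>b\<in>Basis. \<bar>z \<bullet> b\<bar> > 1 / \<epsilon> b)"
    then have "(\<Sum>b\<in>Basis. \<bar>z \<bullet> b\<bar>) \<le> (\<Sum>b\<in>Basis. 1 / \<epsilon> b)"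
      by (intro sum_mono) (auto simp: not_less)
    with norm_le_l1[of z] z show False by linarith
  qed
  then obtain b where b: "b \<in> Basis" "\<bar>z \<bullet> b\<bar> > 1 / \<epsilon> b" by auto
  have "\<bar>\<epsilon> b * (z \<bullet> b)\<bar> \<ge> 1"
    using b assms[OF b(1)] by (simp add: abs_mult field_simps)
  then have "bump (\<epsilon> b * (z \<bullet> b)) = 0" by (rule bump_eq_0)
  then show "cutoff \<epsilon> z = 0" unfolding cutoff_def using b(1) by (intro prod_zero) auto
qed

lemma cutoff_tendsto:
  fixes \<epsilon> :: "nat \<Rightarrow> 'a::euclidean_space \<Rightarrow> real"
  assumes "\<And>b. b \<in> Basis \<Longrightarrow> (\<lambda>k. \<epsilon> k b) \<longlonglongrightarrow> 0"
  shows "(\<lambda>k. cutoff (\<epsilon> k) z) \<longlonglongrightarrow> 1"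
proof -
  have "(\<lambda>k. \<Prod>b\<in>Basis. bump (\<epsilon> k b * (z \<bullet> b))) \<longlonglongrightarrow> (\<Prod>b\<in>(Basis::'a set). bump 0)"
  proof (rule tendsto_prod)
    fix b :: 'a assume b: "b \<in> Basis"
    have "isCont bump 0" using smoothD[OF smooth_bump] by (rule differentiable_imp_continuous_within)
    moreover have "(\<lambda>k. \<epsilon> k b * (z \<bullet> b)) \<longlonglongrightarrow> 0 * (z \<bullet> b)"
      by (intro tendsto_mult tendsto_const assms b)
    ultimately show "(\<lambda>k. bump (\<epsilon> k b * (z \<bullet> b))) \<longlonglongrightarrow> bump 0"
      using isCont_tendsto_compose[of 0 bump] by simp
  qed
  then show ?thesis by (simp add: cutoff_def bump_0)
qed

lemma integral_dilate:
  fixes g :: "'a::euclidean_space \<Rightarrow> complex"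
  assumes [measurable]: "g \<in> borel_measurable borel" and h: "h > 0"
  shows "(\<integral>p. g p \<partial>lborel) = of_real (h ^ DIM('a)) * (\<integral>p. g (h *\<^sub>R p) \<partial>lborel)"
proof -
  have "(\<integral>p. g p \<partial>lborel) = (\<integral>p. g p \<partial>density (distr lborel borel (\<lambda>x. 0 + h *\<^sub>R x)) (\<lambda>_. ennreal (\<bar>h\<bar> ^ DIM('a))))"
    by (subst lborel_affine[of h "0::'a"]) (use h in auto)
  also have "\<dots> = (\<integral>p. (h ^ DIM('a)) *\<^sub>R g p \<partial>distr lborel borel (\<lambda>x. 0 + h *\<^sub>R x))"
    using h by (subst integral_density) auto
  also have "\<dots> = (\<integral>p. (h ^ DIM('a)) *\<^sub>R g (0 + h *\<^sub>R p) \<partial>lborel)"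
    by (rule integral_distr) auto
  finally show ?thesis by (simp add: scaleR_conv_of_real)
qed

text \<open>The substitution \<open>h p\<close> for \<open>p\<close> in the outer integral cancels the powers of \<open>h\<close> in the
  normalization and in the phase and moves \<open>h\<close> into the symbol.\<close>

lemma Op_rescale:
  fixes a :: "'n::{finite,linorder} phase \<Rightarrow> complex"
  assumes a: "continuous_on UNIV a" and u [measurable]: "u \<in> borel_measurable borel" and h: "h > 0"
  shows "Op t h a u x = of_real (1 / (2 * pi) ^ CARD('n)) *
    (\<integral>p. \<integral>y. a (t *\<^sub>R x + (1 - t) *\<^sub>R y, h *\<^sub>R p) * exp (\<i> * of_real (p \<bullet> (x - y))) * u y \<partial>lborel \<partial>lborel)"
proof -
  let ?g = "\<lambda>p. \<integral>y. a (t *\<^sub>R x + (1 - t) *\<^sub>R y, p) * exp (\<i> * of_real (p \<bullet> (x - y) / h)) * u y \<partial>lborel"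
  have [measurable]: "(\<lambda>z. a (t *\<^sub>R x + (1 - t) *\<^sub>R snd z, fst z)) \<in> borel_measurable (borel \<Otimes>\<^sub>M borel)"
  proof -
    have "continuous_on UNIV (\<lambda>z. a (t *\<^sub>R x + (1 - t) *\<^sub>R snd z, fst z))"
      by (rule continuous_on_compose2[OF a]) (auto intro!: continuous_intros)
    then show ?thesis by (simp add: borel_prod borel_measurable_continuous_onI)
  qed
  have m: "?g \<in> borel_measurable borel" by measurable
  have "Op t h a u x = of_real (1 / (2 * pi * h) ^ CARD('n)) * (of_real (h ^ CARD('n)) * (\<integral>p. ?g (h *\<^sub>R p) \<partial>lborel))"
    unfolding Op_def using integral_dilate[OF m h] by simp
  also have "\<dots> = of_real (1 / (2 * pi * h) ^ CARD('n) * h ^ CARD('n)) * (\<integral>p. ?g (h *\<^sub>R p) \<partial>lborel)"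
    by (simp only: of_real_mult mult.assoc)
  also have "1 / (2 * pi * h) ^ CARD('n) * h ^ CARD('n) = 1 / (2 * pi) ^ CARD('n)"
    using h by (simp add: power_mult_distrib)
  also have "(\<integral>p. ?g (h *\<^sub>R p) \<partial>lborel) =
    (\<integral>p. \<integral>y. a (t *\<^sub>R x + (1 - t) *\<^sub>R y, h *\<^sub>R p) * exp (\<i> * of_real (p \<bullet> (x - y))) * u y \<partial>lborel \<partial>lborel)"
    using h by simp
  finally show ?thesis .
qed

text \<open>The operator for \<open>h = 1\<close>, as an iterated integral that may fail to converge absolutely.\<close>

definition quantize :: "real \<Rightarrow> ('n::finite phase \<Rightarrow> complex) \<Rightarrow> (real ^ 'n \<Rightarrow> complex) \<Rightarrow> real ^ 'n \<Rightarrow> complex"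
  where "quantize t a u x = of_real (1 / (2 * pi) ^ CARD('n)) *
    (\<integral>p. \<integral>y. a (t *\<^sub>R x + (1 - t) *\<^sub>R y, p) * exp (\<i> * of_real (p \<bullet> (x - y))) * u y \<partial>lborel \<partial>lborel)"

definition operator_constant :: "'n::{finite,linorder} itself \<Rightarrow> real"
  where "operator_constant _ = (\<Sum>\<kappa>\<in>(multi_exponents :: ('n \<Rightarrow> nat) set). term_mass \<kappa>) *
    (2 ^ CARD('n) * ((2 * pi) ^ CARD('n) * pi ^ CARD('n))) / (2 * pi) ^ CARD('n)"

lemma operator_constant_nonneg: "0 \<le> operator_constant TYPE('n::{finite,linorder})"
  unfolding operator_constant_def
  by (intro divide_nonneg_nonneg mult_nonneg_nonneg sum_nonneg term_mass_nonneg) auto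

lemma norm_integral_le:
  fixes f :: "'x \<Rightarrow> 'b::{banach, second_countable_topology}"
  assumes "integrable M f" "integrable M g" "\<And>x. norm (f x) \<le> g x"
  shows "norm (\<integral>x. f x \<partial>M) \<le> (\<integral>x. g x \<partial>M)"
  by (rule order_trans[OF Bochner_Integration.integral_norm_bound integral_mono]) (use assms in auto)

text \<open>For a compactly supported symbol the iterated integral may be rearranged into an integral kernel, and
  the bilinear estimate is applied with \<open>v\<close> the complex conjugate of the image itself. The image is
  restricted to a ball because its square integrability is not known beforehand, and the estimate
  has the square of its norm on both sides.\<close>

lemma quantize_compact_bound:
  fixes a :: "'n::{finite,linorder} phase \<Rightarrow> complex" and u :: "(real, 'n) vec \<Rightarrow> complex" and \<rho> t :: real
  assumes f_meas: "f \<in> borel_measurable borel" and f: "\<And>r. 1 \<le> f r"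
    and a: "smooth a" and R: "\<And>z. norm z > R \<Longrightarrow> a z = 0"
    and B: "\<And>z. jet_bound (4 * CARD('n)) (phase_weight (scale_vec f (fst z $ r_idx))) z B a"
    and u: "integrable lborel u" and u2: "integrable lborel (\<lambda>x. (norm (u x))\<^sup>2)" and t: "t \<in> {0..1}"
  defines "w \<equiv> \<lambda>x. indicat_real (cball 0 \<rho>) x *\<^sub>R quantize t a u x"
  shows "w \<in> borel_measurable borel"
    and "integrable lborel (\<lambda>x. (norm (w x))\<^sup>2)"
    and "(\<integral>x. (norm (w x))\<^sup>2 \<partial>lborel) \<le> (operator_constant TYPE('n) * B)\<^sup>2 * (\<integral>x. (norm (u x))\<^sup>2 \<partial>lborel)"
proof -
  obtain js :: "'n list" where js: "admissible_order js" "set js = UNIV" using admissible_order_exists by blast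
  have [measurable]: "u \<in> borel_measurable borel" using u by auto
  have [measurable]: "a \<in> borel_measurable (borel \<Otimes>\<^sub>M borel)"
    using borel_measurable_continuous_onI[OF smooth_continuous[OF a]] by (simp add: borel_prod)
  have aB: "norm (a z) \<le> B" for z by (rule jet_bound_norm[OF B])
  have B0: "0 \<le> B" using aB norm_ge_zero order_trans by blast
  have aR: "a (m, p) = 0" if "norm p > R" for m p
  proof -
    have "norm (m, p) > R" using that norm_snd_le[of p m] by linarith
    then show ?thesis by (rule R)
  qed
  let ?S = "lborel \<Otimes>\<^sub>M lborel :: ((real, 'n) vec \<times> (real, 'n) vec) measure"
  let ?K = "\<lambda>x y. \<integral>p. exp (\<i> * of_real (p \<bullet> (x - y))) * a (t *\<^sub>R x + (1 - t) *\<^sub>R y, p) \<partial>lborel"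
  let ?q = "\<lambda>x p y. a (t *\<^sub>R x + (1 - t) *\<^sub>R y, p) * exp (\<i> * of_real (p \<bullet> (x - y))) * u y"
  let ?vol = "measure lborel (cball (0 :: (real, 'n) vec) R)"
  let ?P = "(2 * pi) ^ CARD('n)"
  have P: "0 < ?P" by simp
  have Kb: "norm (?K x y) \<le> B * ?vol" for x y
  proof -
    have "norm (?K x y) \<le> (\<integral>p. B * indicat_real (cball (0 :: (real, 'n) vec) R) p \<partial>lborel)"
    proof (rule norm_integral_le)
      show "integrable lborel (\<lambda>p. B * indicat_real (cball (0 :: (real, 'n) vec) R) p)"
        by (intro integrable_mult_right integrable_indicator_cball)
      show le: "norm (exp (\<i> * of_real (p \<bullet> (x - y))) * a (t *\<^sub>R x + (1 - t) *\<^sub>R y, p)) \<le> B * indicat_real (cball 0 R) p" for p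
        using aB aR[of p] by (cases "norm p \<le> R") (auto simp: norm_mult)
      show "integrable lborel (\<lambda>p. exp (\<i> * of_real (p \<bullet> (x - y))) * a (t *\<^sub>R x + (1 - t) *\<^sub>R y, p))"
        by (rule integrable_bounded_support[where R = R and B = B]) (auto simp: norm_mult aB aR)
    qed
    then show ?thesis by simp
  qed
  have quantize_eq: "quantize t a u x = of_real (1 / ?P) * (\<integral>y. u y * ?K x y \<partial>lborel)" for x
  proof -
    have int: "integrable ?S (\<lambda>(p, y). ?q x p y)"
    proof (rule Bochner_Integration.integrable_bound)
      show "integrable ?S (\<lambda>w. (B * indicat_real (cball 0 R) (fst w)) * norm (u (snd w)))"
        by (intro lborel_pair.product_function_integrable integrable_mult_right integrable_indicator_cball integrable_norm u)
      show "AE w in ?S. norm (case w of (p, y) \<Rightarrow> ?q x p y) \<le> norm ((B * indicat_real (cball 0 R) (fst w)) * norm (u (snd w)))"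
      proof (rule AE_I2)
        fix w :: "(real, 'n) vec \<times> (real, 'n) vec"
        obtain p y where w: "w = (p, y)" by (cases w)
        show "norm (case w of (p, y) \<Rightarrow> ?q x p y) \<le> norm ((B * indicat_real (cball 0 R) (fst w)) * norm (u (snd w)))"
          using aB[of "(t *\<^sub>R x + (1 - t) *\<^sub>R y, p)"] aR[of p "t *\<^sub>R x + (1 - t) *\<^sub>R y"] B0
          by (cases "norm p \<le> R") (auto simp: w norm_mult mult_right_mono)
      qed
    qed measurable
    have "(\<integral>p. \<integral>y. ?q x p y \<partial>lborel \<partial>lborel) = (\<integral>y. \<integral>p. ?q x p y \<partial>lborel \<partial>lborel)"
      by (rule lborel_pair.Fubini_integral[OF int, symmetric])
    also have "\<dots> = (\<integral>y. u y * ?K x y \<partial>lborel)"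
      by (subst integral_mult_right_zero[symmetric]) (simp only: mult_ac)
    finally show ?thesis by (simp only: quantize_def)
  qed
  have w_eq: "w x = indicat_real (cball 0 \<rho>) x *\<^sub>R (of_real (1 / ?P) * (\<integral>y. u y * ?K x y \<partial>lborel))" for x
    by (simp only: w_def quantize_eq)
  have [measurable]: "cball (0 :: (real, 'n) vec) \<rho> \<in> sets borel" by simp
  show wm [measurable]: "w \<in> borel_measurable borel"
    unfolding w_eq[abs_def] by measurable
  have uK: "integrable lborel (\<lambda>y. u y * ?K x y)" for x
  proof (rule Bochner_Integration.integrable_bound)
    show "integrable lborel (\<lambda>y. norm (u y) * (B * ?vol))" by (intro integrable_mult_left integrable_norm u)
    show "AE y in lborel. norm (u y * ?K x y) \<le> norm (norm (u y) * (B * ?vol))"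
      using B0 Kb by (intro AE_I2) (simp add: norm_mult mult_left_mono abs_of_nonneg)
  qed measurable
  obtain Cw where Cw: "\<And>x. norm (w x) \<le> Cw"
  proof
    fix x
    have "norm (\<integral>y. u y * ?K x y \<partial>lborel) \<le> (\<integral>y. norm (u y) * (B * ?vol) \<partial>lborel)"
      by (intro norm_integral_le uK integrable_mult_left integrable_norm u) (simp add: norm_mult mult_left_mono Kb)
    then have "norm (of_real (1 / ?P) * (\<integral>y. u y * ?K x y \<partial>lborel)) \<le> 1 / ?P * (\<integral>y. norm (u y) * (B * ?vol) \<partial>lborel)"
      unfolding norm_mult norm_of_real using P by (intro mult_mono) auto
    moreover have "norm (w x) \<le> norm (of_real (1 / ?P) * (\<integral>y. u y * ?K x y \<partial>lborel))"
      unfolding w_eq by (simp add: indicator_def)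
    ultimately show "norm (w x) \<le> 1 / ?P * (\<integral>y. norm (u y) * (B * ?vol) \<partial>lborel)" by linarith
  qed
  have w0: "w x = 0" if "norm x > \<rho>" for x using that by (simp add: w_def)
  have iw: "integrable lborel w" by (rule integrable_bounded_support[OF wm Cw w0])
  show iw2: "integrable lborel (\<lambda>x. (norm (w x))\<^sup>2)"
  proof (rule integrable_bounded_support[where R = \<rho> and B = "Cw\<^sup>2"])
    show "norm ((norm (w x))\<^sup>2) \<le> Cw\<^sup>2" for x using Cw[of x] by (simp add: power_mono)
    show "(norm (w x))\<^sup>2 = 0" if "norm x > \<rho>" for x using w0[OF that] by simp
  qed measurable
  let ?nu = "\<integral>x. (norm (u x))\<^sup>2 \<partial>lborel" and ?nw = "\<integral>x. (norm (w x))\<^sup>2 \<partial>lborel"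
  let ?v = "\<lambda>x. cnj (w x)"
  have iv: "integrable lborel ?v" using iw by simp
  have [measurable]: "cnj \<in> borel_measurable borel"
    by (intro borel_measurable_continuous_onI continuous_intros)
  have pair: "(\<integral>s. ?v (fst s) * u (snd s) * ?K (fst s) (snd s) \<partial>?S) = of_real (?P * ?nw)"
  proof -
    have int: "integrable ?S (\<lambda>s. ?v (fst s) * u (snd s) * ?K (fst s) (snd s))"
    proof (rule Bochner_Integration.integrable_bound)
      show "integrable ?S (\<lambda>s. norm (?v (fst s) * u (snd s)) * (B * ?vol))"
        by (intro integrable_mult_left integrable_norm lborel_pair.product_function_integrable iv u)
      show "AE s in ?S. norm (?v (fst s) * u (snd s) * ?K (fst s) (snd s)) \<le> norm (norm (?v (fst s) * u (snd s)) * (B * ?vol))"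
      proof (rule AE_I2)
        fix s :: "(real, 'n) vec \<times> (real, 'n) vec"
        have "norm (?v (fst s) * u (snd s)) * norm (?K (fst s) (snd s)) \<le> norm (?v (fst s) * u (snd s)) * (B * ?vol)"
          by (intro mult_left_mono Kb norm_ge_zero)
        then show "norm (?v (fst s) * u (snd s) * ?K (fst s) (snd s)) \<le> norm (norm (?v (fst s) * u (snd s)) * (B * ?vol))"
          unfolding norm_mult[of "?v (fst s) * u (snd s)"] real_norm_def by (rule order_trans[OF _ abs_ge_self])
      qed
    qed measurable
    have "(\<integral>s. ?v (fst s) * u (snd s) * ?K (fst s) (snd s) \<partial>?S) = (\<integral>x. \<integral>y. ?v x * u y * ?K x y \<partial>lborel \<partial>lborel)"
      using lborel_pair.integral_fst'[OF int] by (simp only: fst_conv snd_conv)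
    also have "\<dots> = (\<integral>x. ?v x * (\<integral>y. u y * ?K x y \<partial>lborel) \<partial>lborel)"
      by (simp only: mult.assoc integral_mult_right_zero)
    also have "\<dots> = (\<integral>x. complex_of_real (?P * (norm (w x))\<^sup>2) \<partial>lborel)"
    proof (rule Bochner_Integration.integral_cong[OF refl])
      fix x :: "(real, 'n) vec"
      show "?v x * (\<integral>y. u y * ?K x y \<partial>lborel) = complex_of_real (?P * (norm (w x))\<^sup>2)"
      proof (cases "norm x \<le> \<rho>")
        case True
        then have "w x = of_real (1 / ?P) * (\<integral>y. u y * ?K x y \<partial>lborel)" by (simp add: w_eq)
        then have "(\<integral>y. u y * ?K x y \<partial>lborel) = of_real ?P * w x" using P by simp
        then show ?thesis
          unfolding of_real_mult complex_norm_square by (simp only: mult_ac)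
      next
        case False
        then show ?thesis using w0[of x] by simp
      qed
    qed
    also have "\<dots> = of_real (?P * ?nw)" by (simp only: integral_complex_of_real integral_mult_right_zero)
    finally show ?thesis .
  qed
  have iv2: "integrable lborel (\<lambda>x. (norm (?v x))\<^sup>2)" using iw2 by simp
  let ?\<Gamma> = "(\<Sum>\<kappa>\<in>(multi_exponents :: ('n \<Rightarrow> nat) set). term_mass \<kappa>) * (2 ^ CARD('n) * B / 2 * (?P * pi ^ CARD('n)))"
  let ?C = "operator_constant TYPE('n) * B"
  have C: "?C * ?P = 2 * ?\<Gamma>" using P by (simp add: operator_constant_def)
  have C0: "0 \<le> ?C" using operator_constant_nonneg[where 'n='n] B0 by simp
  \<comment> \<open>\<open>?nw\<close> stands on both sides, on the right divided by a parameter that is still free\<close>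
  have key: "?P * ?nw \<le> ?\<Gamma> * (c * ?nu + ?nw / c)" if "c > 0" for c
  proof -
    have "0 \<le> ?P * ?nw" by (intro mult_nonneg_nonneg) auto
    then have "?P * ?nw = norm (complex_of_real (?P * ?nw))" by (simp only: norm_of_real abs_of_nonneg)
    also have "\<dots> \<le> ?\<Gamma> * (c * ?nu + ?nw / c)"
      using pairing_bound[OF f_meas f js a R B u iv u2 iv2 that t] unfolding pair by simp
    finally show ?thesis .
  qed
  have nu: "0 \<le> ?nu" and nw: "0 \<le> ?nw" by auto
  show "?nw \<le> ?C\<^sup>2 * ?nu"
  proof (cases "?C = 0")
    case True
    then have "2 * ?\<Gamma> = 0" using C by (simp only: mult_zero_left)
    moreover have "x = 0" if "2 * x = 0" for x :: real using that by simp
    ultimately have "?\<Gamma> = 0" by blast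
    then have "?P * ?nw \<le> 0" using key[OF zero_less_one] by (simp only: mult_zero_left)
    moreover have "n \<le> 0" if "p * n \<le> 0" "0 < p" for p n :: real
      using that by (simp add: mult_le_0_iff)
    ultimately have "?nw \<le> 0" using P by blast
    then show ?thesis unfolding True by simp
  next
    case False
    then have Cpos: "?C > 0" using C0 by linarith
    \<comment> \<open>with \<open>c\<close> equal to the operator bound, half of the right-hand side is absorbed on the left\<close>
    have "2 * (?P * ?nw) \<le> 2 * (?\<Gamma> * (?C * ?nu + ?nw / ?C))"
      by (intro mult_left_mono key Cpos) simp
    also have "\<dots> = (?C * ?P) * (?C * ?nu + ?nw / ?C)"
      unfolding C by (simp only: mult.assoc)
    also have "\<dots> = ?P * (?C\<^sup>2 * ?nu + ?nw)"
    proof -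
      have "(c * p) * (c * r + s / c) = p * (c\<^sup>2 * r + s)" if "c > 0" for c p r s :: real
        using that by (simp add: field_simps power2_eq_square)
      from this[OF Cpos] show ?thesis .
    qed
    finally have "2 * ?nw \<le> ?C\<^sup>2 * ?nu + ?nw" using P by (simp add: mult.left_commute[of 2])
    then show ?thesis by simp
  qed
qed

text \<open>Multiplication by the product of the \<open>1 + (s $ j)\<^sup>2\<close> expands into monomials with even exponents at most
  two, each of which turns into derivatives of \<open>g\<close>.\<close>

lemma wave_integral_decay:
  fixes g :: "(real, 'n::{finite,linorder}) vec \<Rightarrow> complex"
  assumes g: "smooth g" and R: "\<And>y. norm y > R \<Longrightarrow> g y = 0"
    and A: "\<And>bs y. set bs \<subseteq> Basis \<Longrightarrow> length bs \<le> 2 * CARD('n) \<Longrightarrow> norm (partials bs g y) \<le> A"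
  shows "norm (\<integral>y. exp (\<i> * of_real (y \<bullet> s)) * g y \<partial>lborel) \<le>
    real (card (PiE (UNIV :: 'n set) (\<lambda>_. {..1::nat}))) * (A * measure lborel (cball (0 :: (real, 'n) vec) R)) * (\<Prod>j\<in>UNIV. 1 / (1 + (s $ j)\<^sup>2))"
proof -
  let ?I = "\<integral>y. exp (\<i> * complex_of_real (y \<bullet> s)) * g y \<partial>lborel" and ?V = "measure lborel (cball (0 :: (real, 'n) vec) R)"
  let ?E = "PiE (UNIV :: 'n set) (\<lambda>_. {..1::nat})"
  obtain js :: "'n list" where js: "distinct js" "set js = UNIV" using finite_distinct_list[of "UNIV :: 'n set"] by auto
  have each: "(\<Prod>j\<in>UNIV. ((s $ j)\<^sup>2) ^ \<kappa> j) * norm ?I \<le> A * ?V" if \<kappa>: "\<kappa> \<in> ?E" for \<kappa>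
  proof -
    let ?w = "exponent_word js (\<lambda>j. 2 * \<kappa> j)"
    let ?bs = "map (\<lambda>j. axis j (1::real)) ?w"
    have bs: "set ?bs \<subseteq> Basis" by auto
    have "(\<lambda>j. 2 * \<kappa> j) \<in> multi_exponents" using \<kappa> by (auto simp: multi_exponents_def PiE_iff)
    then have len: "length ?bs \<le> 2 * CARD('n)" using length_exponent_word(1)[OF js] by simp
    have "prod_list (map (\<lambda>b. s \<bullet> b) ?bs) = prod_list (map (\<lambda>j. s $ j) ?w)" by (simp add: comp_def inner_axis)
    also have "\<dots> = (\<Prod>j\<in>UNIV. (s $ j) ^ (2 * \<kappa> j))" by (rule prod_list_exponent_word[OF js])
    also have "\<dots> = (\<Prod>j\<in>UNIV. ((s $ j)\<^sup>2) ^ \<kappa> j)" by (simp only: power_mult)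
    finally have pr: "prod_list (map (\<lambda>b. s \<bullet> b) ?bs) = (\<Prod>j\<in>UNIV. ((s $ j)\<^sup>2) ^ \<kappa> j)" .
    have nn: "0 \<le> (\<Prod>j\<in>UNIV. ((s $ j)\<^sup>2) ^ \<kappa> j)" by (intro prod_nonneg) simp
    have "(\<Prod>j\<in>UNIV. ((s $ j)\<^sup>2) ^ \<kappa> j) * norm ?I = norm (of_real (prod_list (map (\<lambda>b. s \<bullet> b) ?bs)) * ?I)"
      unfolding pr norm_mult norm_of_real using nn by simp
    also have "\<dots> = norm (\<integral>y. exp (\<i> * of_real (y \<bullet> s)) * (\<i> ^ length ?bs * partials ?bs g y) \<partial>lborel)"
      by (subst wave_integral_by_parts_list[OF g R bs]) simp_all
    also have "\<dots> \<le> (\<integral>y. A * indicat_real (cball (0 :: (real, 'n) vec) R) y \<partial>lborel)"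
    proof (rule norm_integral_le)
      show "integrable lborel (\<lambda>y. A * indicat_real (cball (0 :: (real, 'n) vec) R) y)"
        by (intro integrable_mult_right integrable_indicator_cball)
      have z: "partials ?bs g y = 0" if "norm y > R" for y by (rule partial_zero_outside[OF R that])
      show "norm (exp (\<i> * of_real (y \<bullet> s)) * (\<i> ^ length ?bs * partials ?bs g y)) \<le> A * indicat_real (cball 0 R) y" for y
        using A[OF bs len, of y] z[of y] by (cases "norm y \<le> R") (auto simp: norm_mult norm_power)
      have "continuous_on UNIV (\<lambda>y. exp (\<i> * of_real (y \<bullet> s)) * (\<i> ^ length ?bs * partials ?bs g y))"
        by (intro continuous_intros smooth_continuous smooth_partials g bs)
      then show "integrable lborel (\<lambda>y. exp (\<i> * of_real (y \<bullet> s)) * (\<i> ^ length ?bs * partials ?bs g y))"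
        by (rule integrable_continuous_support[where R = R]) (simp add: z)
    qed
    also have "\<dots> = A * ?V" by simp
    finally show ?thesis .
  qed
  have pos: "0 < (\<Prod>j\<in>UNIV. 1 + (s $ j)\<^sup>2)" by (intro prod_pos) (simp add: add_pos_nonneg)
  have "(\<Prod>j\<in>UNIV. 1 + (s $ j)\<^sup>2) = (\<Prod>j\<in>UNIV. \<Sum>k\<in>{..1}. ((s $ j)\<^sup>2) ^ k)" by simp
  also have "\<dots> = (\<Sum>\<kappa>\<in>?E. \<Prod>j\<in>UNIV. ((s $ j)\<^sup>2) ^ \<kappa> j)" by (rule prod_sum_PiE) auto
  finally have "(\<Prod>j\<in>UNIV. 1 + (s $ j)\<^sup>2) * norm ?I = (\<Sum>\<kappa>\<in>?E. (\<Prod>j\<in>UNIV. ((s $ j)\<^sup>2) ^ \<kappa> j) * norm ?I)"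
    by (simp only: sum_distrib_right)
  also have "\<dots> \<le> (\<Sum>\<kappa>\<in>?E. A * ?V)" by (rule sum_mono[OF each])
  also have "\<dots> = real (card ?E) * (A * ?V)" by simp
  finally have "norm ?I \<le> real (card ?E) * (A * ?V) / (\<Prod>j\<in>UNIV. 1 + (s $ j)\<^sup>2)"
    using pos by (simp add: pos_le_divide_eq mult.commute)
  then show ?thesis by (simp only: prod_dividef prod.neutral_const times_divide_eq_right mult_1_right)
qed

lemma integrable_prod_cauchy: "integrable lborel (\<lambda>p :: (real, 'n::finite) vec. \<Prod>j\<in>UNIV. 1 / (1 + (p $ j)\<^sup>2))"
proof -
  have "integrable lborel (\<lambda>p :: (real, 'n) vec. \<Prod>j\<in>UNIV. complex_of_real (1 / (1 + (p $ j)\<^sup>2)))"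
    by (rule product_vec_integrable) (use integrable_cauchy in \<open>simp only: complex_of_real_integrable_eq\<close>)
  then show ?thesis by (simp only: of_real_prod[symmetric] complex_of_real_integrable_eq)
qed

lemma smooth_amplitude:
  fixes a :: "'n::{finite,linorder} phase \<Rightarrow> complex"
  assumes a: "smooth a"
  shows "smooth (\<lambda>y. a (q + c *\<^sub>R y, p))"
    and "set bs \<subseteq> Basis \<Longrightarrow> partials bs (\<lambda>y. a (q + c *\<^sub>R y, p)) y = c ^ length bs *\<^sub>R partials (map (\<lambda>b. (b, 0)) bs) a (q + c *\<^sub>R y, p)"
proof -
  let ?T = "\<lambda>y :: (real, 'n) vec. (c *\<^sub>R y, 0 :: (real, 'n) vec)"
  have T: "bounded_linear ?T"
    by (intro bounded_linear_Pair bounded_linear_scaleR_right bounded_linear_zero)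
  have c: "?T b = c *\<^sub>R (b, 0)" for b by simp
  have B: "(b, 0) \<in> Basis" if "b \<in> Basis" for b :: "(real, 'n) vec" using that by (simp add: Basis_prod_def)
  show "smooth (\<lambda>y. a (q + c *\<^sub>R y, p))"
    using smooth_affine[OF T c B a, of "(q, p)"] by simp
  have "prod_list (map (\<lambda>_. c) bs) = c ^ length bs" by (induction bs) auto
  then show "set bs \<subseteq> Basis \<Longrightarrow> partials bs (\<lambda>y. a (q + c *\<^sub>R y, p)) y = c ^ length bs *\<^sub>R partials (map (\<lambda>b. (b, 0)) bs) a (q + c *\<^sub>R y, p)"
    using partials_affine[OF T c B a, of bs "(q, p)" y] by simp
qed

lemma continuous_bounded_interval:
  fixes f :: "real \<Rightarrow> real"
  assumes "continuous_on UNIV f"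
  shows "\<exists>F\<ge>1. \<forall>r. \<bar>r\<bar> \<le> \<rho> \<longrightarrow> f r \<le> F"
proof -
  have "bounded (f ` {-\<rho>..\<rho>})"
    by (intro compact_imp_bounded compact_continuous_image continuous_on_subset[OF assms]) auto
  then obtain F where F: "\<And>r. r \<in> {-\<rho>..\<rho>} \<Longrightarrow> norm (f r) \<le> F"
    unfolding bounded_iff by blast
  have "f r \<le> max F 1" if "\<bar>r\<bar> \<le> \<rho>" for r
    using F[of r] that by (auto simp: abs_le_iff)
  then show ?thesis by (intro exI[of _ "max F 1"]) auto
qed

text \<open>On the support of \<open>u\<close> the point \<open>t x + (1 - t) y\<close> stays within distance \<open>norm x + Ru\<close> of the origin,
  where \<open>f\<close> and hence all weights are at most \<open>F\<close>.\<close>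

lemma amplitude_derivative_bound:
  fixes a :: "'n::{finite,linorder} phase \<Rightarrow> complex" and u :: "(real, 'n) vec \<Rightarrow> complex"
  assumes a: "smooth a" and fF: "\<And>r. 1 \<le> f r" "1 \<le> F" "\<And>r. \<bar>r\<bar> \<le> norm x + Ru \<Longrightarrow> f r \<le> F"
    and B: "\<And>z. jet_bound L (phase_weight (scale_vec f (fst z $ r_idx))) z B a"
    and u: "smooth u" and Ru: "\<And>y. norm y > Ru \<Longrightarrow> u y = 0" and A: "\<And>y. jet_bound L (\<lambda>_. 1) y A u"
    and t: "t \<in> {0..1}" and bs: "set bs \<subseteq> Basis" "length bs \<le> L"
  shows "norm (partials bs (\<lambda>y. a (t *\<^sub>R x + (1 - t) *\<^sub>R y, p) * u y) y) \<le> 2 ^ L * (B * A) * F ^ L"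
proof -
  let ?\<alpha> = "\<lambda>y. a (t *\<^sub>R x + (1 - t) *\<^sub>R y, p)"
  have s\<alpha>: "smooth ?\<alpha>" by (rule smooth_amplitude(1)[OF a])
  have A0: "0 \<le> A" and B0: "0 \<le> B" using jet_bound_norm[OF A] jet_bound_norm[OF B] norm_ge_zero order_trans by blast+
  have nn: "0 \<le> 2 ^ L * (B * A) * F ^ L" using A0 B0 fF(2) by simp
  show ?thesis
  proof (cases "norm y > Ru")
    case True
    have "?\<alpha> y * u y = 0" if "norm y > Ru" for y using Ru[OF that] by simp
    from partial_zero_outside[of Ru "\<lambda>y. ?\<alpha> y * u y", OF this True] show ?thesis using nn by simp
  next
    case False
    let ?m = "t *\<^sub>R x + (1 - t) *\<^sub>R y"
    have "norm ?m \<le> t * norm x + (1 - t) * norm y" using t by (intro order_trans[OF norm_triangle_ineq]) auto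
    also have "\<dots> \<le> 1 * norm x + 1 * Ru" using t False by (intro add_mono mult_mono) auto
    finally have "\<bar>?m $ r_idx\<bar> \<le> norm x + Ru" using component_le_norm_cart[of ?m r_idx] by linarith
    then have fm: "f (?m $ r_idx) \<le> F" by (rule fF(3))
    have j\<alpha>: "jet_bound L (\<lambda>_. F) y B ?\<alpha>"
      unfolding jet_bound_def
    proof (intro allI impI)
      fix cs :: "(real, 'n) vec list" assume cs: "set cs \<subseteq> Basis" "length cs \<le> L"
      let ?W = "phase_weight (scale_vec f (?m $ r_idx))"
      have cs': "set (map (\<lambda>b. (b, 0)) cs) \<subseteq> (Basis :: 'n phase set)" using cs(1) by (auto simp: Basis_prod_def)
      have "norm (partials cs ?\<alpha> y) = \<bar>1 - t\<bar> ^ length cs * norm (partials (map (\<lambda>b. (b, 0)) cs) a (?m, p))"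
        by (simp add: smooth_amplitude(2)[OF a cs(1)] power_abs)
      also have "\<dots> \<le> 1 * norm (partials (map (\<lambda>b. (b, 0)) cs) a (?m, p))"
        using t by (intro mult_right_mono power_le_one) auto
      also have "\<dots> \<le> B * prod_list (map ?W (map (\<lambda>b. (b, 0)) cs))"
        using jet_boundD[OF B[of "(?m, p)"] cs'] cs(2) by simp
      also have "\<dots> \<le> B * prod_list (map (\<lambda>_. F) cs)"
      proof -
        have "0 \<le> prod_list (map ?W (map (\<lambda>b. (b, 0)) cs)) \<and> prod_list (map ?W (map (\<lambda>b. (b, 0)) cs)) \<le> prod_list (map (\<lambda>_. F) cs)"
          using cs(1)
        proof (induction cs)
          case (Cons b cs)
          then obtain j where "b = axis j 1" by (auto simp: Basis_vec_def)
          then have "?W (b, 0) = scale_vec f (?m $ r_idx) j" by (simp add: phase_weight_q)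
          then have "0 \<le> ?W (b, 0)" "?W (b, 0) \<le> F"
            using fm fF(1)[of "?m $ r_idx"] fF(2) by (auto simp: scale_vec_def)
          then show ?case using Cons fF(2) by (auto intro!: mult_mono)
        qed simp
        then show ?thesis using B0 by (intro mult_left_mono) auto
      qed
      finally show "norm (partials cs ?\<alpha> y) \<le> B * prod_list (map (\<lambda>_. F) cs)" .
    qed
    have ju: "jet_bound L (\<lambda>_. F) y A u"
      by (rule jet_bound_mono_weight[OF A]) (use fF(2) in auto)
    have "norm (partials bs (\<lambda>y. ?\<alpha> y * u y) y) \<le> 2 ^ L * (B * A) * prod_list (map (\<lambda>_. F) bs)"
      by (rule jet_boundD[OF jet_bound_mult[OF j\<alpha> ju s\<alpha> u] bs])
    also have "prod_list (map (\<lambda>_. F) bs) = F ^ length bs" by (induction bs) auto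
    also have "2 ^ L * (B * A) * F ^ length bs \<le> 2 ^ L * (B * A) * F ^ L"
      using bs(2) fF(2) A0 B0 by (intro mult_left_mono power_increasing) auto
    finally show ?thesis .
  qed
qed

text \<open>The inner integral converges by dominated convergence. For the outer one, integration by parts in \<open>y\<close>,
  with \<open>x\<close> fixed and derivatives falling on the symbol and on \<open>u\<close>, provides a bound that is
  integrable in \<open>p\<close> and the same for all approximating symbols.\<close>

lemma quantize_tendsto:
  fixes b :: "'n::{finite,linorder} phase \<Rightarrow> complex" and u :: "(real, 'n) vec \<Rightarrow> complex"
  assumes f: "continuous_on UNIV f" "\<And>r. 1 \<le> f r"
    and a: "\<And>k. smooth (a k)" and B: "\<And>k z. jet_bound (2 * CARD('n)) (phase_weight (scale_vec f (fst z $ r_idx))) z B (a k)"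
    and lim: "\<And>z. (\<lambda>k. a k z) \<longlonglongrightarrow> b z" and b: "continuous_on UNIV b"
    and u: "smooth u" and Ru: "\<And>y. norm y > Ru \<Longrightarrow> u y = 0" and t: "t \<in> {0..1}"
  shows "(\<lambda>k. quantize t (a k) u x) \<longlonglongrightarrow> quantize t b u x"
proof -
  let ?m = "\<lambda>y. t *\<^sub>R x + (1 - t) *\<^sub>R y"
  let ?q = "\<lambda>c p y. c (?m y, p) * exp (\<i> * complex_of_real (p \<bullet> (x - y))) * u y"
  have um [measurable]: "u \<in> borel_measurable borel"
    by (rule borel_measurable_continuous_onI[OF smooth_continuous[OF u]])
  have iu: "integrable lborel u" by (rule integrable_continuous_support[OF smooth_continuous[OF u] Ru])
  have cm: "(\<lambda>z. c (?m (snd z), fst z)) \<in> borel_measurable (borel \<Otimes>\<^sub>M borel)" if c: "continuous_on UNIV c" for c :: "'n phase \<Rightarrow> complex"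
  proof -
    have "continuous_on UNIV (\<lambda>z. c (?m (snd z), fst z))"
      by (rule continuous_on_compose2[OF c]) (auto intro!: continuous_intros)
    then show ?thesis by (simp add: borel_prod borel_measurable_continuous_onI)
  qed
  have [measurable]: "(\<lambda>z. a k (?m (snd z), fst z)) \<in> borel_measurable (borel \<Otimes>\<^sub>M borel)" for k
    by (rule cm[OF smooth_continuous[OF a]])
  have [measurable]: "(\<lambda>z. b (?m (snd z), fst z)) \<in> borel_measurable (borel \<Otimes>\<^sub>M borel)"
    by (rule cm[OF b])
  have slice: "(\<lambda>y. c (?m y, p)) \<in> borel_measurable borel" if c: "continuous_on UNIV c" for c :: "'n phase \<Rightarrow> complex" and p
    by (rule borel_measurable_continuous_onI, rule continuous_on_compose2[OF c]) (auto intro!: continuous_intros)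
  note [measurable] = slice[OF smooth_continuous[OF a]] slice[OF b]
  have aB: "norm (a k z) \<le> B" for k z by (rule jet_bound_norm[OF B])
  have inner: "(\<lambda>k. \<integral>y. ?q (a k) p y \<partial>lborel) \<longlonglongrightarrow> (\<integral>y. ?q b p y \<partial>lborel)" for p
  proof (rule integral_dominated_convergence[where w = "\<lambda>y. B * norm (u y)"])
    show "integrable lborel (\<lambda>y. B * norm (u y))" by (intro integrable_mult_right integrable_norm iu)
    show "AE y in lborel. (\<lambda>k. ?q (a k) p y) \<longlonglongrightarrow> ?q b p y"
      by (intro AE_I2 tendsto_intros lim)
    show "AE y in lborel. norm (?q (a k) p y) \<le> B * norm (u y)" for k
      using aB by (intro AE_I2) (auto simp: norm_mult intro!: mult_right_mono)
  qed measurable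
  obtain F where F: "F \<ge> 1" "\<And>r. \<bar>r\<bar> \<le> norm x + Ru \<Longrightarrow> f r \<le> F"
    using continuous_bounded_interval[OF f(1)] by blast
  let ?L = "2 * CARD('n)"
  obtain A where A: "\<And>y. jet_bound ?L (\<lambda>_. 1) y A u"
    using compact_support_jet_bound[OF u Ru, where L = ?L] by blast
  let ?D = "real (card (PiE (UNIV :: 'n set) (\<lambda>_. {..1::nat}))) * ((2 ^ ?L * (B * A) * F ^ ?L) * measure lborel (cball (0 :: (real, 'n) vec) Ru))"
  have decay: "norm (\<integral>y. ?q (a k) p y \<partial>lborel) \<le> ?D * (\<Prod>j\<in>UNIV. 1 / (1 + (p $ j)\<^sup>2))" for k p
  proof -
    let ?g = "\<lambda>y. a k (?m y, p) * u y"
    have "exp (\<i> * complex_of_real (p \<bullet> (x - y))) = exp (\<i> * of_real (p \<bullet> x)) * exp (\<i> * of_real (y \<bullet> (- p)))" for y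
      by (simp add: exp_add[symmetric] inner_diff_right inner_commute[of y] algebra_simps)
    then have "(\<integral>y. ?q (a k) p y \<partial>lborel) = (\<integral>y. exp (\<i> * of_real (p \<bullet> x)) * (exp (\<i> * of_real (y \<bullet> (- p))) * ?g y) \<partial>lborel)"
      by (simp only: mult_ac)
    also have "\<dots> = exp (\<i> * of_real (p \<bullet> x)) * (\<integral>y. exp (\<i> * of_real (y \<bullet> (- p))) * ?g y \<partial>lborel)"
      by (rule integral_mult_right_zero)
    finally have "norm (\<integral>y. ?q (a k) p y \<partial>lborel) = norm (\<integral>y. exp (\<i> * of_real (y \<bullet> (- p))) * ?g y \<partial>lborel)"
      by (simp only: norm_mult norm_exp_i_times mult_1_left)
    also have "\<dots> \<le> ?D * (\<Prod>j\<in>UNIV. 1 / (1 + ((- p) $ j)\<^sup>2))"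
    proof (rule wave_integral_decay)
      show "smooth ?g" by (intro smooth_mult smooth_amplitude a u)
      show "?g y = 0" if "norm y > Ru" for y using Ru[OF that] by simp
      show "norm (partials bs ?g y) \<le> 2 ^ ?L * (B * A) * F ^ ?L" if "set bs \<subseteq> Basis" "length bs \<le> 2 * CARD('n)" for bs y
        by (rule amplitude_derivative_bound[OF a f(2) F B u Ru A t that])
    qed
    finally show ?thesis by simp
  qed
  have "(\<lambda>k. \<integral>p. \<integral>y. ?q (a k) p y \<partial>lborel \<partial>lborel) \<longlonglongrightarrow> (\<integral>p. \<integral>y. ?q b p y \<partial>lborel \<partial>lborel)"
  proof (rule integral_dominated_convergence[where w = "\<lambda>p. ?D * (\<Prod>j\<in>UNIV. 1 / (1 + (p $ j)\<^sup>2))"])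
    show "integrable lborel (\<lambda>p :: (real, 'n) vec. ?D * (\<Prod>j\<in>UNIV. 1 / (1 + (p $ j)\<^sup>2)))"
      by (intro integrable_mult_right integrable_prod_cauchy)
    show "AE p in lborel. (\<lambda>k. \<integral>y. ?q (a k) p y \<partial>lborel) \<longlonglongrightarrow> (\<integral>y. ?q b p y \<partial>lborel)"
      by (intro AE_I2 inner)
    show "AE p in lborel. norm (\<integral>y. ?q (a k) p y \<partial>lborel) \<le> ?D * (\<Prod>j\<in>UNIV. 1 / (1 + (p $ j)\<^sup>2))" for k
      by (intro AE_I2 decay)
  qed measurable
  then show ?thesis unfolding quantize_def by (intro tendsto_mult tendsto_const)
qed

lemma L2_fatou:
  fixes w :: "nat \<Rightarrow> 'a::euclidean_space \<Rightarrow> complex"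
  assumes m [measurable]: "\<And>k. w k \<in> borel_measurable borel" and i: "\<And>k. integrable lborel (\<lambda>x. (norm (w k x))\<^sup>2)"
    and D: "\<And>k. (\<integral>x. (norm (w k x))\<^sup>2 \<partial>lborel) \<le> D" and lim: "\<And>x. (\<lambda>k. w k x) \<longlonglongrightarrow> v x"
  shows "v \<in> borel_measurable borel" "integrable lborel (\<lambda>x. (norm (v x))\<^sup>2)" "(\<integral>x. (norm (v x))\<^sup>2 \<partial>lborel) \<le> D"
proof -
  show vm [measurable]: "v \<in> borel_measurable borel" by (rule borel_measurable_LIMSEQ_metric[OF m lim])
  have D0: "0 \<le> D" using D[of 0] by (rule order_trans[rotated]) simp
  have "(\<integral>\<^sup>+x. ennreal ((norm (v x))\<^sup>2) \<partial>lborel) = (\<integral>\<^sup>+x. liminf (\<lambda>k. ennreal ((norm (w k x))\<^sup>2)) \<partial>lborel)"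
    by (intro nn_integral_cong lim_imp_Liminf[symmetric] tendsto_ennrealI tendsto_power tendsto_norm lim) auto
  also have "\<dots> \<le> liminf (\<lambda>k. \<integral>\<^sup>+x. ennreal ((norm (w k x))\<^sup>2) \<partial>lborel)"
    by (rule nn_integral_liminf) measurable
  also have "\<dots> \<le> ennreal D"
  proof (intro Liminf_le always_eventually allI)
    fix k
    have "(\<integral>\<^sup>+x. ennreal ((norm (w k x))\<^sup>2) \<partial>lborel) = ennreal (\<integral>x. (norm (w k x))\<^sup>2 \<partial>lborel)"
      by (rule nn_integral_eq_integral[OF i]) simp
    then show "(\<integral>\<^sup>+x. ennreal ((norm (w k x))\<^sup>2) \<partial>lborel) \<le> ennreal D" using D by (simp add: ennreal_leI)
  qed simp
  finally have le: "(\<integral>\<^sup>+x. ennreal ((norm (v x))\<^sup>2) \<partial>lborel) \<le> ennreal D" .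
  show iv: "integrable lborel (\<lambda>x. (norm (v x))\<^sup>2)"
    by (rule integrableI_nonneg) (use le in \<open>auto simp: le_less_trans\<close>)
  have "ennreal (\<integral>x. (norm (v x))\<^sup>2 \<partial>lborel) \<le> ennreal D"
    using le by (subst nn_integral_eq_integral[OF iv, symmetric]) auto
  then show "(\<integral>x. (norm (v x))\<^sup>2 \<partial>lborel) \<le> D" using D0 by simp
qed

text \<open>The cutoff has size \<open>Suc k\<close> in \<open>q\<close> but \<open>Suc k * F k\<close> in \<open>p\<close>, the directions with \<open>fst b = 0\<close>, where \<open>F k\<close> bounds \<open>f\<close> on the support of
  the cutoff in \<open>q\<close>: differentiating it in \<open>p\<close> must not cost more than the weight \<open>1 / f r\<close>.
  \<open>Suc k\<close> avoids division by zero.\<close>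

definition cutoff_scale :: "(nat \<Rightarrow> real) \<Rightarrow> nat \<Rightarrow> 'n::finite phase \<Rightarrow> real"
  where "cutoff_scale F k b = 1 / (real (Suc k) * (if fst b = 0 then F k else 1))"

lemma cutoff_scale_tendsto:
  assumes F: "\<And>k. 1 \<le> F k"
  shows "(\<lambda>k. cutoff_scale F k b) \<longlonglongrightarrow> 0"
proof (rule tendsto_sandwich[of "\<lambda>_. 0" _ _ "\<lambda>k. 1 / real (Suc k)"])
  have "0 \<le> cutoff_scale F k b \<and> cutoff_scale F k b \<le> 1 / real (Suc k)" for k
  proof -
    have "real (Suc k) * 1 \<le> real (Suc k) * (if fst b = 0 then F k else 1)"
      using F[of k] by (intro mult_left_mono) auto
    then show ?thesis unfolding cutoff_scale_def by (auto intro!: divide_left_mono)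
  qed
  then show "\<forall>\<^sub>F k in sequentially. 0 \<le> cutoff_scale F k b" "\<forall>\<^sub>F k in sequentially. cutoff_scale F k b \<le> 1 / real (Suc k)"
    by (auto intro!: always_eventually)
qed (rule tendsto_const, rule LIMSEQ_Suc[OF lim_1_over_n])

text \<open>If \<open>\<bar>r\<bar>\<close> exceeds \<open>Suc k\<close>, the factor of the cutoff in \<open>r\<close> vanishes near the point; otherwise \<open>f r \<le> F k\<close>.\<close>

lemma cutoff_scale_admissible:
  fixes z :: "'n::{finite,linorder} phase"
  assumes F: "\<And>k. 1 \<le> F k" "\<And>k r. \<bar>r\<bar> \<le> real (Suc k) \<Longrightarrow> f r \<le> F k" and f: "\<And>r. 1 \<le> f r"
  shows "(\<forall>b\<in>Basis. cutoff_scale F k b \<le> phase_weight (scale_vec f (fst z $ r_idx)) b) \<or>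
    (\<exists>b\<in>Basis. \<bar>cutoff_scale F k b * (z \<bullet> b)\<bar> > 1)"
proof (cases "\<bar>fst z $ r_idx\<bar> \<le> real (Suc k)")
  case True
  let ?l = "scale_vec f (fst z $ r_idx)"
  have l: "1 \<le> ?l j" "?l j \<le> F k" for j
    using F(1)[of k] F(2)[OF True] f by (auto simp: scale_vec_def)
  have "cutoff_scale F k b \<le> phase_weight ?l b" if "b \<in> Basis" for b
    using that
  proof (cases rule: Basis_phase_cases)
    case (1 j)
    have "cutoff_scale F k b \<le> 1" by (simp add: 1 cutoff_scale_def axis_eq_0_iff)
    then show ?thesis using l(1)[of j] by (simp add: 1 phase_weight_q)
  next
    case (2 j)
    have "?l j \<le> real (Suc k) * F k"
      using mult_mono[of 1 "real (Suc k)" "?l j" "F k"] l[of j] by auto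
    then show ?thesis using l(1)[of j] by (simp add: 2 phase_weight_p cutoff_scale_def inverse_eq_divide) (rule divide_left_mono, auto)
  qed
  then show ?thesis by blast
next
  case False
  have "\<bar>cutoff_scale F k (dir_q r_idx) * (z \<bullet> dir_q r_idx)\<bar> > 1"
    using False by (simp add: cutoff_scale_def axis_eq_0_iff inner_prod_def inner_axis abs_mult field_simps)
  then show ?thesis using dir_Basis(1) by blast
qed

theorem theorem2p6:
  fixes f :: "real \<Rightarrow> real"
  assumes "smooth f"
    and "\<And>r. 1 \<le> f r"
    and "\<And>j. 1 \<le> j \<Longrightarrow> Linf_norm ((deriv ^^ j) (\<lambda>r. ln (f r))) < \<infinity>"
  shows "\<exists>C>0. \<exists>N::nat.
    \<forall>a \<in> (symbol_class f 0 :: ('n::{finite,linorder} phase \<Rightarrow> complex) set).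
    \<forall>u \<in> Cc_smooth. \<forall>t\<in>{0..1}. \<forall>h\<in>{0<..1}.
      Op t h a u \<in> L2 \<and>
      L2_norm (Op t h a u) \<le> C * enn2real (symbol_seminorm f 0 N a) * L2_norm u"
proof -
  let ?N = "4 * CARD('n)"
  have fc: "continuous_on UNIV f" by (rule smooth_continuous[OF assms(1)])
  have f_meas: "f \<in> borel_measurable borel" by (rule borel_measurable_continuous_onI[OF fc])
  note f = assms(2)
  have "\<forall>k. \<exists>F\<ge>1. \<forall>r. \<bar>r\<bar> \<le> real (Suc k) \<longrightarrow> f r \<le> F"
    using continuous_bounded_interval[OF fc] by blast
  then obtain F where F: "\<And>k. 1 \<le> F k" "\<And>k r. \<bar>r\<bar> \<le> real (Suc k) \<Longrightarrow> f r \<le> F k" by metis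
  let ?\<epsilon> = "cutoff_scale F :: nat \<Rightarrow> 'n phase \<Rightarrow> real"
  have \<epsilon>pos: "0 < ?\<epsilon> k b" for k b
    using F(1)[of k] unfolding cutoff_scale_def by (intro divide_pos_pos mult_pos_pos) auto
  obtain K where K: "K \<ge> 0" and jet_cutoff: "\<And>\<epsilon> W (z :: 'n phase). (\<forall>b\<in>Basis. 0 \<le> \<epsilon> b \<and> 0 \<le> W b) \<Longrightarrow>
     (\<forall>b\<in>Basis. \<epsilon> b \<le> W b) \<or> (\<exists>b\<in>Basis. \<bar>\<epsilon> b * (z \<bullet> b)\<bar> > 1) \<Longrightarrow> jet_bound ?N W z K (cutoff \<epsilon>)"
    using jet_bound_cutoff[where 'a = "'n phase" and L = ?N] by blast
  let ?O = "operator_constant TYPE('n) * (2 ^ ?N * K)"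
  have O: "0 \<le> ?O" using operator_constant_nonneg[where 'n = 'n] K by simp
  have "Op t h a u \<in> L2 \<and> L2_norm (Op t h a u) \<le> (?O + 1) * enn2real (symbol_seminorm f 0 ?N a) * L2_norm u"
    if a: "a \<in> symbol_class f 0" and u: "u \<in> Cc_smooth" and t: "t \<in> {0..1}" and h: "h \<in> {0<..1}"
    for a :: "'n phase \<Rightarrow> complex" and u :: "(real, 'n) vec \<Rightarrow> complex" and t h
  proof -
    define M where "M = enn2real (symbol_seminorm f 0 ?N a)"
    have M: "0 \<le> M" by (simp add: M_def)
    have sa: "smooth a" using a by (simp add: symbol_class_def)
    define W :: "'n phase \<Rightarrow> 'n phase \<Rightarrow> real" where "W z = phase_weight (scale_vec f (fst z $ r_idx))" for z
    have W: "0 \<le> W z b" if "b \<in> Basis" for z b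
    proof -
      have "0 \<le> scale_vec f (fst z $ r_idx) j" for j :: 'n by (rule order_trans[OF zero_le_one scale_vec_pos[OF f]])
      with that show ?thesis
        unfolding W_def by (cases rule: Basis_phase_cases) (auto simp: phase_weight_q phase_weight_p)
    qed
    have ja: "jet_bound ?N (W z) z M a" for z
      unfolding jet_bound_def M_def W_def using symbol_seminorm_jet[OF fc f a] by blast
    define b where "b z = a (fst z, h *\<^sub>R snd z)" for z
    have sb: "smooth b" unfolding b_def by (rule smooth_rescale_p[OF sa])
    have jb: "jet_bound ?N (W z) z M b" for z
    proof -
      have "W z = W (fst z, h *\<^sub>R snd z)" by (simp add: W_def)
      then show ?thesis
        unfolding b_def by (intro jet_bound_rescale_p sa W) (use h ja in auto)
    qed
    define c where "c k z = b z * cutoff (?\<epsilon> k) z" for k z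
    have sc: "smooth (c k)" for k unfolding c_def by (intro smooth_mult sb smooth_cutoff)
    define B where "B = 2 ^ ?N * (M * K)"
    have jc: "jet_bound ?N (W z) z B (c k)" for k z
    proof -
      have "jet_bound ?N (W z) z K (cutoff (?\<epsilon> k))"
      proof (rule jet_cutoff)
        show "\<forall>b\<in>Basis. 0 \<le> ?\<epsilon> k b \<and> 0 \<le> W z b" using W less_imp_le[OF \<epsilon>pos] by blast
        show "(\<forall>b\<in>Basis. ?\<epsilon> k b \<le> W z b) \<or> (\<exists>b\<in>Basis. \<bar>?\<epsilon> k b * (z \<bullet> b)\<bar> > 1)"
          unfolding W_def by (rule cutoff_scale_admissible[OF F f])
      qed
      then show ?thesis unfolding c_def B_def by (intro jet_bound_mult jb sb smooth_cutoff)
    qed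
    have lim: "(\<lambda>k. c k z) \<longlonglongrightarrow> b z" for z
      using tendsto_mult[OF tendsto_const[of "b z"] cutoff_tendsto[of ?\<epsilon> z, OF cutoff_scale_tendsto[OF F(1)]]]
      by (simp add: c_def)
    have su: "smooth u" using u by (simp add: Cc_smooth_def)
    obtain Ru where Ru: "\<And>y. norm y > Ru \<Longrightarrow> u y = 0"
    proof -
      have "bounded {q. u q \<noteq> 0}"
        using u bounded_subset[OF compact_imp_bounded closure_subset] by (auto simp: Cc_smooth_def)
      then obtain R where "\<And>q. q \<in> {q. u q \<noteq> 0} \<Longrightarrow> norm q \<le> R" unfolding bounded_iff by blast
      then show ?thesis using that[of R] by force
    qed
    have cu: "continuous_on UNIV u" by (rule smooth_continuous[OF su])
    have iu: "integrable lborel u" by (rule integrable_continuous_support[OF cu Ru])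
    have iu2: "integrable lborel (\<lambda>x. (norm (u x))\<^sup>2)"
      by (rule integrable_continuous_support[where R = Ru]) (auto intro!: continuous_intros cu simp: Ru)
    \<comment> \<open>the balls exhaust the space, so the truncation disappears in the limit\<close>
    define w where "w k x = indicat_real (cball 0 (real k)) x *\<^sub>R quantize t (c k) u x" for k x
    have wk: "w k \<in> borel_measurable borel \<and> integrable lborel (\<lambda>x. (norm (w k x))\<^sup>2) \<and>
      (\<integral>x. (norm (w k x))\<^sup>2 \<partial>lborel) \<le> (operator_constant TYPE('n) * B)\<^sup>2 * (\<integral>x. (norm (u x))\<^sup>2 \<partial>lborel)" for k
    proof -
      obtain R where cut: "\<forall>z. norm z > R \<longrightarrow> cutoff (?\<epsilon> k) z = 0" using cutoff_support[of "?\<epsilon> k", OF \<epsilon>pos] by blast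
      then have R: "c k z = 0" if "norm z > R" for z
        unfolding c_def using cut that by (simp only: mult_zero_right)
      have jc': "jet_bound ?N (phase_weight (scale_vec f (fst z $ r_idx))) z B (c k)" for z
        using jc[of z k] by (simp only: W_def)
      show ?thesis
        unfolding w_def
        using quantize_compact_bound[where \<rho> = "real k", OF f_meas f sc R jc' iu iu2 t] by blast
    qed
    have "Op t h a u = quantize t b u"
      using h by (auto simp: fun_eq_iff quantize_def b_def
        Op_rescale[OF smooth_continuous[OF sa] borel_measurable_continuous_onI[OF cu]])
    moreover have "(\<lambda>k. w k x) \<longlonglongrightarrow> quantize t b u x" for x
    proof -
      have jc': "jet_bound (2 * CARD('n)) (phase_weight (scale_vec f (fst z $ r_idx))) z B (c k)" for k z
        using jet_bound_mono[OF jc[of z k] order_refl W] by (simp add: W_def)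
      have q: "(\<lambda>k. quantize t (c k) u x) \<longlonglongrightarrow> quantize t b u x"
        by (rule quantize_tendsto[OF fc f sc jc' lim smooth_continuous[OF sb] su Ru t])
      have "eventually (\<lambda>k. quantize t (c k) u x = w k x) sequentially"
        using eventually_ge_at_top[of "nat \<lceil>norm x\<rceil>"] by eventually_elim (auto simp: w_def indicator_def)
      from Lim_transform_eventually[OF q this] show ?thesis .
    qed
    ultimately have lim_w: "(\<lambda>k. w k x) \<longlonglongrightarrow> Op t h a u x" for x by simp
    note res = L2_fatou[of w, OF _ _ _ lim_w, where D = "(operator_constant TYPE('n) * B)\<^sup>2 * (\<integral>x. (norm (u x))\<^sup>2 \<partial>lborel)"]
    have "Op t h a u \<in> borel_measurable borel" "integrable lborel (\<lambda>x. (norm (Op t h a u x))\<^sup>2)"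
      and le: "(\<integral>x. (norm (Op t h a u x))\<^sup>2 \<partial>lborel) \<le> (operator_constant TYPE('n) * B)\<^sup>2 * (\<integral>x. (norm (u x))\<^sup>2 \<partial>lborel)"
      using res wk by blast+
    then have "Op t h a u \<in> L2" by (simp add: L2_def)
    moreover have "L2_norm (Op t h a u) \<le> (?O + 1) * M * L2_norm u"
    proof -
      have B: "operator_constant TYPE('n) * B = ?O * M" by (simp add: B_def)
      have "L2_norm (Op t h a u) \<le> sqrt ((?O * M)\<^sup>2 * (\<integral>x. (norm (u x))\<^sup>2 \<partial>lborel))"
        unfolding L2_norm_def using le unfolding B by (rule real_sqrt_le_mono)
      also have "\<dots> = (?O * M) * L2_norm u"
        using O M by (simp add: real_sqrt_mult L2_norm_def)
      also have "\<dots> \<le> (?O + 1) * M * L2_norm u"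
        using M by (intro mult_right_mono) (auto simp: L2_norm_def)
      finally show ?thesis .
    qed
    ultimately show ?thesis by (simp add: M_def)
  qed
  \<comment> \<open>the summand \<open>1\<close> makes the constant positive\<close>
  moreover have "?O + 1 > 0" using O by simp
  ultimately show ?thesis by blast
qed

end
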